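(* Under the standing assumptions stated in the context, let $$v_n:=\sum_{0\le p<n}\mathbb{E}\left(V_p(\overline{Q}_{p,n}(1))^2\right)=\sum_{0\le q<n}\mathrm{Cov}_{q,\eta_{q-1}}\left(\overline{Q}_{q,n}(1),\overline{Q}_{q,n}(1)\right).$$ Assume that $N=N(n)$ depends on $n$ in such a way that $\lim_{n\to+\infty} n/N=\alpha\in\,]0,+\infty[$, and that $\lim_{n\to+\infty} v_n/n=\sigma^2\in\,]0,+\infty[$. Then, as $n\to+\infty$, the following convergence in distribution holds: $$\log\overline{\gamma}^N_n(1)\ \xrightarrow{\ d\ }\ \mathcal{N}\left(-\tfrac12\alpha\sigma^2,\ \alpha\sigma^2\right),$$ where $\mathcal{N}(u,v)$ denotes the normal distribution with mean $u$ and variance $v$.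
   Context: Setting. $(E,\mathcal{E})$ is a measurable space; $(X_n)_{n\ge0}$ is a Markov chain on $E$ with initial law $\eta_0$ and Markov transition kernels $(M_n)_{n\ge1}$; $(G_n)_{n\ge0}$ are positive bounded measurable functions on $E$. Write $\mu(f)=\int f\,d\mu$, $\mu K(dx')=\int\mu(dx)K(x,dx')$, $K(f)(x)=\int f(x')K(x,dx')$, $\|f\|=\sup_x|f(x)|$, $\mathrm{osc}(f)=\sup_{x,y}|f(x)-f(y)|$, and let $\mathrm{Osc}(E)$ be the set of measurable $f$ with $\mathrm{osc}(f)\le1$. For bounded measurable $f$ let $\gamma_n(f)=\mathbb{E}\big(f(X_n)\prod_{0\le p<n}G_p(X_p)\big)$ and $\eta_n(f)=\gamma_n(f)/\gamma_n(1)$. With $\Psi_G(\mu)(dx)=\frac{1}{\mu(G)}G(x)\mu(dx)$ and $\Phi_n(\mu)=\Psi_{G_{n-1}}(\mu)M_n$, one has $\eta_n=\Phi_n(\eta_{n-1})$ for $n\ge1$. A collection of Markov kernels $K_{n,\mu}$ ($n\ge1$, $\mu$ a probability measure on $E$) is given with $\Phi_n(\mu)=\mu K_{n,\mu}$. Conventions for $n=0$: $\Phi_0(\mu)=\eta_0$, $K_{0,\mu}(x,\cdot)=\eta_0$, $\eta_{-1}=\eta_{-1}^N=\eta_0$, $\mathcal{F}^N_{-1}$ trivial. Semigroups. For $0\le p\le n$: $Q_{p,n}(f)(x)=\mathbb{E}\big(f(X_n)\prod_{p\le q<n}G_q(X_q)\,\big|\,X_p=x\big)$, $\overline{Q}_{p,n}(f)=Q_{p,n}(f)/\eta_p(Q_{p,n}(1))$,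 and $P_{p,n}$ is the Markov kernel $P_{p,n}(f)=Q_{p,n}(f)/Q_{p,n}(1)$. The Dobrushin coefficient is $\beta(P)=\sup_{x,y\in E,\,f\in\mathrm{Osc}(E)}|P(f)(x)-P(f)(y)|$. Covariances. $\mathrm{Cov}_{n,\mu}(f_1,f_2)=\mu\big[K_{n,\mu}(f_1f_2)-K_{n,\mu}(f_1)K_{n,\mu}(f_2)\big]$. $(V_n)_{n\ge0}$ denotes a sequence of independent centered Gaussian random fields, indexed by bounded measurable functions, with $\mathbb{E}(V_n(f_1)V_n(f_2))=\mathrm{Cov}_{n,\eta_{n-1}}(f_1,f_2)$. Particle system. For $N\ge1$, $\xi_n^{(N)}=(\xi_n^{(N,i)})_{1\le i\le N}$, $n\ge0$, is an $E^N$-valued Markov chain; $\xi_0^{(N)}$ has law $\eta_0^{\otimes N}$ and, for $n\ge1$, conditionally on $\mathcal{F}^N_{n-1}=\sigma(\xi_p^{(N)},0\le p\le n-1)$, the variables $\xi_n^{(N,i)}$ are independent with respective laws $K_{n,\eta^N_{n-1}}(\xi^{(N,i)}_{n-1},\cdot)$, where $\eta^N_n=\frac1N\sum_{j=1}^N\delta_{\xi_n^{(N,j)}}$. Put $\gamma^N_n(1)=\prod_{0\le p<n}\eta^N_p(G_p)$ and $\overline{\gamma}^N_n(1)=\gamma^N_n(1)/\gamma_n(1)$. Standing assumptions. (i) $g_n:=\sup G_n/\inf G_n<\infty$ and $g:=\sup_n g_n<\infty$. (ii) $\beta(P_{p,n})\le a\,e^{-\lambda(n-p)}$ for all $0\le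 p\le n$, for some finite $a$ and some $\lambda>0$. (iii) There is a finite constant $\kappa$ such that for all $n$, all probability measures $\mu_1,\mu_2$ on $E$ and all $f\in\mathrm{Osc}(E)$, $\|[K_{n,\mu_1}-K_{n,\mu_2}](f)\|\le\kappa\,|(\mu_1-\mu_2)(T_n(f,\mu_2))|$, where $T_n(f,\mu_2)\in\mathrm{Osc}(E)$ may depend on $n,f,\mu_2$ (but not on $\mu_1$). *)

theory Defs
  imports "HOL-Probability.Probability"
begin

text \<open>
  The measurable space is represented by a measure \<open>E\<close> of which only \<open>space E\<close> and \<open>sets E\<close> matter.
  Probability measures on it are the elements of \<open>space (prob_algebra E)\<close>; Markov kernels on it are
  the elements of \<open>E \<rightarrow>\<^sub>M prob_algebra E\<close>.  The product \<open>\<mu> K\<close> is \<open>bind \<mu> K\<close>.  The supremum-type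
  quantities below are \<open>ereal\<close>-valued, so that they are \<open>\<infinity>\<close> when the supremum is infinite.
\<close>

section \<open>Test functions\<close>

definition bounded_measurable :: "'a measure \<Rightarrow> ('a \<Rightarrow> real) set" where
  "bounded_measurable E = {f \<in> borel_measurable E. bounded (f ` space E)}"

definition osc :: "'a measure \<Rightarrow> ('a \<Rightarrow> real) \<Rightarrow> ereal" where
  "osc E f = (SUP x\<in>space E. SUP y\<in>space E. ereal \<bar>f x - f y\<bar>)"

definition Osc :: "'a measure \<Rightarrow> ('a \<Rightarrow> real) set" where
  "Osc E = {f \<in> borel_measurable E. osc E f \<le> 1}"

definition sup_norm :: "'a measure \<Rightarrow> ('a \<Rightarrow> real) \<Rightarrow> ereal" where
  "sup_norm E f = (SUP x\<in>space E. ereal \<bar>f x\<bar>)"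

text \<open>The Dobrushin coefficient, for a Markov kernel given by its action on functions.\<close>

definition dobrushin :: "'a measure \<Rightarrow> (('a \<Rightarrow> real) \<Rightarrow> 'a \<Rightarrow> real) \<Rightarrow> ereal" where
  "dobrushin E P = (SUP x\<in>space E. SUP y\<in>space E. SUP f\<in>Osc E. ereal \<bar>P f x - P f y\<bar>)"

text \<open>Division in \<^typ>\<open>ereal\<close>: for a positive \<open>G\<close> with infimum 0 the ratio is \<open>\<infinity>\<close>.\<close>

definition sup_inf_ratio :: "'a measure \<Rightarrow> ('a \<Rightarrow> real) \<Rightarrow> ereal" where
  "sup_inf_ratio E G = (SUP x\<in>space E. ereal (G x)) / (INF x\<in>space E. ereal (G x))"

section \<open>Feynman-Kac measures and semigroups\<close>

text \<open>
  The law on path space of the Markov chain \<open>(X\<^sub>p, X\<^bsub>p+1\<^esub>, \<dots>)\<close> that has law \<open>\<nu>\<close> at time \<open>p\<close>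
  and moves from time \<open>n - 1\<close> to time \<open>n\<close> according to \<open>M n\<close>.  The coordinate \<open>\<omega> k\<close> is \<open>X\<^bsub>p+k\<^esub>\<close>.
\<close>

definition chain_law ::
  "'a measure \<Rightarrow> (nat \<Rightarrow> 'a \<Rightarrow> 'a measure) \<Rightarrow> nat \<Rightarrow> 'a measure \<Rightarrow> (nat \<Rightarrow> 'a) measure" where
  "chain_law E M p \<nu> =
     projective_family.lim UNIV
       (Ionescu_Tulcea.CI (\<lambda>k \<omega>. case k of 0 \<Rightarrow> \<nu> | Suc j \<Rightarrow> M (p + Suc j) (\<omega> j)) (\<lambda>_. E))
       (\<lambda>_. E)"

definition gamma ::
  "'a measure \<Rightarrow> 'a measure \<Rightarrow> (nat \<Rightarrow> 'a \<Rightarrow> 'a measure) \<Rightarrow> (nat \<Rightarrow> 'a \<Rightarrow> real) \<Rightarrow>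
     nat \<Rightarrow> ('a \<Rightarrow> real) \<Rightarrow> real" where
  "gamma E \<eta>\<^sub>0 M G n f = (\<integral>\<omega>. f (\<omega> n) * (\<Prod>p<n. G p (\<omega> p)) \<partial>chain_law E M 0 \<eta>\<^sub>0)"

text \<open>
  \<open>\<eta>\<^sub>n\<close> as a measure: the law of \<open>X\<^sub>n\<close> after the change of probability with density
  \<open>(\<Prod>p<n. G\<^sub>p(X\<^sub>p)) / \<gamma>\<^sub>n(1)\<close>.  Lemma \<open>integral_eta\<close> below states \<open>\<eta>\<^sub>n(f) = \<gamma>\<^sub>n(f) / \<gamma>\<^sub>n(1)\<close>.
\<close>

definition eta ::
  "'a measure \<Rightarrow> 'a measure \<Rightarrow> (nat \<Rightarrow> 'a \<Rightarrow> 'a measure) \<Rightarrow> (nat \<Rightarrow> 'a \<Rightarrow> real) \<Rightarrow>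
     nat \<Rightarrow> 'a measure" where
  "eta E \<eta>\<^sub>0 M G n =
     distr (density (chain_law E M 0 \<eta>\<^sub>0)
              (\<lambda>\<omega>. ennreal ((\<Prod>p<n. G p (\<omega> p)) / gamma E \<eta>\<^sub>0 M G n (\<lambda>_. 1))))
       E (\<lambda>\<omega>. \<omega> n)"

definition Psi :: "('a \<Rightarrow> real) \<Rightarrow> 'a measure \<Rightarrow> 'a measure" where
  "Psi G \<mu> = density \<mu> (\<lambda>x. ennreal (G x / (\<integral>y. G y \<partial>\<mu>)))"

definition Phi ::
  "(nat \<Rightarrow> 'a \<Rightarrow> 'a measure) \<Rightarrow> (nat \<Rightarrow> 'a \<Rightarrow> real) \<Rightarrow> nat \<Rightarrow> 'a measure \<Rightarrow> 'a measure" where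
  "Phi M G n \<mu> = bind (Psi (G (n - 1)) \<mu>) (M n)"

text \<open>Conditioning on \<open>X\<^sub>p = x\<close> means starting the chain at \<open>x\<close> at time \<open>p\<close>.\<close>

definition Q ::
  "'a measure \<Rightarrow> (nat \<Rightarrow> 'a \<Rightarrow> 'a measure) \<Rightarrow> (nat \<Rightarrow> 'a \<Rightarrow> real) \<Rightarrow>
     nat \<Rightarrow> nat \<Rightarrow> ('a \<Rightarrow> real) \<Rightarrow> 'a \<Rightarrow> real" where
  "Q E M G p n f x =
     (\<integral>\<omega>. f (\<omega> (n - p)) * (\<Prod>q\<in>{p..<n}. G q (\<omega> (q - p))) \<partial>chain_law E M p (return E x))"

definition Qbar ::
  "'a measure \<Rightarrow> 'a measure \<Rightarrow> (nat \<Rightarrow> 'a \<Rightarrow> 'a measure) \<Rightarrow> (nat \<Rightarrow> 'a \<Rightarrow> real) \<Rightarrow>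
     nat \<Rightarrow> nat \<Rightarrow> ('a \<Rightarrow> real) \<Rightarrow> 'a \<Rightarrow> real" where
  "Qbar E \<eta>\<^sub>0 M G p n f x =
     Q E M G p n f x / (\<integral>y. Q E M G p n (\<lambda>_. 1) y \<partial>eta E \<eta>\<^sub>0 M G p)"

definition P_kernel ::
  "'a measure \<Rightarrow> (nat \<Rightarrow> 'a \<Rightarrow> 'a measure) \<Rightarrow> (nat \<Rightarrow> 'a \<Rightarrow> real) \<Rightarrow>
     nat \<Rightarrow> nat \<Rightarrow> ('a \<Rightarrow> real) \<Rightarrow> 'a \<Rightarrow> real" where
  "P_kernel E M G p n f x = Q E M G p n f x / Q E M G p n (\<lambda>_. 1) x"

section \<open>Covariances and Gaussian fields\<close>

definition Cov ::
  "(nat \<Rightarrow> 'a measure \<Rightarrow> 'a \<Rightarrow> 'a measure) \<Rightarrow> nat \<Rightarrow> 'a measure \<Rightarrow>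
     ('a \<Rightarrow> real) \<Rightarrow> ('a \<Rightarrow> real) \<Rightarrow> real" where
  "Cov K n \<mu> f1 f2 =
     (\<integral>x. (\<integral>y. f1 y * f2 y \<partial>K n \<mu> x) - (\<integral>y. f1 y \<partial>K n \<mu> x) * (\<integral>y. f2 y \<partial>K n \<mu> x) \<partial>\<mu>)"

text \<open>The normal law with mean \<open>m\<close> and variance \<open>v \<ge> 0\<close>, a point mass for \<open>v = 0\<close>.\<close>

definition normal_law :: "real \<Rightarrow> real \<Rightarrow> real measure" where
  "normal_law m v =
     (if v = 0 then return borel m
      else density lborel (\<lambda>x. ennreal (normal_density m (sqrt v) x)))"

text \<open>
  Independent centered Gaussian random fields \<open>V\<^sub>0, V\<^sub>1, \<dots>\<close> on the probability space \<open>W\<close>, indexed by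
  the bounded measurable functions, where \<open>V\<^sub>n\<close> has covariance function \<open>C n\<close>.
\<close>

definition centered_gaussian_fields ::
  "'v measure \<Rightarrow> 'a measure \<Rightarrow> (nat \<Rightarrow> ('a \<Rightarrow> real) \<Rightarrow> ('a \<Rightarrow> real) \<Rightarrow> real) \<Rightarrow>
     (nat \<Rightarrow> ('a \<Rightarrow> real) \<Rightarrow> 'v \<Rightarrow> real) \<Rightarrow> bool" where
  "centered_gaussian_fields W E C V \<longleftrightarrow>
     prob_space W \<and>
     (\<forall>n. \<forall>f\<in>bounded_measurable E. V n f \<in> borel_measurable W) \<and>
     prob_space.indep_vars W (\<lambda>_. \<Pi>\<^sub>M f\<in>bounded_measurable E. borel)
       (\<lambda>n \<omega>. \<lambda>f\<in>bounded_measurable E. V n f \<omega>) UNIV \<and>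
     (\<forall>n J c. finite J \<and> J \<subseteq> bounded_measurable E \<longrightarrow>
        (\<exists>v\<ge>0. distr W borel (\<lambda>\<omega>. \<Sum>f\<in>J. c f * V n f \<omega>) = normal_law 0 v)) \<and>
     (\<forall>n. \<forall>f1\<in>bounded_measurable E. \<forall>f2\<in>bounded_measurable E.
        (\<integral>\<omega>. V n f1 \<omega> * V n f2 \<omega> \<partial>W) = C n f1 f2)"

section \<open>Particle system\<close>

text \<open>The empirical measure of the points \<open>x 1, \<dots>, x N\<close>.\<close>

definition empirical :: "'a measure \<Rightarrow> nat \<Rightarrow> (nat \<Rightarrow> 'a) \<Rightarrow> 'a measure" where
  "empirical E N x = distr (uniform_count_measure {1..N}) E x"

text \<open>
  Here and below \<open>\<xi> n i \<omega>\<close> is particle \<open>i\<close> at time \<open>n\<close>.  \<open>past E W N \<xi> n\<close> is the sigma-algebra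
  generated by the particles at all times strictly before \<open>n\<close>.
\<close>

definition past ::
  "'a measure \<Rightarrow> 'w measure \<Rightarrow> nat \<Rightarrow> (nat \<Rightarrow> nat \<Rightarrow> 'w \<Rightarrow> 'a) \<Rightarrow> nat \<Rightarrow> 'w measure" where
  "past E W N \<xi> n =
     sigma (space W) {\<xi> p i -` A \<inter> space W | p i A. p < n \<and> i \<in> {1..N} \<and> A \<in> sets E}"

definition particle_system ::
  "'a measure \<Rightarrow> 'a measure \<Rightarrow> (nat \<Rightarrow> 'a measure \<Rightarrow> 'a \<Rightarrow> 'a measure) \<Rightarrow>
     'w measure \<Rightarrow> nat \<Rightarrow> (nat \<Rightarrow> nat \<Rightarrow> 'w \<Rightarrow> 'a) \<Rightarrow> bool" where
  "particle_system E \<eta>\<^sub>0 K W N \<xi> \<longleftrightarrow>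
     prob_space W \<and>
     (\<forall>n. \<forall>i\<in>{1..N}. \<xi> n i \<in> W \<rightarrow>\<^sub>M E) \<and>
     distr W (\<Pi>\<^sub>M i\<in>{1..N}. E) (\<lambda>\<omega>. \<lambda>i\<in>{1..N}. \<xi> 0 i \<omega>) = (\<Pi>\<^sub>M i\<in>{1..N}. \<eta>\<^sub>0) \<and>
     (\<forall>n\<ge>1. \<forall>A \<in> {1..N} \<rightarrow> sets E.
        AE \<omega> in W.
          real_cond_exp W (past E W N \<xi> n)
            (indicator {\<omega> \<in> space W. \<forall>i\<in>{1..N}. \<xi> n i \<omega> \<in> A i}) \<omega> =
          (\<Prod>i=1..N. measure (K n (empirical E N (\<lambda>j. \<xi> (n - 1) j \<omega>)) (\<xi> (n - 1) i \<omega>)) (A i)))"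

definition gammaN ::
  "'a measure \<Rightarrow> (nat \<Rightarrow> 'a \<Rightarrow> real) \<Rightarrow> nat \<Rightarrow> (nat \<Rightarrow> nat \<Rightarrow> 'w \<Rightarrow> 'a) \<Rightarrow> nat \<Rightarrow> 'w \<Rightarrow> real" where
  "gammaN E G N \<xi> n \<omega> = (\<Prod>p<n. \<integral>x. G p x \<partial>empirical E N (\<lambda>j. \<xi> p j \<omega>))"

definition gammaN_bar ::
  "'a measure \<Rightarrow> 'a measure \<Rightarrow> (nat \<Rightarrow> 'a \<Rightarrow> 'a measure) \<Rightarrow> (nat \<Rightarrow> 'a \<Rightarrow> real) \<Rightarrow>
     nat \<Rightarrow> (nat \<Rightarrow> nat \<Rightarrow> 'w \<Rightarrow> 'a) \<Rightarrow> nat \<Rightarrow> 'w \<Rightarrow> real" where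
  "gammaN_bar E \<eta>\<^sub>0 M G N \<xi> n \<omega> = gammaN E G N \<xi> n \<omega> / gamma E \<eta>\<^sub>0 M G n (\<lambda>_. 1)"

text \<open>
  The variance \<open>v\<^sub>n\<close>.  The convention that \<open>\<eta>\<close> at time \<open>-1\<close> equals \<open>\<eta>\<^sub>0\<close> is met by truncated
  subtraction, since \<^term>\<open>eta E \<eta>\<^sub>0 M G 0\<close> is \<open>\<eta>\<^sub>0\<close>.
\<close>

definition asym_var ::
  "'a measure \<Rightarrow> 'a measure \<Rightarrow> (nat \<Rightarrow> 'a \<Rightarrow> 'a measure) \<Rightarrow> (nat \<Rightarrow> 'a \<Rightarrow> real) \<Rightarrow>
     (nat \<Rightarrow> 'a measure \<Rightarrow> 'a \<Rightarrow> 'a measure) \<Rightarrow> nat \<Rightarrow> real" where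
  "asym_var E \<eta>\<^sub>0 M G K n =
     (\<Sum>q<n. Cov K q (eta E \<eta>\<^sub>0 M G (q - 1))
        (Qbar E \<eta>\<^sub>0 M G q n (\<lambda>_. 1)) (Qbar E \<eta>\<^sub>0 M G q n (\<lambda>_. 1)))"

section \<open>Consistency of the definitions\<close>

lemma Ionescu_Tulcea_chain:
  assumes "\<nu> \<in> space (prob_algebra E)" "\<And>n. n \<ge> 1 \<Longrightarrow> M n \<in> E \<rightarrow>\<^sub>M prob_algebra E"
  shows "Ionescu_Tulcea (\<lambda>k \<omega>. case k of 0 \<Rightarrow> \<nu> | Suc j \<Rightarrow> M (p + Suc j) (\<omega> j)) (\<lambda>_. E)"
proof (rule Ionescu_Tulcea.intro)
  fix i :: nat
  have "(case i of 0 \<Rightarrow> (\<lambda>\<omega>. \<nu>) | Suc j \<Rightarrow> (\<lambda>\<omega>. M (p + Suc j) (\<omega> j)))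
      \<in> PiM {0..<i} (\<lambda>_. E) \<rightarrow>\<^sub>M prob_algebra E"
  proof (cases i)
    case 0
    then show ?thesis using assms(1) by simp
  next
    case (Suc j)
    have "(\<lambda>\<omega>. \<omega> j) \<in> PiM {0..<i} (\<lambda>_. E) \<rightarrow>\<^sub>M E"
      using Suc by (intro measurable_component_singleton) auto
    from measurable_compose[OF this assms(2)[of "p + Suc j"]] show ?thesis
      using Suc by simp
  qed
  moreover have "(\<lambda>\<omega>. case i of 0 \<Rightarrow> \<nu> | Suc j \<Rightarrow> M (p + Suc j) (\<omega> j)) =
      (case i of 0 \<Rightarrow> (\<lambda>\<omega>. \<nu>) | Suc j \<Rightarrow> (\<lambda>\<omega>. M (p + Suc j) (\<omega> j)))"
    by (cases i) auto
  ultimately have *: "(\<lambda>\<omega>. case i of 0 \<Rightarrow> \<nu> | Suc j \<Rightarrow> M (p + Suc j) (\<omega> j))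
      \<in> PiM {0..<i} (\<lambda>_. E) \<rightarrow>\<^sub>M prob_algebra E"
    by simp
  from * show "(\<lambda>\<omega>. case i of 0 \<Rightarrow> \<nu> | Suc j \<Rightarrow> M (p + Suc j) (\<omega> j))
      \<in> PiM {0..<i} (\<lambda>_. E) \<rightarrow>\<^sub>M subprob_algebra E"
    by (rule measurable_prob_algebraD)
  fix x :: "nat \<Rightarrow> 'a" assume "x \<in> space (PiM {0..<i} (\<lambda>_. E))"
  from measurable_space[OF * this]
  show "prob_space (case i of 0 \<Rightarrow> \<nu> | Suc j \<Rightarrow> M (p + Suc j) (x j))"
    by (simp add: space_prob_algebra)
qed

lemma
  assumes "\<nu> \<in> space (prob_algebra E)" "\<And>n. n \<ge> 1 \<Longrightarrow> M n \<in> E \<rightarrow>\<^sub>M prob_algebra E"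
  shows prob_space_chain_law: "prob_space (chain_law E M p \<nu>)"
    and sets_chain_law: "sets (chain_law E M p \<nu>) = sets (\<Pi>\<^sub>M i\<in>UNIV. E)"
    and distr_chain_law_0: "distr (chain_law E M p \<nu>) E (\<lambda>\<omega>. \<omega> 0) = \<nu>"
proof -
  define P where "P = (\<lambda>k (\<omega> :: nat \<Rightarrow> 'a). case k of 0 \<Rightarrow> \<nu> | Suc j \<Rightarrow> M (p + Suc j) (\<omega> j))"
  interpret IT: Ionescu_Tulcea P "\<lambda>_. E"
    unfolding P_def using assms by (rule Ionescu_Tulcea_chain)
  have eq: "chain_law E M p \<nu> = IT.PF.lim"
    by (simp add: chain_law_def P_def)
  have \<nu>: "sets \<nu> = sets E" "prob_space \<nu>" using assms(1) by (auto simp: space_prob_algebra)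
  interpret \<nu>: prob_space \<nu> by fact
  show s: "sets (chain_law E M p \<nu>) = sets (\<Pi>\<^sub>M i\<in>UNIV. E)"
    by (simp add: eq)
  have meas: "(\<lambda>\<omega>. \<omega> 0) \<in> chain_law E M p \<nu> \<rightarrow>\<^sub>M E"
    by (subst measurable_cong_sets[OF s refl]) simp
  have sp: "space (chain_law E M p \<nu>) = space (\<Pi>\<^sub>M i\<in>UNIV. E)"
    using s by (rule sets_eq_imp_space_eq)
  have C1: "IT.C 0 1 (\<lambda>_. undefined) = distr \<nu> (PiM {0..<1} (\<lambda>_. E)) (fun_upd (\<lambda>_. undefined) 0)"
  proof -
    have "IT.C 0 1 (\<lambda>_. undefined) =
        bind (return (PiM {0..<0::nat} (\<lambda>_. E)) (\<lambda>_. undefined)) (IT.eP 0)"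
      by simp
    also have "\<dots> = IT.eP 0 (\<lambda>_. undefined)"
      by (rule bind_return[OF IT.measurable_eP]) (simp add: space_PiM)
    finally have "IT.C 0 1 (\<lambda>_. undefined) = IT.eP 0 (\<lambda>_. undefined)" .
    moreover have "P 0 (\<lambda>_. undefined) = \<nu>" by (simp add: P_def)
    ultimately show ?thesis by (simp add: IT.eP_def)
  qed
  have key: "emeasure (chain_law E M p \<nu>) ((\<lambda>\<omega>. \<omega> 0) -` A \<inter> space (chain_law E M p \<nu>)) = emeasure \<nu> A"
    if A: "A \<in> sets E" for A
  proof -
    let ?X = "\<Pi>\<^sub>E i\<in>{0..<1::nat}. A"
    have X: "?X \<in> sets (PiM {0..<1::nat} (\<lambda>_. E))"
      using A by (intro sets_PiM_I_finite) auto
    have upd: "fun_upd (\<lambda>_. undefined) 0 \<in> \<nu> \<rightarrow>\<^sub>M PiM {0..<1::nat} (\<lambda>_. E)"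
      using \<nu> by (intro measurable_fun_upd[where J="{}"])
        (auto simp: space_PiM measurable_cong_sets[OF \<nu>(1) refl])
    have "(\<lambda>\<omega>. \<omega> 0) -` A \<inter> space (chain_law E M p \<nu>) = prod_emb UNIV (\<lambda>_. E) {0..<1} ?X"
      by (auto simp: sp prod_emb_def space_PiM PiE_iff extensional_def restrict_def)
    then have "emeasure (chain_law E M p \<nu>) ((\<lambda>\<omega>. \<omega> 0) -` A \<inter> space (chain_law E M p \<nu>)) =
        emeasure (IT.CI {0..<1}) ?X"
      using IT.lim[OF _ X] by (simp add: eq)
    also have "\<dots> = emeasure (IT.C 0 1 (\<lambda>_. undefined)) (prod_emb {0..<1} (\<lambda>_. E) {0..<1} ?X)"
      by (rule IT.emeasure_CI[OF _ X]) simp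
    also have "prod_emb {0..<1} (\<lambda>_. E) {0..<1} ?X = ?X"
      using sets.sets_into_space[OF X] unfolding space_PiM
      by (rule prod_emb_id)
    also have "emeasure (IT.C 0 1 (\<lambda>_. undefined)) ?X =
        emeasure \<nu> (fun_upd (\<lambda>_. undefined) 0 -` ?X \<inter> space \<nu>)"
      unfolding C1 by (rule emeasure_distr[OF upd X])
    also have "fun_upd (\<lambda>_. undefined) 0 -` ?X \<inter> space \<nu> = A"
      using sets.sets_into_space[OF A] sets_eq_imp_space_eq[OF \<nu>(1)]
      by (auto simp: PiE_iff extensional_def)
    finally show ?thesis .
  qed
  show "distr (chain_law E M p \<nu>) E (\<lambda>\<omega>. \<omega> 0) = \<nu>"
    by (rule measure_eqI) (auto simp: \<nu>(1) emeasure_distr[OF meas] key)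
  have "space \<nu> = space E" using \<nu>(1) by (rule sets_eq_imp_space_eq)
  with key[of "space E"] \<nu>.emeasure_space_1 measurable_space[OF meas]
  show "prob_space (chain_law E M p \<nu>)"
    by (intro prob_spaceI) (simp add: Int_absorb1 subset_eq)
qed

lemma
  assumes "\<eta>\<^sub>0 \<in> space (prob_algebra E)" "\<And>n. n \<ge> 1 \<Longrightarrow> M n \<in> E \<rightarrow>\<^sub>M prob_algebra E"
    and G: "\<And>n. G n \<in> bounded_measurable E" "\<And>n x. x \<in> space E \<Longrightarrow> G n x > 0"
  shows integral_eta: "f \<in> borel_measurable E \<Longrightarrow>
      (\<integral>x. f x \<partial>eta E \<eta>\<^sub>0 M G n) = gamma E \<eta>\<^sub>0 M G n f / gamma E \<eta>\<^sub>0 M G n (\<lambda>_. 1)"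
    and gamma_pos: "gamma E \<eta>\<^sub>0 M G n (\<lambda>_. 1) > 0"
    and prob_space_eta: "prob_space (eta E \<eta>\<^sub>0 M G n)"
    and eta_0: "eta E \<eta>\<^sub>0 M G 0 = \<eta>\<^sub>0"
proof -
  let ?L = "chain_law E M 0 \<eta>\<^sub>0"
  let ?D = "\<lambda>\<omega>. \<Prod>p<n. G p (\<omega> p)"
  interpret L: prob_space ?L using assms(1,2) by (rule prob_space_chain_law)
  have s: "sets ?L = sets (\<Pi>\<^sub>M i\<in>UNIV. E)" using assms(1,2) by (rule sets_chain_law)
  have X [measurable]: "(\<lambda>\<omega>. \<omega> k) \<in> ?L \<rightarrow>\<^sub>M E" for k
    by (subst measurable_cong_sets[OF s refl]) simp
  have Gm [measurable]: "G k \<in> borel_measurable E" for k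
    using G(1) by (auto simp: bounded_measurable_def)
  have GX [measurable]: "(\<lambda>\<omega>. G k (\<omega> k)) \<in> borel_measurable ?L" for k
    by (rule measurable_compose[OF X Gm])
  have Dm [measurable]: "?D \<in> borel_measurable ?L" by measurable
  have Dpos: "?D \<omega> > 0" if "\<omega> \<in> space ?L" for \<omega>
    using measurable_space[OF X that] G(2) by (intro prod_pos) auto
  have "\<forall>k. \<exists>B. \<forall>x\<in>space E. \<bar>G k x\<bar> \<le> B"
    using G(1) by (auto simp: bounded_measurable_def bounded_iff)
  then obtain B where B: "\<And>k x. x \<in> space E \<Longrightarrow> \<bar>G k x\<bar> \<le> B k" by metis
  have "\<bar>?D \<omega>\<bar> \<le> (\<Prod>p<n. B p)" if "\<omega> \<in> space ?L" for \<omega>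
    unfolding abs_prod using B measurable_space[OF X that] by (intro prod_mono) auto
  then have int: "integrable ?L ?D"
    by (intro L.integrable_const_bound[where B="\<Prod>p<n. B p"]) auto
  show pos: "gamma E \<eta>\<^sub>0 M G n (\<lambda>_. 1) > 0"
  proof -
    have "(\<integral>\<omega>. ?D \<omega> \<partial>?L) > 0"
      using int Dpos by (intro L.integral_less_AE_space[of "\<lambda>_. 0", simplified])
        (auto simp: L.emeasure_space_1)
    then show ?thesis by (simp add: gamma_def)
  qed
  let ?d = "\<lambda>\<omega>. ?D \<omega> / gamma E \<eta>\<^sub>0 M G n (\<lambda>_. 1)"
  have d0: "AE \<omega> in ?L. 0 \<le> ?d \<omega>"
    using pos Dpos by (auto intro!: AE_I2 divide_nonneg_pos less_imp_le)
  show "(\<integral>x. f x \<partial>eta E \<eta>\<^sub>0 M G n) = gamma E \<eta>\<^sub>0 M G n f / gamma E \<eta>\<^sub>0 M G n (\<lambda>_. 1)"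
    if f [measurable]: "f \<in> borel_measurable E"
  proof -
    have fX [measurable]: "(\<lambda>\<omega>. f (\<omega> n)) \<in> borel_measurable ?L"
      by (rule measurable_compose[OF X f])
    have "(\<integral>x. f x \<partial>eta E \<eta>\<^sub>0 M G n) = (\<integral>\<omega>. f (\<omega> n) \<partial>density ?L (\<lambda>\<omega>. ennreal (?d \<omega>)))"
      unfolding eta_def by (rule integral_distr) (simp_all add: X)
    also have "\<dots> = (\<integral>\<omega>. ?d \<omega> *\<^sub>R f (\<omega> n) \<partial>?L)"
      using d0 by (intro integral_density) auto
    also have "\<dots> = (\<integral>\<omega>. f (\<omega> n) * ?D \<omega> / gamma E \<eta>\<^sub>0 M G n (\<lambda>_. 1) \<partial>?L)"
      by (simp add: mult.commute)
    also have "\<dots> = gamma E \<eta>\<^sub>0 M G n f / gamma E \<eta>\<^sub>0 M G n (\<lambda>_. 1)"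
      by (simp add: gamma_def)
    finally show ?thesis .
  qed
  show "prob_space (eta E \<eta>\<^sub>0 M G n)"
    unfolding eta_def
  proof (intro prob_space.prob_space_distr prob_spaceI)
    have "(\<integral>\<^sup>+\<omega>. ennreal (?d \<omega>) \<partial>?L) = ennreal (\<integral>\<omega>. ?d \<omega> \<partial>?L)"
      using int d0 by (intro nn_integral_eq_integral) auto
    also have "(\<integral>\<omega>. ?d \<omega> \<partial>?L) = 1"
      using pos by (simp add: gamma_def)
    finally show "emeasure (density ?L (\<lambda>\<omega>. ennreal (?d \<omega>)))
        (space (density ?L (\<lambda>\<omega>. ennreal (?d \<omega>)))) = 1"
      by (simp add: emeasure_density cong: nn_integral_cong)
  qed simp
  show "eta E \<eta>\<^sub>0 M G 0 = \<eta>\<^sub>0"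
    using distr_chain_law_0[where p=0, OF assms(1,2)]
    by (simp add: eta_def gamma_def L.prob_space density_1)
qed

end

theory Submission
  imports Defs
begin

text \<open>
  Write \<open>h\<^sub>p\<close> for \<open>Q\<^bsub>p,n\<^esub>(1)\<close> normalised by \<open>\<eta>\<^sub>p(h\<^sub>p) = 1\<close>.  As \<open>\<Phi>\<^sub>p\<close> maps \<open>h\<^sub>p\<close> back to
  \<open>h\<^bsub>p-1\<^esub>\<close> up to the factor \<open>G\<^bsub>p-1\<^esub>\<close>, the normalised constant is exactly the product over \<open>p < n\<close> of the
  ratios \<open>R\<^sub>p = \<eta>\<^sub>p\<^sup>N(h\<^sub>p) / \<Phi>\<^sub>p(\<eta>\<^bsub>p-1\<^esub>\<^sup>N)(h\<^sub>p)\<close>, each of conditional mean 1 given the past, and by mixing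
  the \<open>h\<^sub>p\<close> are bounded above and below uniformly in \<open>p\<close> and \<open>n\<close>.
  With \<open>\<theta> = (t\<^sup>2 + \<i>t)/2\<close>, a Taylor expansion of \<open>R\<^sub>p\<^bsup>\<i>t\<^esup>\<close> around 1 gives
  \<open>E(R\<^sub>p\<^bsup>\<i>t\<^esup> | past) = exp (- \<theta> w\<^sub>p / N)\<close> up to an error of order \<open>N\<^bsup>-3/2\<^esup>\<close> in the mean, where \<open>w\<^sub>p\<close> is the
  \<open>p\<close>-th summand of \<open>v\<^sub>n\<close>; the conditional variance is compared with the deterministic \<open>w\<^sub>p\<close>
  through the Lipschitz property of the kernels and a time-uniform bound on \<open>\<eta>\<^sub>p\<^sup>N - \<eta>\<^sub>p\<close>.
  All the factors have modulus at most 1, so the errors add up to order \<open>n N\<^bsup>-3/2\<^esup>\<close>, the characteristic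
  function of the logarithm is close to \<open>exp (- \<theta> v\<^sub>n / N)\<close>, and Levy's continuity theorem applies.
\<close>

section \<open>Expansion of the characteristic function\<close>

text \<open>The number \<theta> comes from the power \<open>x powr s\<close> with
  \<open>s = \<i> * t\<close>, whose second Taylor coefficient at 1 is
  \<open>s * (s - 1) / 2 = - \<theta>\<close>. Its imaginary part, due to the curvature of the
  logarithm, becomes the mean of the limit law; its nonnegative real part keeps the factors in the
  unit disc. The total error vanishes because n N^(-3/2) is \<open>n / N\<close> times N^(-1/2). The
  bound on the empirical measures is uniform in time because the error at time \<open>p\<close> is a
  telescoping sum of local sampling errors, each carried to time \<open>p\<close> by the normalised
  semigroup and damped geometrically by mixing. A measurability obstacle shapes the middle part:
  \<open>K n \<mu>\<close> is a kernel for each fixed \<mu>, but nothing makes it measurable in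
  \<mu>, so an integral against a kernel indexed by an empirical measure is not known to be a random
  variable. The conditional mean is measurable because consistency with \<open>Phi\<close> makes it
  a quotient of empirical integrals; the conditional variance is replaced by a version built from
  conditional expectations, and its distance to the deterministic value is controlled by an
  integrable majorant.\<close>

lemma integral_complex_eqI:
  fixes f g :: "'a \<Rightarrow> complex"
  assumes f: "integrable M f" and g: "integrable M g"
    and "(\<integral>x. Re (f x) \<partial>M) = (\<integral>x. Re (g x) \<partial>M)" "(\<integral>x. Im (f x) \<partial>M) = (\<integral>x. Im (g x) \<partial>M)"
  shows "(\<integral>x. f x \<partial>M) = (\<integral>x. g x \<partial>M)"
  using assms by (simp add: complex_eq_iff)

lemma norm_integral_le:
  fixes f :: "'a \<Rightarrow> 'b :: {banach, second_countable_topology}" and g :: "'a \<Rightarrow> real"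
  assumes g: "integrable M g" and f: "\<And>x. x \<in> space M \<Longrightarrow> norm (f x) \<le> g x"
  shows "norm (\<integral>x. f x \<partial>M) \<le> (\<integral>x. g x \<partial>M)"
proof (rule order_trans[OF integral_norm_bound integral_mono'[OF g f]])
  show "0 \<le> g x" if "x \<in> space M" for x
    using norm_ge_zero f[OF that] by (rule order_trans)
qed

text \<open>The cubic term of the exponential series at \<bar>y\<bar>, whence the factor 6 = 3!. It
  turns bounds on exponential moments of both signs into bounds on third absolute moments.\<close>

lemma abs_power3_le_exp: "\<bar>y\<bar> ^ 3 \<le> 6 * (exp y + exp (- y))" for y :: real
proof -
  have "\<bar>y\<bar> ^ 3 / fact 3 \<le> (\<Sum>k<4. \<bar>y\<bar> ^ k / fact k)"
    by (rule member_le_sum) auto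
  also have "\<dots> \<le> exp \<bar>y\<bar>"
  proof -
    have "(\<Sum>k<4. \<bar>y\<bar> ^ k /\<^sub>R fact k) \<le> (\<Sum>k. \<bar>y\<bar> ^ k /\<^sub>R fact k)"
      by (intro sum_le_suminf summable_exp_generic) auto
    then show ?thesis by (simp add: exp_def divide_inverse mult.commute)
  qed
  also have "\<dots> \<le> exp y + exp (- y)"
    by (cases "y \<ge> 0") auto
  finally show ?thesis by (simp add: fact_numeral)
qed

lemma abs_le_exp: "\<bar>y\<bar> \<le> exp y + exp (- y)" for y :: real
proof (cases "y \<ge> 0")
  case True
  with exp_ge_add_one_self[of y] exp_gt_zero[of "-y"] show ?thesis by linarith
next
  case False
  with exp_ge_add_one_self[of "-y"] exp_gt_zero[of "y"] show ?thesis by linarith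
qed

text \<open>\<open>iexp (t * ln x)\<close> is the complex power \<open>x powr s\<close> with
  \<open>s = \<i> * t\<close>, expanded to second order around 1. The bound \<open>b\<close> keeps
  \<open>x\<close> away from 0, where the third derivative blows up like the inverse cube.\<close>

lemma iexp_ln_Taylor:
  fixes t b x :: real
  assumes b: "0 < b" "b \<le> 1" "b \<le> x"
  shows "cmod (iexp (t * ln x) -
      (1 + \<i> * t * (x - 1) - complex_of_real ((x - 1)\<^sup>2) * ((t\<^sup>2 + \<i> * t) / 2)))
    \<le> (\<bar>t\<bar> + 2) ^ 3 / b ^ 3 * \<bar>x - 1\<bar> ^ 3"
proof -
  define s where "s = \<i> * complex_of_real t"
  \<comment> \<open>\<open>f i\<close> is the \<open>i\<close>-th derivative of
    \<open>z powr s\<close>.\<close>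
  define f where "f i z = (\<Prod>j<i. s - of_nat j) * z powr (s - of_nat i)" for i :: nat and z
  \<comment> \<open>A half-line of positive reals is convex and misses the branch cut, so the
    complex Taylor theorem applies along it; \<open>b \<le> 1\<close> puts the base point 1 into
    it.\<close>
  let ?S = "complex_of_real ` {b..}"
  have S: "convex ?S"
    by (intro convex_linear_image) (auto simp: linear_iff scaleR_conv_of_real)
  have der: "(f i has_field_derivative f (Suc i) z) (at z within ?S)" if "z \<in> ?S" for i z
  proof -
    from that b have z: "z \<notin> \<real>\<^sub>\<le>\<^sub>0" by auto
    have "(f i has_field_derivative
        (\<Prod>j<i. s - of_nat j) * ((s - of_nat i) * z powr (s - of_nat i - 1))) (at z)"
      unfolding f_def using z by (auto intro!: derivative_eq_intros has_field_derivative_powr)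
    also have "(\<Prod>j<i. s - of_nat j) * ((s - of_nat i) * z powr (s - of_nat i - 1)) = f (Suc i) z"
      by (simp add: f_def algebra_simps)
    finally show ?thesis by (rule has_field_derivative_at_within)
  qed
  have half: "q / fact 2 \<le> q" if "q \<ge> 0" for q :: real
    using that by simp
  have ns: "cmod s = \<bar>t\<bar>" by (simp add: s_def norm_mult)
  \<comment> \<open>The factors of \<open>s * (s - 1) * (s - 2)\<close> are each at most
    \<open>\<bar>t\<bar> + 2\<close> in modulus, and as \<open>s\<close> is purely imaginary the
    remaining power has modulus \<open>1 / r ^ 3\<close>.\<close>
  have B: "cmod (f (Suc 2) z) \<le> (\<bar>t\<bar> + 2) ^ 3 / b ^ 3" if "z \<in> ?S" for z
  proof -
    from that obtain r where r: "z = of_real r" "r \<ge> b" by auto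
    have "cmod (f (Suc 2) z) = cmod s * cmod (s - 1) * cmod (s - 2) * (r powr (Re (s - 3)))"
      using r b by (simp add: f_def norm_mult norm_powr_real_powr eval_nat_numeral lessThan_Suc)
    also have "r powr (Re (s - 3)) = 1 / r ^ 3"
      using r b by (simp add: s_def powr_minus powr_numeral field_simps)
    also have "cmod s * cmod (s - 1) * cmod (s - 2) * (1 / r ^ 3)
        \<le> (\<bar>t\<bar> + 2) * (\<bar>t\<bar> + 2) * (\<bar>t\<bar> + 2) * (1 / b ^ 3)"
      using norm_triangle_ineq4[of s 1] norm_triangle_ineq4[of s 2] ns r b
      by (intro mult_mono divide_left_mono power_mono) auto
    finally show ?thesis
      by (simp add: power3_eq_cube)
  qed
  have "cmod (f 0 (of_real x) - (\<Sum>i\<le>2. f i (of_real 1) * (of_real x - of_real 1) ^ i / fact i))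
      \<le> (\<bar>t\<bar> + 2) ^ 3 / b ^ 3 * cmod (of_real x - of_real 1) ^ Suc 2 / fact 2"
    by (rule field_Taylor[OF S der B]) (use b in auto)
  also have "f 0 (of_real x) = iexp (t * ln x)"
    using b by (simp add: f_def powr_def s_def Ln_of_real mult_ac)
  also have "(\<Sum>i\<le>2. f i (of_real 1) * (of_real x - of_real 1) ^ i / fact i) =
      1 + \<i> * t * (x - 1) - complex_of_real ((x - 1)\<^sup>2) * ((t\<^sup>2 + \<i> * t) / 2)"
    by (simp add: f_def eval_nat_numeral s_def field_simps atMost_Suc lessThan_Suc)
  also have "cmod (of_real x - of_real 1) = \<bar>x - 1\<bar>"
    by (metis norm_of_real of_real_diff)
  also have "(\<bar>t\<bar> + 2) ^ 3 / b ^ 3 * \<bar>x - 1\<bar> ^ Suc 2 / fact 2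
      \<le> (\<bar>t\<bar> + 2) ^ 3 / b ^ 3 * \<bar>x - 1\<bar> ^ Suc 2"
    using b by (intro half) auto
  finally show ?thesis by (simp add: numeral_3_eq_3)
qed

lemma norm_exp_minus_le:
  fixes z :: complex
  shows "cmod (exp (- z) - (1 - z)) \<le> exp (cmod z) * (cmod z)\<^sup>2"
proof -
  have "cmod (exp (- z) - (\<Sum>i\<le>1. (- z) ^ i / fact i)) \<le> exp \<bar>Re (- z)\<bar> * cmod (- z) ^ Suc 1 / fact 1"
    by (rule Taylor_exp)
  also have "\<dots> = exp \<bar>Re z\<bar> * (cmod z)\<^sup>2"
    by (simp add: power2_eq_square)
  also have "\<dots> \<le> exp (cmod z) * (cmod z)\<^sup>2"
    by (intro mult_right_mono) (auto simp: abs_Re_le_cmod)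
  finally show ?thesis by (simp add: atMost_Suc)
qed

text \<open>Hoeffding's lemma on the interval from \<open>- c\<close> to \<open>c\<close> has the
  exponent \<open>l\<^sup>2 * (2 * c)\<^sup>2 / 8\<close>, rounded up here to
  \<open>l\<^sup>2 * c\<^sup>2\<close>. Negative \<open>l\<close> is reached by passing to
  \<open>- f\<close>.\<close>

lemma (in prob_space) Hoeffding_exp:
  fixes f :: "'a \<Rightarrow> real"
  assumes [measurable]: "f \<in> borel_measurable M"
    and f: "\<And>x. x \<in> space M \<Longrightarrow> \<bar>f x\<bar> \<le> c"
  shows "expectation (\<lambda>x. exp (l * f x)) \<le> exp (l * expectation f + l\<^sup>2 * c\<^sup>2)"
proof -
  have pos: "expectation (\<lambda>x. exp (l * g x)) \<le> exp (l * expectation g + l\<^sup>2 * c\<^sup>2)"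
    if l: "l > 0" and [measurable]: "g \<in> borel_measurable M"
      and g: "\<And>x. x \<in> space M \<Longrightarrow> \<bar>g x\<bar> \<le> c" for g :: "'a \<Rightarrow> real" and l
  proof -
    interpret interval_bounded_random_variable M g "- c" c
      proof unfold_locales
      show "AE x in M. g x \<in> {- c..c}"
        using g by (intro AE_I2) (simp add: abs_le_iff minus_le_iff)
    qed (rule that)
    have int: "integrable M (\<lambda>x. exp (l * (g x - expectation g)))"
    proof (rule integrable_const_bound[where B="exp (l * (c - expectation g))"])
      show "AE x in M. norm (exp (l * (g x - expectation g))) \<le> exp (l * (c - expectation g))"
        using g l by (intro AE_I2) (auto simp: abs_le_iff intro!: mult_left_mono)
    qed measurable
    have "ennreal (expectation (\<lambda>x. exp (l * (g x - expectation g)))) =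
        (\<integral>\<^sup>+x. ennreal (exp (l * (g x - expectation g))) \<partial>M)"
      using int by (simp add: nn_integral_eq_integral)
    also have "\<dots> \<le> ennreal (exp (l\<^sup>2 * (c - - c)\<^sup>2 / 8))"
      using Hoeffdings_lemma_nn_integral[OF l] by simp
    finally have "expectation (\<lambda>x. exp (l * (g x - expectation g))) \<le> exp (l\<^sup>2 * (c - - c)\<^sup>2 / 8)"
      by (simp add: ennreal_le_iff)
    also have "(c - - c)\<^sup>2 = 4 * c\<^sup>2" by (simp add: power2_eq_square algebra_simps)
    also have "exp (l\<^sup>2 * (4 * c\<^sup>2) / 8) \<le> exp (l\<^sup>2 * c\<^sup>2)" by simp
    finally have "exp (l * expectation g) * expectation (\<lambda>x. exp (l * (g x - expectation g)))
        \<le> exp (l * expectation g) * exp (l\<^sup>2 * c\<^sup>2)"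
      by simp
    also have "exp (l * expectation g) * expectation (\<lambda>x. exp (l * (g x - expectation g))) =
        expectation (\<lambda>x. exp (l * g x))"
      by (simp flip: integral_mult_right_zero exp_add add: algebra_simps)
    finally show ?thesis by (simp add: exp_add)
  qed
  consider "l > 0" | "l = 0" | "l < 0" by linarith
  then show ?thesis
  proof cases
    case 3
    then show ?thesis using pos[of "- l" "\<lambda>x. - f x"] f by simp
  qed (use pos[of l f] f prob_space in auto)
qed

text \<open>At \<open>l = 1 / sqrt n\<close> and its negative the exponent
  \<open>n * l\<^sup>2 * c\<^sup>2\<close> reduces to \<open>c\<^sup>2\<close>, so
  \<open>D / sqrt n\<close> has exponential moments bounded independently of \<open>n\<close>; these
  dominate its first and third absolute moments. The bound \<open>B\<close> provides
  integrability.\<close>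

lemma (in prob_space) moments_of_subgaussian:
  fixes D :: "'a \<Rightarrow> real"
  assumes [measurable]: "D \<in> borel_measurable M" and n: "n > 0"
    and D: "\<And>x. x \<in> space M \<Longrightarrow> \<bar>D x\<bar> \<le> B"
    and E: "\<And>l. expectation (\<lambda>x. exp (l * D x)) \<le> exp (n * l\<^sup>2 * c\<^sup>2)"
  shows "expectation (\<lambda>x. \<bar>D x / n\<bar>) \<le> 2 * exp (c\<^sup>2) / sqrt n"
    and "expectation (\<lambda>x. \<bar>D x / n\<bar> ^ 3) \<le> 12 * exp (c\<^sup>2) / (n * sqrt n)"
proof -
  let ?y = "\<lambda>x. D x / sqrt n"
  have int: "integrable M (\<lambda>x. exp (l * D x))" for l
  proof (rule integrable_const_bound[where B="exp (\<bar>l\<bar> * B)"])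
    show "AE x in M. norm (exp (l * D x)) \<le> exp (\<bar>l\<bar> * B)"
    proof (intro AE_I2)
      fix x assume "x \<in> space M"
      have "l * D x \<le> \<bar>l\<bar> * \<bar>D x\<bar>" by (metis abs_ge_self abs_mult)
      also have "\<dots> \<le> \<bar>l\<bar> * B" using D[OF \<open>x \<in> space M\<close>] by (intro mult_left_mono) auto
      finally show "norm (exp (l * D x)) \<le> exp (\<bar>l\<bar> * B)" by simp
    qed
  qed measurable
  have int1: "integrable M (\<lambda>x. exp (?y x))" and int2: "integrable M (\<lambda>x. exp (- ?y x))"
    using int[of "1 / sqrt n"] int[of "- (1 / sqrt n)"] by simp_all
  have nl: "n * (1 / sqrt n)\<^sup>2 * c\<^sup>2 = c\<^sup>2"
    using n by (simp add: power_divide)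
  have E2: "expectation (\<lambda>x. exp (?y x) + exp (- ?y x)) \<le> 2 * exp (c\<^sup>2)"
    using E[of "1 / sqrt n"] E[of "- (1 / sqrt n)"] nl int1 int2 by simp
  have "expectation (\<lambda>x. \<bar>?y x\<bar>) \<le> expectation (\<lambda>x. exp (?y x) + exp (- ?y x))"
    by (intro integral_mono' Bochner_Integration.integrable_add int1 int2 abs_le_exp) auto
  with E2 have "expectation (\<lambda>x. \<bar>?y x\<bar>) / sqrt n \<le> 2 * exp (c\<^sup>2) / sqrt n"
    using n by (intro divide_right_mono) auto
  then show "expectation (\<lambda>x. \<bar>D x / n\<bar>) \<le> 2 * exp (c\<^sup>2) / sqrt n"
    using n by (simp flip: integral_divide_zero add: abs_divide)
  have "expectation (\<lambda>x. \<bar>?y x\<bar> ^ 3) \<le> expectation (\<lambda>x. 6 * (exp (?y x) + exp (- ?y x)))"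
    by (intro integral_mono' integrable_mult_right Bochner_Integration.integrable_add int1 int2
        abs_power3_le_exp) auto
  also have "\<dots> \<le> 12 * exp (c\<^sup>2)"
    using E2 by (simp only: integral_mult_right_zero)
  finally have "expectation (\<lambda>x. \<bar>?y x\<bar> ^ 3) / (n * sqrt n) \<le> 12 * exp (c\<^sup>2) / (n * sqrt n)"
    using n by (intro divide_right_mono) auto
  moreover have "\<bar>D x / n\<bar> ^ 3 = \<bar>?y x\<bar> ^ 3 / (n * sqrt n)" for x
  proof -
    have "n * sqrt n * (sqrt n) ^ 3 = n ^ 3"
      using n by (simp add: power3_eq_cube)
    then show ?thesis
      using n by (simp add: abs_divide power_divide field_simps)
  qed
  ultimately show "expectation (\<lambda>x. \<bar>D x / n\<bar> ^ 3) \<le> 12 * exp (c\<^sup>2) / (n * sqrt n)"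
    by simp
qed

text \<open>Random factors are exchanged for constants one at a time. As all of them lie in the unit
  disc, an exchange costs at most \<open>e\<close> and is not amplified by the other factors. The
  hypothesis on \<open>e\<close> keeps the preceding product as a weight, so that an estimate
  conditional on the past can supply it.\<close>

lemma (in prob_space) expectation_prod_diff_le:
  fixes r :: "nat \<Rightarrow> 'a \<Rightarrow> complex" and d :: "nat \<Rightarrow> complex"
  assumes [measurable]: "\<And>p. p < n \<Longrightarrow> r p \<in> borel_measurable M"
    and r: "\<And>p x. p < n \<Longrightarrow> x \<in> space M \<Longrightarrow> cmod (r p x) \<le> 1"
    and d: "\<And>p. p < n \<Longrightarrow> cmod (d p) \<le> 1"
    and e: "\<And>p. p < n \<Longrightarrow> cmod (expectation (\<lambda>x. (\<Prod>q<p. r q x) * (r p x - d p))) \<le> e"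
  shows "cmod (expectation (\<lambda>x. \<Prod>q<n. r q x) - (\<Prod>q<n. d q)) \<le> n * e"
  using assms
proof (induction n)
  case 0
  then show ?case by (simp add: prob_space)
next
  case (Suc n)
  let ?A = "\<lambda>x. \<Prod>q<n. r q x"
  have A: "cmod (?A x) \<le> 1" if "x \<in> space M" for x
    unfolding prod_norm[symmetric] using Suc.prems(2) that by (intro prod_le_1) auto
  have [measurable]: "?A \<in> borel_measurable M" "r n \<in> borel_measurable M"
    using Suc.prems(1) by (auto intro!: borel_measurable_prod)
  have int: "integrable M ?A" "integrable M (\<lambda>x. ?A x * r n x)"
    using A Suc.prems(2)[of n]
    by (auto intro!: integrable_const_bound[where B=1] AE_I2 simp: norm_mult mult_le_one)
  \<comment> \<open>The last factor is exchanged behind the random product; what remains is the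
    induction hypothesis times \<open>d n\<close>.\<close>
  have "expectation (\<lambda>x. \<Prod>q<Suc n. r q x) - (\<Prod>q<Suc n. d q) =
      expectation (\<lambda>x. ?A x * (r n x - d n)) + (expectation ?A - (\<Prod>q<n. d q)) * d n"
    using int by (simp add: algebra_simps)
  also have "cmod \<dots> \<le> e + real n * e * 1"
  proof (intro order_trans[OF norm_triangle_ineq] add_mono)
    show "cmod (expectation (\<lambda>x. ?A x * (r n x - d n))) \<le> e"
      using Suc.prems(4)[of n] by simp
    show "cmod ((expectation ?A - (\<Prod>q<n. d q)) * d n) \<le> real n * e * 1"
      unfolding norm_mult
    proof (rule mult_mono)
      show "cmod (expectation ?A - (\<Prod>q<n. d q)) \<le> real n * e"
        using Suc.prems by (intro Suc.IH) auto
      then show "0 \<le> real n * e" using norm_ge_zero order_trans by blast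
    qed (use Suc.prems(3) in auto)
  qed
  finally show ?case by (simp add: algebra_simps)
qed

text \<open>One exchange of factors. \<open>A\<close> is the weight from the past, \<open>Y\<close>
  the relative increment, \<open>V\<close> its conditional second moment and \<open>u\<close> the
  deterministic substitute for \<open>V\<close>. In the Taylor polynomial the linear term vanishes
  by \<open>mean\<close>, the quadratic one becomes \<open>V\<close> by \<open>var\<close>, and
  \<open>1 - \<theta> * u\<close> is the beginning of the exponential.\<close>

lemma (in prob_space) iexp_ln_increment:
  fixes A :: "'a \<Rightarrow> complex" and Y V :: "'a \<Rightarrow> real" and t :: real
  defines "\<theta> \<equiv> (complex_of_real (t\<^sup>2) + \<i> * t) / 2"
  assumes [measurable]: "A \<in> borel_measurable M" "Y \<in> borel_measurable M" "V \<in> borel_measurable M"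
    and A: "\<And>x. x \<in> space M \<Longrightarrow> cmod (A x) \<le> 1"
    and b: "0 < b" "b \<le> 1" "\<And>x. x \<in> space M \<Longrightarrow> b \<le> 1 + Y x"
    and Y: "\<And>x. x \<in> space M \<Longrightarrow> \<bar>Y x\<bar> \<le> B"
    and V: "integrable M V"
    and mean: "expectation (\<lambda>x. A x * Y x) = 0"
    and var: "expectation (\<lambda>x. A x * (Y x)\<^sup>2) = expectation (\<lambda>x. A x * V x)"
    and u: "0 \<le> u" "u \<le> U" "expectation (\<lambda>x. \<bar>V x - u\<bar>) \<le> e"
    and d: "expectation (\<lambda>x. \<bar>Y x\<bar> ^ 3) \<le> d"
  shows "cmod (expectation (\<lambda>x. A x * (iexp (t * ln (1 + Y x)) - exp (- (\<theta> * u)))))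
    \<le> (\<bar>t\<bar> + 2) ^ 3 / b ^ 3 * d + cmod \<theta> * e + exp (cmod \<theta> * U) * (cmod \<theta>)\<^sup>2 * u\<^sup>2"
proof -
  \<comment> \<open>\<open>r1\<close> is the remainder of the power, of third order in
    \<open>Y\<close>; \<open>r2\<close> below is that of the exponential, of second order in
    \<open>u\<close>.\<close>
  define r1 where "r1 x = iexp (t * ln (1 + Y x)) -
      (1 + \<i> * t * Y x - complex_of_real ((Y x)\<^sup>2) * \<theta>)" for x
  define r2 where "r2 = exp (- (\<theta> * u)) - (1 - \<theta> * u)"
  have [measurable]: "r1 \<in> borel_measurable M" unfolding r1_def by measurable
  have r1: "cmod (r1 x) \<le> (\<bar>t\<bar> + 2) ^ 3 / b ^ 3 * \<bar>Y x\<bar> ^ 3" if "x \<in> space M" for x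
    using iexp_ln_Taylor[OF b(1,2) b(3)[OF that], of t] by (simp add: r1_def \<theta>_def)
  have B: "\<bar>Y x\<bar> ^ k \<le> B ^ k" if "x \<in> space M" for x k
    using Y[OF that] by (intro power_mono) auto
  have AY: "cmod (A x * complex_of_real (Y x ^ k)) \<le> B ^ k" if "x \<in> space M" for x k
    using mult_mono[OF A[OF that] B[OF that, of k]] by (simp add: norm_mult norm_power)
  have intA: "integrable M (\<lambda>x. A x * of_real (Y x ^ k))" for k
    using AY by (intro integrable_const_bound[where B="B ^ k"] AE_I2) auto
  have intY: "integrable M (\<lambda>x. \<bar>Y x\<bar> ^ 3)"
    using B by (intro integrable_const_bound[where B="B ^ 3"] AE_I2) (auto simp: power_abs)
  have intV: "integrable M (\<lambda>x. A x * of_real (V x - u))"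
  proof (rule Bochner_Integration.integrable_bound)
    show "integrable M (\<lambda>x. V x - u)" using V by simp
    show "AE x in M. cmod (A x * of_real (V x - u)) \<le> norm (V x - u)"
      using A by (intro AE_I2) (auto simp: norm_mult simp flip: of_real_diff intro!: mult_left_le_one_le)
  qed measurable
  have intr1: "integrable M (\<lambda>x. A x * r1 x)"
  proof (rule Bochner_Integration.integrable_bound)
    show "integrable M (\<lambda>x. (\<bar>t\<bar> + 2) ^ 3 / b ^ 3 * \<bar>Y x\<bar> ^ 3)" using intY by simp
    show "AE x in M. cmod (A x * r1 x) \<le> norm ((\<bar>t\<bar> + 2) ^ 3 / b ^ 3 * \<bar>Y x\<bar> ^ 3)"
    proof (intro AE_I2)
      fix x assume x: "x \<in> space M"
      have "cmod (A x * r1 x) \<le> cmod (r1 x)"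
        using A[OF x] by (simp add: norm_mult mult_left_le_one_le)
      also note r1[OF x]
      finally show "cmod (A x * r1 x) \<le> norm ((\<bar>t\<bar> + 2) ^ 3 / b ^ 3 * \<bar>Y x\<bar> ^ 3)"
        using b by simp
    qed
  qed measurable
  have intAA: "integrable M A" using intA[of 0] by simp
  have "expectation (\<lambda>x. A x * (iexp (t * ln (1 + Y x)) - exp (- (\<theta> * u)))) =
      expectation (\<lambda>x. \<i> * t * (A x * of_real (Y x ^ 1)) - \<theta> * (A x * of_real (Y x ^ 2))
        + \<theta> * u * A x + A x * r1 x - r2 * A x)"
    by (intro Bochner_Integration.integral_cong) (auto simp: r1_def r2_def algebra_simps)
  also have "\<dots> = \<i> * t * expectation (\<lambda>x. A x * of_real (Y x ^ 1))
      - \<theta> * expectation (\<lambda>x. A x * of_real (Y x ^ 2)) + \<theta> * u * expectation A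
      + expectation (\<lambda>x. A x * r1 x) - r2 * expectation A"
    using intA[of 1] intA[of 2] intAA intr1 by simp
  also have "\<dots> = - \<theta> * (expectation (\<lambda>x. A x * V x) - u * expectation A)
      + expectation (\<lambda>x. A x * r1 x) - r2 * expectation A"
    using mean var by (simp add: algebra_simps)
  also have "expectation (\<lambda>x. A x * V x) - u * expectation A =
      expectation (\<lambda>x. A x * of_real (V x - u))"
  proof -
    have "expectation (\<lambda>x. A x * V x) = expectation (\<lambda>x. A x * of_real (V x - u) + u * A x)"
      by (intro Bochner_Integration.integral_cong) (auto simp: algebra_simps)
    then show ?thesis using intV intAA by simp
  qed
  also have "cmod (- \<theta> * expectation (\<lambda>x. A x * of_real (V x - u))
      + expectation (\<lambda>x. A x * r1 x) - r2 * expectation A)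
    \<le> cmod \<theta> * e + (\<bar>t\<bar> + 2) ^ 3 / b ^ 3 * d + exp (cmod \<theta> * U) * (cmod \<theta>)\<^sup>2 * u\<^sup>2 * 1"
  proof (intro order_trans[OF norm_triangle_ineq4] order_trans[OF norm_triangle_ineq] add_mono)
    have "cmod (expectation (\<lambda>x. A x * of_real (V x - u))) \<le> expectation (\<lambda>x. \<bar>V x - u\<bar>)"
    proof (rule norm_integral_le)
      show "cmod (A x * of_real (V x - u)) \<le> \<bar>V x - u\<bar>" if "x \<in> space M" for x
        using A[OF that] by (auto simp: norm_mult simp flip: of_real_diff intro!: mult_left_le_one_le)
    qed (use V in simp)
    with u(3) show "cmod (- \<theta> * expectation (\<lambda>x. A x * of_real (V x - u))) \<le> cmod \<theta> * e"
      unfolding norm_mult norm_minus_cancel by (intro mult_left_mono) auto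
    have "cmod (expectation (\<lambda>x. A x * r1 x)) \<le> expectation (\<lambda>x. (\<bar>t\<bar> + 2) ^ 3 / b ^ 3 * \<bar>Y x\<bar> ^ 3)"
    proof (rule norm_integral_le)
      show "cmod (A x * r1 x) \<le> (\<bar>t\<bar> + 2) ^ 3 / b ^ 3 * \<bar>Y x\<bar> ^ 3" if "x \<in> space M" for x
        using r1[OF that] A[OF that]
        by (simp add: norm_mult) (meson mult_left_le_one_le norm_ge_zero order_trans)
    qed (use intY in simp)
    also have "\<dots> \<le> (\<bar>t\<bar> + 2) ^ 3 / b ^ 3 * d"
      using d b unfolding integral_mult_right_zero by (intro mult_left_mono) auto
    finally show "cmod (expectation (\<lambda>x. A x * r1 x)) \<le> (\<bar>t\<bar> + 2) ^ 3 / b ^ 3 * d" .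
    have "cmod r2 \<le> exp (cmod (\<theta> * u)) * (cmod (\<theta> * u))\<^sup>2"
      unfolding r2_def by (rule norm_exp_minus_le)
    also have "\<dots> = exp (cmod \<theta> * u) * ((cmod \<theta>)\<^sup>2 * u\<^sup>2)"
      using u by (simp add: norm_mult power_mult_distrib)
    also have "\<dots> \<le> exp (cmod \<theta> * U) * ((cmod \<theta>)\<^sup>2 * u\<^sup>2)"
      using u by (intro mult_right_mono) (auto intro!: mult_left_mono)
    finally have r2: "cmod r2 \<le> exp (cmod \<theta> * U) * (cmod \<theta>)\<^sup>2 * u\<^sup>2" by (simp add: mult_ac)
    have "cmod (expectation A) \<le> expectation (\<lambda>_. 1)"
      using A intAA by (intro norm_integral_le) auto
    with r2 show "cmod (r2 * expectation A) \<le> exp (cmod \<theta> * U) * (cmod \<theta>)\<^sup>2 * u\<^sup>2 * 1"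
      unfolding norm_mult by (intro mult_mono) (auto simp: prob_space)
  qed
  finally show ?thesis by (simp add: algebra_simps)
qed

section \<open>Conditionally independent samples\<close>

lemma bounded_measurable_bound:
  assumes "f \<in> bounded_measurable E"
  shows "\<exists>B\<ge>0. \<forall>x\<in>space E. \<bar>f x\<bar> \<le> B"
proof -
  obtain B where "\<And>x. x \<in> space E \<Longrightarrow> \<bar>f x\<bar> \<le> B"
    using assms by (auto simp: bounded_measurable_def bounded_iff)
  then show ?thesis by (intro exI[of _ "max B 0"]) (auto intro: max.coboundedI1)
qed

lemma bounded_measurableI:
  assumes "f \<in> borel_measurable E" "\<And>x. x \<in> space E \<Longrightarrow> \<bar>f x\<bar> \<le> B"
  shows "f \<in> bounded_measurable E"
  using assms by (auto simp: bounded_measurable_def bounded_iff)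

lemma bounded_measurableD: "f \<in> bounded_measurable E \<Longrightarrow> f \<in> borel_measurable E"
  by (simp add: bounded_measurable_def)

text \<open>Rounding \<open>k * f\<close> down to an integer: a bounded function has finitely many
  level sets, and their indicators recover \<open>f\<close> up to \<open>1 / k\<close>.\<close>

lemma floor_approximation:
  fixes f :: "'a \<Rightarrow> real"
  assumes k: "k > (0::nat)" and f: "\<And>x. x \<in> S \<Longrightarrow> \<bar>f x\<bar> \<le> B"
  defines "Z \<equiv> {- \<lceil>k * B\<rceil> - 1..\<lceil>k * B\<rceil>}"
  defines "g \<equiv> \<lambda>x. \<Sum>z\<in>Z. (of_int z / k) * indicator {x\<in>S. \<lfloor>k * f x\<rfloor> = z} x"
  assumes x: "x \<in> S"
  shows "\<bar>f x - g x\<bar> \<le> 1 / k"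
proof -
  have le: "\<bar>k * f x\<bar> \<le> k * B" using f[OF x] k by (simp add: abs_mult)
  have "\<lfloor>k * f x\<rfloor> \<in> Z"
    using le unfolding Z_def by (auto simp: abs_le_iff) linarith+
  moreover have "finite Z" by (simp add: Z_def)
  moreover have "g x = (\<Sum>z\<in>Z. if z = \<lfloor>k * f x\<rfloor> then of_int z / k else 0)"
    unfolding g_def using x by (intro sum.cong) (auto simp: indicator_def)
  ultimately have "g x = of_int \<lfloor>k * f x\<rfloor> / k"
    by (simp add: sum.delta)
  moreover have "k * f x - of_int \<lfloor>k * f x\<rfloor> \<le> 1" "of_int \<lfloor>k * f x\<rfloor> - k * f x \<le> 1"
    by linarith+
  ultimately show ?thesis using k by (simp add: field_simps abs_le_iff)
qed

text \<open>\<open>\<kappa> i e\<close> stands for the conditional law of \<open>\<xi> i\<close>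
  given \<open>F\<close>, prescribed on rectangles. Nothing is said about measurability in
  \<open>e\<close>, which is why the lemmas on averages take an \<open>F\<close>-measurable version
  \<open>m\<close> of \<open>kavg f\<close> as a separate argument.\<close>

locale conditionally_independent = prob_space W + subalg: finite_measure_subalgebra W F
  for W F :: "'w measure" +
  fixes E :: "'a measure" and I :: "'i set" and \<xi> :: "'i \<Rightarrow> 'w \<Rightarrow> 'a"
    and \<kappa> :: "'i \<Rightarrow> 'w \<Rightarrow> 'a measure"
  assumes finite_I: "finite I"
    and \<xi> [measurable]: "\<And>i. i \<in> I \<Longrightarrow> \<xi> i \<in> W \<rightarrow>\<^sub>M E"
    and \<kappa>: "\<And>i e. i \<in> I \<Longrightarrow> e \<in> space W \<Longrightarrow> \<kappa> i e \<in> space (prob_algebra E)"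
    and cond_exp_indicator: "\<And>A. A \<in> I \<rightarrow> sets E \<Longrightarrow>
      AE e in W. real_cond_exp W F (indicator {e \<in> space W. \<forall>i\<in>I. \<xi> i e \<in> A i}) e =
        (\<Prod>i\<in>I. measure (\<kappa> i e) (A i))"
begin

definition kint :: "('a \<Rightarrow> real) \<Rightarrow> 'i \<Rightarrow> 'w \<Rightarrow> real" where
  "kint f i e = (\<integral>x. f x \<partial>\<kappa> i e)"

lemma kernel:
  assumes "i \<in> I" "e \<in> space W"
  shows "prob_space (\<kappa> i e)" "sets (\<kappa> i e) = sets E" "space (\<kappa> i e) = space E"
  using \<kappa>[OF assms] by (auto simp: space_prob_algebra dest: sets_eq_imp_space_eq)

lemma integrable_kernel:
  assumes "i \<in> I" "e \<in> space W" "f \<in> bounded_measurable E"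
  shows "integrable (\<kappa> i e) f"
proof -
  interpret \<kappa>: prob_space "\<kappa> i e" using assms(1,2) by (rule kernel)
  obtain B where "\<And>x. x \<in> space E \<Longrightarrow> \<bar>f x\<bar> \<le> B"
    using assms(3) by (auto simp: bounded_measurable_def bounded_iff)
  with assms kernel[OF assms(1,2)] show ?thesis
    by (intro \<kappa>.integrable_const_bound[where B=B] AE_I2)
      (auto simp: bounded_measurable_def cong: measurable_cong_sets)
qed

lemma abs_kint_le:
  assumes "i \<in> I" "e \<in> space W" "f \<in> bounded_measurable E"
    and B: "\<And>x. x \<in> space E \<Longrightarrow> \<bar>f x\<bar> \<le> B"
  shows "\<bar>kint f i e\<bar> \<le> B"
proof -
  interpret \<kappa>: prob_space "\<kappa> i e" using assms(1,2) by (rule kernel)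
  have "\<bar>kint f i e\<bar> \<le> (\<integral>x. B \<partial>\<kappa> i e)"
    unfolding kint_def using integrable_kernel[OF assms(1-3)] B kernel[OF assms(1,2)]
    by (intro norm_integral_le[where 'b=real, simplified]) auto
  then show ?thesis by (simp add: \<kappa>.prob_space)
qed

text \<open>Conditional expectation contracts the uniform norm, so approximations within
  \<open>c / k\<close> of both \<open>X\<close> and \<open>H\<close> leave a gap of at most
  \<open>2 * c / k\<close> almost surely. The countably many \<open>k\<close> share one null
  set.\<close>

lemma cond_exp_uniform_limit:
  fixes X H :: "'w \<Rightarrow> real"
  assumes [measurable]: "X \<in> borel_measurable W" and "\<And>e. e \<in> space W \<Longrightarrow> \<bar>X e\<bar> \<le> B"
    and c: "c \<ge> 0"
    and approx: "\<And>k. k > (0::nat) \<Longrightarrow> \<exists>X' H'. X' \<in> borel_measurable W \<and>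
      (\<forall>e\<in>space W. \<bar>X e - X' e\<bar> \<le> c / k \<and> \<bar>H e - H' e\<bar> \<le> c / k) \<and>
      (AE e in W. real_cond_exp W F X' e = H' e)"
  shows "AE e in W. real_cond_exp W F X e = H e"
proof -
  have intX: "integrable W X" using assms(2) by (intro integrable_const_bound[where B=B] AE_I2) auto
  have "AE e in W. \<forall>k>0. \<bar>real_cond_exp W F X e - H e\<bar> \<le> 2 * c / real k"
    unfolding AE_all_countable
  proof safe
    fix k :: nat
    show "AE e in W. 0 < k \<longrightarrow> \<bar>real_cond_exp W F X e - H e\<bar> \<le> 2 * c / real k"
    proof (cases "k > 0")
      case True
      from approx[OF this] obtain X' H' where [measurable]: "X' \<in> borel_measurable W"
        and X': "\<And>e. e \<in> space W \<Longrightarrow> \<bar>X e - X' e\<bar> \<le> c / k"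
        and H': "\<And>e. e \<in> space W \<Longrightarrow> \<bar>H e - H' e\<bar> \<le> c / k"
        and eq: "AE e in W. real_cond_exp W F X' e = H' e" by blast
      have intd: "integrable W (\<lambda>e. X e - X' e)"
        using X' by (intro integrable_const_bound[where B="c / k"] AE_I2) auto
      from Bochner_Integration.integrable_diff[OF intX this] have intX': "integrable W X'" by simp
      have "AE e in W. real_cond_exp W F (\<lambda>e. X e - X' e) e \<le> c / k"
        using X' by (intro subalg.real_cond_exp_le_c intd AE_I2) (blast dest: abs_le_D1)
      moreover have "AE e in W. real_cond_exp W F (\<lambda>e. X e - X' e) e \<ge> - (c / k)"
      proof (intro subalg.real_cond_exp_ge_c intd AE_I2)
        show "- (c / k) \<le> X e - X' e" if "e \<in> space W" for e
          using X'[OF that] by linarith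
      qed
      moreover have "AE e in W. real_cond_exp W F (\<lambda>e. X e - X' e) e =
          real_cond_exp W F X e - real_cond_exp W F X' e"
        using intX intX' by (rule subalg.real_cond_exp_diff)
      ultimately have "AE e in W. \<bar>real_cond_exp W F X e - H e\<bar> \<le> 2 * c / real k"
        using eq AE_space
      proof eventually_elim
        case (elim e)
        have "\<bar>real_cond_exp W F X e - H' e\<bar> \<le> c / k"
          using elim by (simp add: abs_le_iff)
        with H'[of e] elim show ?case by (simp add: abs_le_iff)
      qed
      then show ?thesis by simp
    qed simp
  qed
  then show ?thesis
  proof eventually_elim
    case (elim e)
    have "\<bar>real_cond_exp W F X e - H e\<bar> \<le> 0"
    proof (rule LIMSEQ_le_const)
      show "(\<lambda>k. 2 * c / real k) \<longlonglongrightarrow> 0" by (rule lim_const_over_n)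
      show "\<exists>N. \<forall>n\<ge>N. \<bar>real_cond_exp W F X e - H e\<bar> \<le> 2 * c / real n"
        using elim by (intro exI[of _ 1]) auto
    qed
    then show ?case by simp
  qed
qed

text \<open>Passage from indicators to bounded functions, one coordinate at a time, by linearity and
  uniform approximation.\<close>

lemma cond_exp_prod:
  assumes "\<And>i. i \<in> I \<Longrightarrow> f i \<in> bounded_measurable E"
  shows "AE e in W. real_cond_exp W F (\<lambda>e. \<Prod>i\<in>I. f i (\<xi> i e)) e = (\<Prod>i\<in>I. kint (f i) i e)"
proof -
  have bm: "f i \<in> borel_measurable E" if "i \<in> I" "\<forall>i\<in>I. f i \<in> bounded_measurable E"
    for i and f :: "'i \<Rightarrow> 'a \<Rightarrow> real"
    using that by (auto simp: bounded_measurable_def)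
  \<comment> \<open>Generalised to families that consist of indicators outside \<open>J\<close>: the
    empty \<open>J\<close> is the assumption on rectangles, and \<open>J = I\<close> is the
    claim.\<close>
  have "AE e in W. real_cond_exp W F (\<lambda>e. \<Prod>i\<in>I. f i (\<xi> i e)) e = (\<Prod>i\<in>I. kint (f i) i e)"
    if "J \<subseteq> I" "\<forall>i\<in>I. f i \<in> bounded_measurable E"
      "\<forall>i\<in>I - J. \<exists>A\<in>sets E. f i = indicator A" for J f
  proof -
    have "finite J" using that finite_I by (rule_tac finite_subset)
    from this that show ?thesis
    proof (induction J arbitrary: f rule: finite_induct)
      case empty
      then have "\<forall>i\<in>I. \<exists>A\<in>sets E. f i = indicator A" by simp
      then obtain A where A: "\<And>i. i \<in> I \<Longrightarrow> A i \<in> sets E" "\<And>i. i \<in> I \<Longrightarrow> f i = indicator (A i)"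
        by metis
      note [measurable] = A(1)
      have S [measurable]: "{e \<in> space W. \<forall>i\<in>I. \<xi> i e \<in> A i} \<in> sets W"
        using finite_I by measurable
      have fS: "(\<Prod>i\<in>I. f i (\<xi> i e)) = indicator {e \<in> space W. \<forall>i\<in>I. \<xi> i e \<in> A i} e"
        if "e \<in> space W" for e
        using that finite_I A by (auto simp: indicator_def prod_zero_iff)
      have "AE e in W. real_cond_exp W F (\<lambda>e. \<Prod>i\<in>I. f i (\<xi> i e)) e =
          real_cond_exp W F (indicator {e \<in> space W. \<forall>i\<in>I. \<xi> i e \<in> A i}) e"
        using bm[OF _ empty(2)] by (intro subalg.real_cond_exp_cong AE_I2 fS) auto
      moreover have "AE e in W. real_cond_exp W F (indicator {e \<in> space W. \<forall>i\<in>I. \<xi> i e \<in> A i}) e =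
          (\<Prod>i\<in>I. measure (\<kappa> i e) (A i))"
        using A by (intro cond_exp_indicator) auto
      ultimately show ?case
        using AE_space
      proof eventually_elim
        case (elim e)
        have "(\<Prod>i\<in>I. measure (\<kappa> i e) (A i)) = (\<Prod>i\<in>I. kint (f i) i e)"
        proof (rule prod.cong[OF refl])
          fix i assume i: "i \<in> I"
          show "measure (\<kappa> i e) (A i) = kint (f i) i e"
            using A[OF i] kernel[OF i elim(3)] sets.sets_into_space[OF A(1)[OF i]]
            by (simp add: kint_def Int_absorb1)
        qed
        with elim show ?case by simp
      qed
    next
      case (insert j J)
      from insert.prems have j: "j \<in> I" by auto
      \<comment> \<open>With an indicator in coordinate \<open>j\<close> the family falls under the
        induction hypothesis for \<open>J\<close>.\<close>
      have IH: "AE e in W. real_cond_exp W F (\<lambda>e. \<Prod>i\<in>I. (f(j := indicator A)) i (\<xi> i e)) e =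
          (\<Prod>i\<in>I. kint ((f(j := indicator A)) i) i e)" if "A \<in> sets E" for A
        using insert that by (intro insert.IH) (auto simp: bounded_measurable_def bounded_iff indicator_def)
      let ?P = "\<lambda>e. \<Prod>i\<in>I - {j}. f i (\<xi> i e)" and ?R = "\<lambda>e. \<Prod>i\<in>I - {j}. kint (f i) i e"
      have split: "(\<Prod>i\<in>I. (f(j := u)) i (\<xi> i e)) = u (\<xi> j e) * ?P e"
        "(\<Prod>i\<in>I. kint ((f(j := u)) i) i e) = kint u j e * ?R e" for u e
        using j finite_I by (auto simp: prod.remove[of I j] cong: prod.cong_simp)
      have split': "(\<Prod>i\<in>I. f i (\<xi> i e)) = f j (\<xi> j e) * ?P e"
        "(\<Prod>i\<in>I. kint (f i) i e) = kint (f j) j e * ?R e" for e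
        using j finite_I by (auto simp: prod.remove[of I j])
      have "\<forall>i\<in>I. \<exists>B\<ge>0. \<forall>x\<in>space E. \<bar>f i x\<bar> \<le> B"
        using insert.prems(2) by (meson bounded_measurable_bound)
      then obtain B where B: "\<And>i. i \<in> I \<Longrightarrow> B i \<ge> 0"
        "\<And>i x. i \<in> I \<Longrightarrow> x \<in> space E \<Longrightarrow> \<bar>f i x\<bar> \<le> B i" by metis
      \<comment> \<open>A bound for the product of the other factors, on the particle side as well
        as on the kernel side; it converts an error \<open>1 / k\<close> in coordinate
        \<open>j\<close> into \<open>c / k\<close>.\<close>
      define c where "c = (\<Prod>i\<in>I - {j}. B i)"
      have c: "c \<ge> 0" using B by (auto simp: c_def intro: prod_nonneg)
      have \<xi>s: "\<xi> i e \<in> space E" if "i \<in> I" "e \<in> space W" for i e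
        using measurable_space[OF \<xi>] that by blast
      have P: "\<bar>?P e\<bar> \<le> c" if "e \<in> space W" for e
        unfolding abs_prod c_def using B \<xi>s that by (intro prod_mono) auto
      have R: "\<bar>?R e\<bar> \<le> c" if "e \<in> space W" for e
        unfolding abs_prod c_def using B abs_kint_le insert.prems(2) that by (intro prod_mono) auto
      have [measurable]: "f i \<in> borel_measurable E" if "i \<in> I" for i
        using bm[OF that insert.prems(2)] .
      have Pm [measurable]: "?P \<in> borel_measurable W" by measurable
      show ?case
        unfolding split'
      proof (rule cond_exp_uniform_limit[where B="B j * c" and c=c])
        show "\<bar>f j (\<xi> j e) * ?P e\<bar> \<le> B j * c" if "e \<in> space W" for e
          unfolding abs_mult using B(1) B(2) \<xi>s P that j by (intro mult_mono) auto
        show "(\<lambda>e. f j (\<xi> j e) * ?P e) \<in> borel_measurable W" using j by measurable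
        fix k :: nat assume k: "k > 0"
        define Z where "Z = {- \<lceil>k * B j\<rceil> - 1..\<lceil>k * B j\<rceil>}"
        define A where "A z = {x \<in> space E. \<lfloor>k * f j x\<rfloor> = z}" for z :: int
        define u where "u x = (\<Sum>z\<in>Z. (of_int z / k) * indicator (A z) x)" for x
        have u: "\<bar>f j x - u x\<bar> \<le> 1 / k" if "x \<in> space E" for x
          using floor_approximation[OF k B(2)[OF j] that] by (simp add: u_def A_def Z_def)
        have A [measurable]: "A z \<in> sets E" for z
          unfolding A_def using j by measurable
        have ub: "u \<in> borel_measurable E" unfolding u_def by measurable
        have uB: "u \<in> bounded_measurable E"
        proof -
          have "\<bar>u x\<bar> \<le> B j + 1 / k" if "x \<in> space E" for x
            using u[OF that] B(2)[OF j that] by linarith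
          with ub show ?thesis by (auto simp: bounded_measurable_def bounded_iff)
        qed
        have kint_u: "kint u j e = (\<Sum>z\<in>Z. (of_int z / k) * kint (indicator (A z)) j e)"
          if "e \<in> space W" for e
        proof -
          have "integrable (\<kappa> j e) (indicat_real (A z))" for z
            using j that by (intro integrable_kernel)
              (auto simp: bounded_measurable_def bounded_iff indicator_def)
          then show ?thesis unfolding kint_def u_def by simp
        qed
        have AEz: "AE e in W. real_cond_exp W F (\<lambda>e. (of_int z / k) * (indicator (A z) (\<xi> j e) * ?P e)) e =
            (of_int z / k) * (kint (indicator (A z)) j e * ?R e)" for z
        proof -
          have "integrable W (\<lambda>e. indicator (A z) (\<xi> j e) * ?P e)"
            using P c j by (intro integrable_const_bound[where B=c] AE_I2) (auto simp: indicator_def)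
          from subalg.real_cond_exp_cmult[OF this, of "of_int z / k"] IH[OF A, of z]
          show ?thesis unfolding split by eventually_elim simp
        qed
        have "AE e in W. real_cond_exp W F
            (\<lambda>e. \<Sum>z\<in>Z. (of_int z / k) * (indicator (A z) (\<xi> j e) * ?P e)) e =
            (\<Sum>z\<in>Z. real_cond_exp W F (\<lambda>e. (of_int z / k) * (indicator (A z) (\<xi> j e) * ?P e)) e)"
          using P c j by (intro subalg.real_cond_exp_sum integrable_mult_right
            integrable_const_bound[where B=c] AE_I2) (auto simp: indicator_def)
        moreover have "AE e in W. \<forall>z\<in>Z. real_cond_exp W F
            (\<lambda>e. (of_int z / k) * (indicator (A z) (\<xi> j e) * ?P e)) e =
            (of_int z / k) * (kint (indicator (A z)) j e * ?R e)"
          using AEz by (intro AE_finite_allI) (auto simp: Z_def)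
        ultimately have "AE e in W. real_cond_exp W F (\<lambda>e. u (\<xi> j e) * ?P e) e = kint u j e * ?R e"
          using AE_space
        proof eventually_elim
          case (elim e)
          have uP: "(\<lambda>e. \<Sum>z\<in>Z. (of_int z / k) * (indicator (A z) (\<xi> j e) * ?P e)) =
              (\<lambda>e. u (\<xi> j e) * ?P e)"
            by (simp add: u_def sum_distrib_right mult.assoc)
          have "kint u j e * ?R e =
              (\<Sum>z\<in>Z. (of_int z / k) * (kint (indicator (A z)) j e * ?R e))"
            using elim by (simp only: kint_u sum_distrib_right mult.assoc)
          with elim show ?case unfolding uP by simp
        qed
        moreover have "\<forall>e\<in>space W. \<bar>f j (\<xi> j e) * ?P e - u (\<xi> j e) * ?P e\<bar> \<le> c / k \<and>
            \<bar>kint (f j) j e * ?R e - kint u j e * ?R e\<bar> \<le> c / k"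
        proof safe
          fix e assume e: "e \<in> space W"
          show "\<bar>f j (\<xi> j e) * ?P e - u (\<xi> j e) * ?P e\<bar> \<le> c / k"
            using mult_mono[OF u[OF \<xi>s[OF j e]] P[OF e]] by (simp flip: left_diff_distrib add: abs_mult)
          have fj: "f j \<in> bounded_measurable E" using insert.prems(2) j by auto
          have "kint (f j) j e - kint u j e = kint (\<lambda>x. f j x - u x) j e"
            unfolding kint_def using integrable_kernel[OF j e] fj uB by simp
          also have "\<bar>\<dots>\<bar> \<le> 1 / k"
          proof (rule abs_kint_le[OF j e _ u])
            show "(\<lambda>x. f j x - u x) \<in> bounded_measurable E"
              using u fj uB by (auto simp: bounded_measurable_def bounded_iff)
          qed
          finally show "\<bar>kint (f j) j e * ?R e - kint u j e * ?R e\<bar> \<le> c / k"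
            using mult_mono[OF _ R[OF e]] by (fastforce simp flip: left_diff_distrib simp: abs_mult)
        qed
        moreover have "(\<lambda>e. u (\<xi> j e) * ?P e) \<in> borel_measurable W"
          using measurable_compose[OF \<xi>[OF j] ub] by measurable
        ultimately show "\<exists>X' H'. X' \<in> borel_measurable W \<and>
            (\<forall>e\<in>space W. \<bar>f j (\<xi> j e) * ?P e - X' e\<bar> \<le> c / k \<and>
              \<bar>kint (f j) j e * ?R e - H' e\<bar> \<le> c / k) \<and>
            (AE e in W. real_cond_exp W F X' e = H' e)"
          by (intro exI[of _ "\<lambda>e. u (\<xi> j e) * ?P e"]
              exI[of _ "\<lambda>e. kint u j e * ?R e"] conjI)
      qed (rule c)
    qed
  qed
  from this[of I f] assms show ?thesis by auto
qed


text \<open>The product formula with the constant 1 in the other coordinates.\<close>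

lemma cond_exp_single:
  assumes "i \<in> I" "f \<in> bounded_measurable E"
  shows "AE e in W. real_cond_exp W F (\<lambda>e. f (\<xi> i e)) e = kint f i e"
proof -
  let ?f = "(\<lambda>_ _. 1)(i := f)"
  have "AE e in W. real_cond_exp W F (\<lambda>e. \<Prod>j\<in>I. ?f j (\<xi> j e)) e = (\<Prod>j\<in>I. kint (?f j) j e)"
    using assms by (intro cond_exp_prod) (auto intro!: bounded_measurableI[where B=1])
  then show ?thesis using AE_space
  proof eventually_elim
    case (elim e)
    have "kint (\<lambda>_. 1) j e = 1" if "j \<in> I" for j
      using prob_space.prob_space[OF kernel(1)[OF that elim(2)]] by (simp add: kint_def)
    with elim assms finite_I show ?case
      by (simp add: prod.remove[of I i] cong: prod.cong_simp)
  qed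
qed

lemma cond_exp_pair:
  assumes "i \<in> I" "j \<in> I" "i \<noteq> j" "f \<in> bounded_measurable E" "g \<in> bounded_measurable E"
  shows "AE e in W. real_cond_exp W F (\<lambda>e. f (\<xi> i e) * g (\<xi> j e)) e = kint f i e * kint g j e"
proof -
  let ?f = "(\<lambda>_ _. 1)(i := f, j := g)"
  have "AE e in W. real_cond_exp W F (\<lambda>e. \<Prod>k\<in>I. ?f k (\<xi> k e)) e = (\<Prod>k\<in>I. kint (?f k) k e)"
    using assms by (intro cond_exp_prod) (auto intro!: bounded_measurableI[where B=1])
  then show ?thesis using AE_space
  proof eventually_elim
    case (elim e)
    have "kint (\<lambda>_. 1) j e = 1" if "j \<in> I" for j
      using prob_space.prob_space[OF kernel(1)[OF that elim(2)]] by (simp add: kint_def)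
    with elim assms finite_I show ?case
      by (simp add: prod.remove[of I i] prod.remove[of "I - {i}" j] cong: prod.cong_simp)
  qed
qed

section \<open>Conditional moments of sample averages\<close>

lemma \<xi>_space: "i \<in> I \<Longrightarrow> e \<in> space W \<Longrightarrow> \<xi> i e \<in> space E"
  using measurable_space[OF \<xi>] by blast

lemma measurable_F: "A \<in> borel_measurable F \<Longrightarrow> A \<in> borel_measurable W"
  by (rule measurable_from_subalg[OF subalg.subalg])

definition avg :: "('a \<Rightarrow> real) \<Rightarrow> 'w \<Rightarrow> real" where
  "avg f e = (\<Sum>i\<in>I. f (\<xi> i e)) / card I"

definition kavg :: "('a \<Rightarrow> real) \<Rightarrow> 'w \<Rightarrow> real" where
  "kavg f e = (\<Sum>i\<in>I. kint f i e) / card I"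

lemma measurable_avg [measurable]: "f \<in> bounded_measurable E \<Longrightarrow> avg f \<in> borel_measurable W"
  unfolding avg_def using bounded_measurableD
  by (intro borel_measurable_divide borel_measurable_sum borel_measurable_const
      measurable_compose[OF \<xi>]) auto

lemma sum_le_card:
  fixes h :: "'i \<Rightarrow> real" and B :: real
  assumes "\<And>i. i \<in> I \<Longrightarrow> \<bar>h i\<bar> \<le> B"
  shows "\<bar>\<Sum>i\<in>I. h i\<bar> \<le> card I * B"
  using sum_norm_bound[of I h B] assms by simp

lemma abs_avg_le:
  assumes B: "\<And>x. x \<in> space E \<Longrightarrow> \<bar>f x\<bar> \<le> B" and e: "e \<in> space W" and I: "I \<noteq> {}"
  shows "\<bar>avg f e\<bar> \<le> B"
proof -
  have "card I > 0" using I finite_I by (simp add: card_gt_0_iff)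
  moreover have "\<bar>\<Sum>i\<in>I. f (\<xi> i e)\<bar> \<le> card I * B"
    using B \<xi>_space e by (intro sum_le_card) auto
  ultimately show ?thesis by (simp add: avg_def abs_divide field_simps)
qed

lemma abs_kavg_le:
  assumes f: "f \<in> bounded_measurable E" and B: "\<And>x. x \<in> space E \<Longrightarrow> \<bar>f x\<bar> \<le> B"
    and e: "e \<in> space W" and I: "I \<noteq> {}"
  shows "\<bar>kavg f e\<bar> \<le> B"
proof -
  have "card I > 0" using I finite_I by (simp add: card_gt_0_iff)
  moreover have "\<bar>\<Sum>i\<in>I. kint f i e\<bar> \<le> card I * B"
    using B f e by (intro sum_le_card abs_kint_le) auto
  ultimately show ?thesis by (simp add: kavg_def abs_divide field_simps)
qed

text \<open>The tower property, particle by particle. The kernel means are identified only after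
  summation, where \<open>m\<close> supplies a measurable version of their average.\<close>

lemma expectation_avg:
  assumes f: "f \<in> bounded_measurable E"
    and A: "A \<in> borel_measurable F" "\<And>e. e \<in> space W \<Longrightarrow> \<bar>A e\<bar> \<le> C"
    and m: "m \<in> borel_measurable F" "\<And>e. e \<in> space W \<Longrightarrow> m e = kavg f e" and I: "I \<noteq> {}"
  shows "expectation (\<lambda>e. A e * avg f e) = expectation (\<lambda>e. A e * m e)"
proof -
  obtain B where B: "B \<ge> 0" "\<And>x. x \<in> space E \<Longrightarrow> \<bar>f x\<bar> \<le> B" using bounded_measurable_bound[OF f] by blast
  note [measurable] = measurable_F[OF A(1)] measurable_F[OF m(1)] bounded_measurableD[OF f]
  have C: "C \<ge> 0" using A(2) not_empty by (meson abs_ge_zero ex_in_conv order_trans)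
  have int: "integrable W (\<lambda>e. f (\<xi> i e))" if "i \<in> I" for i
    using B(2) \<xi>_space that by (intro integrable_const_bound[where B=B] AE_I2) auto
  have intA: "integrable W (\<lambda>e. A e * f (\<xi> i e))" if "i \<in> I" for i
    using B A(2) C \<xi>_space that
    by (intro integrable_const_bound[where B="C * B"] AE_I2) (auto simp: abs_mult intro!: mult_mono)
  have "expectation (\<lambda>e. A e * avg f e) = (\<Sum>i\<in>I. expectation (\<lambda>e. A e * f (\<xi> i e))) / card I"
    using intA by (simp add: avg_def sum_distrib_left)
  also have "\<dots> = (\<Sum>i\<in>I. expectation (\<lambda>e. A e * real_cond_exp W F (\<lambda>e. f (\<xi> i e)) e)) / card I"
    using subalg.real_cond_exp_intg(2)[OF intA A(1)] by (intro arg_cong2[where f="(/)"] sum.cong) auto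
  also have "\<dots> = expectation (\<lambda>e. A e * (\<Sum>i\<in>I. real_cond_exp W F (\<lambda>e. f (\<xi> i e)) e) / card I)"
    using subalg.real_cond_exp_intg(1)[OF intA A(1)] by (simp add: sum_distrib_left)
  also have "\<dots> = expectation (\<lambda>e. A e * m e)"
  proof (rule integral_cong_AE)
    have "AE e in W. \<forall>i\<in>I. real_cond_exp W F (\<lambda>e. f (\<xi> i e)) e = kint f i e"
      using finite_I f by (intro AE_finite_allI cond_exp_single) auto
    then show "AE e in W. A e * (\<Sum>i\<in>I. real_cond_exp W F (\<lambda>e. f (\<xi> i e)) e) / card I = A e * m e"
      using AE_space by eventually_elim (simp add: m(2) kavg_def)
  qed measurable
  finally show ?thesis .
qed

text \<open>Given \<open>F\<close>, the exponential of the sum factorises into kernel integrals, and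
  Hoeffding's bound applies to each of them under its own kernel law.\<close>

lemma expectation_exp_avg:
  fixes c l :: real
  assumes f: "f \<in> bounded_measurable E" and c: "\<And>x. x \<in> space E \<Longrightarrow> \<bar>f x\<bar> \<le> c"
    and m: "m \<in> borel_measurable F" "\<And>e. e \<in> space W \<Longrightarrow> m e = kavg f e" and I: "I \<noteq> {}"
  shows "expectation (\<lambda>e. exp (l * (card I * (avg f e - m e)))) \<le> exp (card I * l\<^sup>2 * c\<^sup>2)"
proof -
  let ?n = "real (card I)" and ?e = "\<lambda>x. exp (l * f x)"
  note [measurable] = measurable_F[OF m(1)] bounded_measurableD[OF f]
  have n: "?n > 0" using I finite_I by (simp add: card_gt_0_iff)
  have mc: "\<bar>m e\<bar> \<le> c" if "e \<in> space W" for e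
    using abs_kavg_le[OF f c that I] m(2)[OF that] by simp
  have eb: "exp (l * y) \<le> exp (\<bar>l\<bar> * c)" if "\<bar>y\<bar> \<le> c" for y
  proof -
    have "l * y \<le> \<bar>l\<bar> * \<bar>y\<bar>" using abs_ge_self[of "l * y"] by (simp add: abs_mult)
    also have "\<dots> \<le> \<bar>l\<bar> * c" using that by (intro mult_left_mono) auto
    finally show ?thesis by simp
  qed
  have e: "?e \<in> bounded_measurable E"
    using eb c by (intro bounded_measurableI[where B="exp (\<bar>l\<bar> * c)"]) auto
  have Am: "(\<lambda>e. exp (- l * (?n * m e))) \<in> borel_measurable F" using m(1) by measurable
  have int: "integrable W (\<lambda>e. exp (- l * (?n * m e)) * (\<Prod>i\<in>I. ?e (\<xi> i e)))"
  proof (rule integrable_const_bound[where B="exp (\<bar>l\<bar> * c) ^ card I * exp (\<bar>l\<bar> * c) ^ card I"])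
    show "AE e in W. norm (exp (- l * (?n * m e)) * (\<Prod>i\<in>I. ?e (\<xi> i e))) \<le>
        exp (\<bar>l\<bar> * c) ^ card I * exp (\<bar>l\<bar> * c) ^ card I"
    proof (intro AE_I2)
      fix e assume e: "e \<in> space W"
      have "exp (- l * (?n * m e)) = exp (l * (- m e)) ^ card I"
        by (simp flip: exp_of_nat_mult add: mult_ac)
      also have "\<dots> \<le> exp (\<bar>l\<bar> * c) ^ card I"
        using mc[OF e] by (intro power_mono eb) auto
      finally have 1: "exp (- l * (?n * m e)) \<le> exp (\<bar>l\<bar> * c) ^ card I" .
      have "(\<Prod>i\<in>I. ?e (\<xi> i e)) \<le> (\<Prod>i\<in>I. exp (\<bar>l\<bar> * c))"
        using e by (intro prod_mono conjI eb c \<xi>_space) auto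
      with 1 show "norm (exp (- l * (?n * m e)) * (\<Prod>i\<in>I. ?e (\<xi> i e))) \<le>
          exp (\<bar>l\<bar> * c) ^ card I * exp (\<bar>l\<bar> * c) ^ card I"
        by (simp add: abs_mult abs_prod mult_mono prod_nonneg)
    qed
  qed measurable
  have "expectation (\<lambda>e. exp (l * (?n * (avg f e - m e)))) =
      expectation (\<lambda>e. exp (- l * (?n * m e)) * (\<Prod>i\<in>I. ?e (\<xi> i e)))"
  proof (rule Bochner_Integration.integral_cong[OF refl])
    fix e
    have "l * (?n * (avg f e - m e)) = - l * (?n * m e) + (\<Sum>i\<in>I. l * f (\<xi> i e))"
      using n by (simp add: avg_def algebra_simps flip: sum_distrib_left)
    then show "exp (l * (?n * (avg f e - m e))) = exp (- l * (?n * m e)) * (\<Prod>i\<in>I. ?e (\<xi> i e))"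
      using finite_I by (simp only: exp_add exp_sum)
  qed
  also have "\<dots> = expectation (\<lambda>e. exp (- l * (?n * m e)) *
      real_cond_exp W F (\<lambda>e. \<Prod>i\<in>I. ?e (\<xi> i e)) e)"
    by (rule subalg.real_cond_exp_intg(2)[OF int Am, symmetric]) measurable
  also have "\<dots> \<le> expectation (\<lambda>e. exp (?n * l\<^sup>2 * c\<^sup>2))"
  proof (rule integral_mono_AE)
    show "integrable W (\<lambda>e. exp (- l * (?n * m e)) * real_cond_exp W F (\<lambda>e. \<Prod>i\<in>I. ?e (\<xi> i e)) e)"
      by (rule subalg.real_cond_exp_intg(1)[OF int Am]) measurable
    show "AE e in W. exp (- l * (?n * m e)) * real_cond_exp W F (\<lambda>e. \<Prod>i\<in>I. ?e (\<xi> i e)) e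
        \<le> exp (?n * l\<^sup>2 * c\<^sup>2)"
      using cond_exp_prod[of "\<lambda>_. ?e", OF e] AE_space
    proof eventually_elim
      case (elim e)
      have "(\<Prod>i\<in>I. kint ?e i e) \<le> (\<Prod>i\<in>I. exp (l * kint f i e + l\<^sup>2 * c\<^sup>2))"
      proof (rule prod_mono)
        fix i assume i: "i \<in> I"
        note k = kernel[OF i elim(2)]
        interpret \<kappa>: prob_space "\<kappa> i e" by (rule k)
        have "kint ?e i e \<le> exp (l * kint f i e + l\<^sup>2 * c\<^sup>2)"
          unfolding kint_def using c k bounded_measurableD[OF f]
          by (intro \<kappa>.Hoeffding_exp) (auto cong: measurable_cong_sets)
        moreover have "0 \<le> kint ?e i e" by (simp add: kint_def)
        ultimately show "0 \<le> kint ?e i e \<and> kint ?e i e \<le> exp (l * kint f i e + l\<^sup>2 * c\<^sup>2)" by simp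
      qed
      \<comment> \<open>The kernel means add up to \<open>?n * m e\<close>, which the prefactor
        \<open>exp (- l * (?n * m e))\<close> cancels exactly.\<close>
      also have "\<dots> = exp (l * (?n * m e) + ?n * l\<^sup>2 * c\<^sup>2)"
        using finite_I n m(2)[OF elim(2)]
        by (simp add: kavg_def sum.distrib mult_ac flip: exp_sum sum_distrib_left)
      finally show ?case using elim by (simp add: exp_add exp_minus field_simps)
    qed
  qed simp
  finally show ?thesis by (simp add: prob_space)
qed

lemma moments_avg:
  fixes c :: real
  assumes f: "f \<in> bounded_measurable E" and c: "\<And>x. x \<in> space E \<Longrightarrow> \<bar>f x\<bar> \<le> c"
    and m: "m \<in> borel_measurable F" "\<And>e. e \<in> space W \<Longrightarrow> m e = kavg f e" and I: "I \<noteq> {}"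
  shows "expectation (\<lambda>e. \<bar>avg f e - m e\<bar>) \<le> 2 * exp (c\<^sup>2) / sqrt (card I)"
    and "expectation (\<lambda>e. \<bar>avg f e - m e\<bar> ^ 3) \<le> 12 * exp (c\<^sup>2) / (card I * sqrt (card I))"
proof -
  let ?n = "real (card I)"
  have n: "?n > 0" using I finite_I by (simp add: card_gt_0_iff)
  have D: "(\<lambda>e. ?n * (avg f e - m e)) \<in> borel_measurable W"
    using measurable_F[OF m(1)] measurable_avg[OF f] by measurable
  have "\<bar>?n * (avg f e - m e)\<bar> \<le> ?n * (2 * c)" if "e \<in> space W" for e
  proof -
    have "\<bar>avg f e\<bar> \<le> c" "\<bar>m e\<bar> \<le> c"
      using abs_avg_le[OF c that I] abs_kavg_le[OF f c that I] m(2)[OF that] by simp_all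
    then show ?thesis using n by (simp add: abs_mult)
  qed
  note * = moments_of_subgaussian[OF D n this expectation_exp_avg[OF f c m I]]
  show "expectation (\<lambda>e. \<bar>avg f e - m e\<bar>) \<le> 2 * exp (c\<^sup>2) / sqrt (card I)"
    using *(1) n by simp
  show "expectation (\<lambda>e. \<bar>avg f e - m e\<bar> ^ 3) \<le> 12 * exp (c\<^sup>2) / (card I * sqrt (card I))"
    using *(2) n by simp
qed

text \<open>Covariances between distinct particles vanish, so only the individual variances remain.
  The variance is delivered as a measurable \<open>v\<close> that agrees almost surely with the
  kernel expression, since the latter is not known to be measurable in \<open>e\<close>.\<close>

lemma conditional_variance_avg:
  assumes f: "f \<in> bounded_measurable E"
    and m: "m \<in> borel_measurable F" "\<And>e. e \<in> space W \<Longrightarrow> m e = kavg f e" and I: "I \<noteq> {}"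
  obtains v where "v \<in> borel_measurable F"
    "AE e in W. v e = kavg (\<lambda>x. (f x)\<^sup>2) e - (\<Sum>i\<in>I. (kint f i e)\<^sup>2) / card I"
    "\<And>(A :: 'w \<Rightarrow> real) C. A \<in> borel_measurable F \<Longrightarrow> (\<And>e. e \<in> space W \<Longrightarrow> \<bar>A e\<bar> \<le> C) \<Longrightarrow>
      expectation (\<lambda>e. A e * (avg f e - m e)\<^sup>2) = expectation (\<lambda>e. A e * (v e / card I))"
proof -
  let ?n = "real (card I)"
  have n: "?n > 0" using I finite_I by (simp add: card_gt_0_iff)
  obtain B where B: "B \<ge> 0" "\<And>x. x \<in> space E \<Longrightarrow> \<bar>f x\<bar> \<le> B" using bounded_measurable_bound[OF f] by blast
  note [measurable] = measurable_F[OF m(1)] bounded_measurableD[OF f] measurable_avg[OF f]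
  have f2: "(\<lambda>x. (f x)\<^sup>2) \<in> bounded_measurable E"
  proof (rule bounded_measurableI)
    show "\<bar>(f x)\<^sup>2\<bar> \<le> B\<^sup>2" if "x \<in> space E" for x
      using power_mono[OF B(2)[OF that], of 2] by simp
  qed measurable
  \<comment> \<open>Conditional expectations take the place of kernel integrals, so that
    \<open>v\<close> below is \<open>F\<close>-measurable by construction.\<close>
  define c where "c i = real_cond_exp W F (\<lambda>e. f (\<xi> i e))" for i
  define s where "s i = real_cond_exp W F (\<lambda>e. (f (\<xi> i e))\<^sup>2)" for i
  define v where "v e = (\<Sum>i\<in>I. s i e - (c i e)\<^sup>2) / ?n" for e
  have [measurable]: "c i \<in> borel_measurable F" "s i \<in> borel_measurable F" for i
    by (simp_all add: c_def s_def)
  have vF: "v \<in> borel_measurable F" unfolding v_def by measurable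
  have AEc: "AE e in W. \<forall>i\<in>I. c i e = kint f i e \<and> s i e = kint (\<lambda>x. (f x)\<^sup>2) i e"
    using finite_I cond_exp_single[OF _ f] cond_exp_single[OF _ f2]
    by (intro AE_finite_allI AE_conjI) (auto simp: c_def s_def)
  have AEv: "AE e in W. v e = kavg (\<lambda>x. (f x)\<^sup>2) e - (\<Sum>i\<in>I. (kint f i e)\<^sup>2) / ?n"
    using AEc by eventually_elim (simp add: v_def kavg_def sum_subtractf diff_divide_distrib)
  have AEv_bound: "AE e in W. \<bar>v e\<bar> \<le> 2 * B\<^sup>2"
    using AEv AE_space
  proof eventually_elim
    case (elim e)
    have "\<bar>kavg (\<lambda>x. (f x)\<^sup>2) e\<bar> \<le> B\<^sup>2"
      using abs_kavg_le[OF f2 _ elim(2) I] power_mono[OF B(2), of _ 2] by simp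
    moreover have "\<bar>\<Sum>i\<in>I. (kint f i e)\<^sup>2\<bar> \<le> ?n * B\<^sup>2"
      using power_mono[OF abs_kint_le[OF _ elim(2) f B(2)], of _ 2] by (intro sum_le_card) auto
    then have "\<bar>(\<Sum>i\<in>I. (kint f i e)\<^sup>2) / ?n\<bar> \<le> B\<^sup>2"
      using n by (simp add: abs_divide field_simps)
    ultimately show ?case using elim by linarith
  qed
  show thesis
  proof (rule that[OF vF AEv])
    fix A :: "'w \<Rightarrow> real" and C assume A: "A \<in> borel_measurable F" "\<And>e. e \<in> space W \<Longrightarrow> \<bar>A e\<bar> \<le> C"
    note [measurable] = measurable_F[OF A(1)] measurable_F[OF vF]
    have C: "C \<ge> 0" using A(2) not_empty by (meson abs_ge_zero ex_in_conv order_trans)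
    have mB: "\<bar>m e\<bar> \<le> B" if "e \<in> space W" for e
      using abs_kavg_le[OF f B(2) that I] m(2)[OF that] by simp
    have aB: "\<bar>avg f e\<bar> \<le> B" if "e \<in> space W" for e
      using abs_avg_le[OF B(2) that I] .
    have intA: "integrable W (\<lambda>e. A e * (f (\<xi> i e) * f (\<xi> j e)))" if "i \<in> I" "j \<in> I" for i j
      using B A(2) C \<xi>_space that
      by (intro integrable_const_bound[where B="C * (B * B)"] AE_I2)
        (auto simp: abs_mult intro!: mult_mono)
    have int3: "integrable W (\<lambda>e. A e * (g e * h e))"
      if [measurable]: "g \<in> borel_measurable W" "h \<in> borel_measurable W"
        and "\<And>e. e \<in> space W \<Longrightarrow> \<bar>g e\<bar> \<le> B" "\<And>e. e \<in> space W \<Longrightarrow> \<bar>h e\<bar> \<le> B" for g h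
    proof (rule integrable_const_bound[where B="C * (B * B)"])
      show "AE e in W. norm (A e * (g e * h e)) \<le> C * (B * B)"
        unfolding real_norm_def abs_mult using A(2) that(3,4) B(1) C by (intro AE_I2 mult_mono) auto
    qed measurable
    let ?p = "\<lambda>i j e. real_cond_exp W F (\<lambda>e. f (\<xi> i e) * f (\<xi> j e)) e"
    have sq: "expectation (\<lambda>e. A e * (avg f e)\<^sup>2) = expectation (\<lambda>e. A e * ((m e)\<^sup>2 + v e / ?n))"
    proof -
      have "A e * (avg f e)\<^sup>2 = (\<Sum>i\<in>I. \<Sum>j\<in>I. A e * (f (\<xi> i e) * f (\<xi> j e))) / ?n\<^sup>2" for e
      proof -
        have "A e * (avg f e)\<^sup>2 = A e * ((\<Sum>i\<in>I. f (\<xi> i e)) * (\<Sum>i\<in>I. f (\<xi> i e))) / ?n\<^sup>2"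
          by (simp add: avg_def power_divide power2_eq_square)
        also have "\<dots> = (\<Sum>i\<in>I. \<Sum>j\<in>I. A e * (f (\<xi> i e) * f (\<xi> j e))) / ?n\<^sup>2"
          by (simp only: sum_product) (simp only: sum_distrib_left)
        finally show ?thesis .
      qed
      then have "expectation (\<lambda>e. A e * (avg f e)\<^sup>2) =
          (\<Sum>i\<in>I. \<Sum>j\<in>I. expectation (\<lambda>e. A e * (f (\<xi> i e) * f (\<xi> j e)))) / ?n\<^sup>2"
        using intA by simp
      also have "\<dots> = (\<Sum>i\<in>I. \<Sum>j\<in>I. expectation (\<lambda>e. A e * ?p i j e)) / ?n\<^sup>2"
        using subalg.real_cond_exp_intg(2)[OF intA A(1)]
        by (intro arg_cong2[where f="(/)"] sum.cong) auto
      also have "\<dots> = expectation (\<lambda>e. (\<Sum>i\<in>I. \<Sum>j\<in>I. A e * ?p i j e) / ?n\<^sup>2)"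
        using subalg.real_cond_exp_intg(1)[OF intA A(1)] by simp
      also have "\<dots> = expectation (\<lambda>e. A e * ((m e)\<^sup>2 + v e / ?n))"
      proof (rule integral_cong_AE)
        \<comment> \<open>Off the diagonal the product formula gives \<open>c i * c j\<close>; on it
          the correction term turns the squared mean into the second moment.\<close>
        have "AE e in W. \<forall>i\<in>I. \<forall>j\<in>I. ?p i j e = c i e * c j e + (if i = j then s i e - (c i e)\<^sup>2 else 0)"
        proof (intro AE_finite_allI finite_I)
          fix i j assume ij: "i \<in> I" "j \<in> I"
          show "AE e in W. ?p i j e = c i e * c j e + (if i = j then s i e - (c i e)\<^sup>2 else 0)"
          proof (cases "i = j")
            case True
            then show ?thesis by (simp add: s_def power2_eq_square)
          next
            case False
            from cond_exp_pair[OF ij False f f] AEc show ?thesis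
              by eventually_elim (use ij False in simp)
          qed
        qed
        then show "AE e in W. (\<Sum>i\<in>I. \<Sum>j\<in>I. A e * ?p i j e) / ?n\<^sup>2 = A e * ((m e)\<^sup>2 + v e / ?n)"
          using AEc AE_space
        proof eventually_elim
          case (elim e)
          have "(\<Sum>i\<in>I. \<Sum>j\<in>I. ?p i j e) =
              (\<Sum>i\<in>I. \<Sum>j\<in>I. c i e * c j e + (if i = j then s i e - (c i e)\<^sup>2 else 0))"
            using elim by (intro sum.cong) auto
          also have "\<dots> = (\<Sum>i\<in>I. c i e) * (\<Sum>i\<in>I. c i e) + (\<Sum>i\<in>I. s i e - (c i e)\<^sup>2)"
            using finite_I by (simp add: sum.distrib sum_product)
          also have "(\<Sum>i\<in>I. c i e) = ?n * m e"
            using elim n m(2) by (simp add: kavg_def)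
          finally have "(\<Sum>i\<in>I. \<Sum>j\<in>I. ?p i j e) = ?n\<^sup>2 * ((m e)\<^sup>2 + v e / ?n)"
            using n by (simp add: v_def power2_eq_square field_simps)
          then show ?case using n by (simp flip: sum_distrib_left)
        qed
      qed measurable
      finally show ?thesis .
    qed
    \<comment> \<open>The cross term of the square: with the weight \<open>A * m\<close> the average
      may be replaced by its conditional mean.\<close>
    have "expectation (\<lambda>e. A e * m e * avg f e) = expectation (\<lambda>e. A e * m e * m e)"
    proof (rule expectation_avg[OF f _ _ m I])
      show "(\<lambda>e. A e * m e) \<in> borel_measurable F" using A(1) m(1) by measurable
      show "\<bar>A e * m e\<bar> \<le> C * B" if "e \<in> space W" for e
        unfolding abs_mult using A(2) mB that C by (intro mult_mono) auto
    qed
    moreover have "integrable W (\<lambda>e. A e * m e * avg f e)" "integrable W (\<lambda>e. A e * m e * m e)"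
      "integrable W (\<lambda>e. A e * (avg f e)\<^sup>2)"
      using int3[of m "avg f"] int3[of m m] int3[of "avg f" "avg f"] mB aB
      by (simp_all add: power2_eq_square mult.assoc)
    moreover have "integrable W (\<lambda>e. A e * (v e / ?n))"
    proof (rule integrable_const_bound[where B="C * (2 * B\<^sup>2 / ?n)"])
      show "AE e in W. norm (A e * (v e / ?n)) \<le> C * (2 * B\<^sup>2 / ?n)"
        using AEv_bound AE_space
      proof eventually_elim
        case (elim e)
        then show ?case
          unfolding real_norm_def abs_mult abs_divide using n A(2) C
          by (intro mult_mono) (auto intro!: divide_right_mono)
      qed
    qed measurable
    ultimately have "expectation (\<lambda>e. A e * (avg f e)\<^sup>2 - 2 * (A e * m e * avg f e) + A e * m e * m e) =
        expectation (\<lambda>e. A e * m e * m e + A e * (v e / ?n)) - 2 * expectation (\<lambda>e. A e * m e * m e)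
          + expectation (\<lambda>e. A e * m e * m e)"
      using sq by (simp add: distrib_left power2_eq_square mult.assoc)
    also have "\<dots> = expectation (\<lambda>e. A e * (v e / ?n))"
      using \<open>integrable W (\<lambda>e. A e * m e * m e)\<close> \<open>integrable W (\<lambda>e. A e * (v e / ?n))\<close> by simp
    finally show "expectation (\<lambda>e. A e * (avg f e - m e)\<^sup>2) = expectation (\<lambda>e. A e * (v e / ?n))"
      by (simp add: power2_eq_square algebra_simps)
  qed
qed

end

section \<open>Feynman-Kac semigroups\<close>

lemma bounded_measurable_mult:
  assumes "f \<in> bounded_measurable E" "g \<in> bounded_measurable E"
  shows "(\<lambda>x. f x * g x) \<in> bounded_measurable E"
proof -
  obtain A B where "A \<ge> 0" "\<And>x. x \<in> space E \<Longrightarrow> \<bar>f x\<bar> \<le> A" "\<And>x. x \<in> space E \<Longrightarrow> \<bar>g x\<bar> \<le> B"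
    using assms[THEN bounded_measurable_bound] by metis
  then have "\<bar>f x * g x\<bar> \<le> A * B" if "x \<in> space E" for x
    unfolding abs_mult using that by (intro mult_mono) auto
  then show ?thesis
    using borel_measurable_times[OF assms[THEN bounded_measurableD]] by (rule bounded_measurableI[rotated])
qed

lemma bounded_measurable_const: "(\<lambda>_. c) \<in> bounded_measurable E"
  by (rule bounded_measurableI[where B="\<bar>c\<bar>"]) auto

lemma bounded_measurable_cmult: "f \<in> bounded_measurable E \<Longrightarrow> (\<lambda>x. c * f x) \<in> bounded_measurable E"
  by (rule bounded_measurable_mult[OF bounded_measurable_const])

lemma bounded_measurable_diff:
  assumes "f \<in> bounded_measurable E" "g \<in> bounded_measurable E"
  shows "(\<lambda>x. f x - g x) \<in> bounded_measurable E"
proof -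
  obtain A B where "\<And>x. x \<in> space E \<Longrightarrow> \<bar>f x\<bar> \<le> A" "\<And>x. x \<in> space E \<Longrightarrow> \<bar>g x\<bar> \<le> B"
    using assms[THEN bounded_measurable_bound] by metis
  then have "\<bar>f x - g x\<bar> \<le> A + B" if "x \<in> space E" for x
    using that by (intro order_trans[OF abs_triangle_ineq4] add_mono)
  then show ?thesis
    using borel_measurable_diff[OF assms[THEN bounded_measurableD]] by (rule bounded_measurableI[rotated])
qed

lemma integrable_bounded_measurable:
  assumes "\<mu> \<in> space (prob_algebra E)" "f \<in> bounded_measurable E"
  shows "integrable \<mu> f"
proof -
  from assms(1) have s: "sets \<mu> = sets E" and "prob_space \<mu>" by (auto simp: space_prob_algebra)
  then interpret prob_space \<mu> by simp
  obtain B where "\<And>x. x \<in> space E \<Longrightarrow> \<bar>f x\<bar> \<le> B" using bounded_measurable_bound[OF assms(2)] by blast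
  then show ?thesis
    using bounded_measurableD[OF assms(2)] s sets_eq_imp_space_eq[OF s]
    by (intro integrable_const_bound[where B=B] AE_I2) (auto cong: measurable_cong_sets)
qed

lemma
  assumes "\<mu> \<in> space (prob_algebra E)" "f \<in> bounded_measurable E"
  shows prob_integral_ge: "(\<And>x. x \<in> space E \<Longrightarrow> c \<le> f x) \<Longrightarrow> c \<le> (\<integral>x. f x \<partial>\<mu>)"
    and prob_integral_le: "(\<And>x. x \<in> space E \<Longrightarrow> f x \<le> c) \<Longrightarrow> (\<integral>x. f x \<partial>\<mu>) \<le> c"
    and prob_integral_abs_le: "(\<And>x. x \<in> space E \<Longrightarrow> \<bar>f x\<bar> \<le> c) \<Longrightarrow> \<bar>\<integral>x. f x \<partial>\<mu>\<bar> \<le> c"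
proof -
  from assms(1) have s: "sets \<mu> = sets E" and "prob_space \<mu>" by (auto simp: space_prob_algebra)
  then interpret prob_space \<mu> by simp
  note int = integrable_bounded_measurable[OF assms] and sp = sets_eq_imp_space_eq[OF s]
  note one = prob_space[unfolded sp]
  show ge: "c \<le> (\<integral>x. f x \<partial>\<mu>)" if "\<And>x. x \<in> space E \<Longrightarrow> c \<le> f x" for c
    using integral_mono[OF _ int, of "\<lambda>_. c"] that sp one by simp
  show le: "(\<integral>x. f x \<partial>\<mu>) \<le> c" if "\<And>x. x \<in> space E \<Longrightarrow> f x \<le> c" for c
    using integral_mono[OF int, of "\<lambda>_. c"] that sp one by simp
  show "\<bar>\<integral>x. f x \<partial>\<mu>\<bar> \<le> c" if "\<And>x. x \<in> space E \<Longrightarrow> \<bar>f x\<bar> \<le> c"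
    using ge[of "- c"] le[of c] that by (simp add: abs_le_iff minus_le_iff)
qed

lemma kernel_bounded_measurable:
  assumes K: "K \<in> E \<rightarrow>\<^sub>M prob_algebra E" and f: "f \<in> bounded_measurable E"
  shows "(\<lambda>x. \<integral>y. f y \<partial>K x) \<in> bounded_measurable E"
proof -
  obtain B where B: "\<And>x. x \<in> space E \<Longrightarrow> \<bar>f x\<bar> \<le> B" using bounded_measurable_bound[OF f] by blast
  show ?thesis
  proof (rule bounded_measurableI)
    show "(\<lambda>x. \<integral>y. f y \<partial>K x) \<in> borel_measurable E"
      using measurable_compose[OF measurable_prob_algebraD[OF K]
          integral_measurable_subprob_algebra[OF bounded_measurableD[OF f]]] .
    show "\<bar>\<integral>y. f y \<partial>K x\<bar> \<le> B" if "x \<in> space E" for x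
      using B by (rule prob_integral_abs_le[OF measurable_space[OF K that] f])
  qed
qed

lemma integral_bind_kernel:
  assumes \<mu>: "\<mu> \<in> space (prob_algebra E)" and K: "K \<in> E \<rightarrow>\<^sub>M prob_algebra E"
    and f: "f \<in> bounded_measurable E"
  shows "(\<integral>x. f x \<partial>(bind \<mu> K)) = (\<integral>x. \<integral>y. f y \<partial>K x \<partial>\<mu>)"
proof -
  from \<mu> have s: "sets \<mu> = sets E" and p: "prob_space \<mu>" by (auto simp: space_prob_algebra)
  obtain B where B: "\<And>x. x \<in> space E \<Longrightarrow> \<bar>f x\<bar> \<le> B" using bounded_measurable_bound[OF f] by blast
  show ?thesis
  proof (rule integral_bind[OF bounded_measurableD[OF f] B])
    show "K \<in> \<mu> \<rightarrow>\<^sub>M subprob_algebra E"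
      using measurable_prob_algebraD[OF K] s by (simp cong: measurable_cong_sets)
    show "finite_measure \<mu>" using p by (rule prob_space.finite_measure)
    show "AE x in \<mu>. emeasure (K x) (space (K x)) \<le> ennreal 1"
    proof (intro AE_I2)
      fix x assume "x \<in> space \<mu>"
      then have "x \<in> space E" using sets_eq_imp_space_eq[OF s] by simp
      from measurable_space[OF K this] have "prob_space (K x)" by (simp add: space_prob_algebra)
      from prob_space.emeasure_space_1[OF this] show "emeasure (K x) (space (K x)) \<le> ennreal 1" by simp
    qed
  qed
qed

lemma (in Ionescu_Tulcea) CI_atLeastLessThan: "CI {0..<n} = C 0 n (\<lambda>_. undefined)"
proof -
  have "up_to {0..<n} = n"
    unfolding up_to_def
  proof (rule Least_equality)
    show "n \<le> m" if "\<forall>i\<ge>m. i \<notin> {0..<n}" for m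
      using that by (cases "n \<le> m") auto
  qed auto
  then show ?thesis
    unfolding CI_def using distr_C[of n n "\<lambda>_. undefined" 0] by simp
qed

lemma (in Ionescu_Tulcea) integral_eP:
  fixes f :: "(nat \<Rightarrow> 'a) \<Rightarrow> real"
  assumes "e \<in> space (PiM {0..<n} M)" "f \<in> borel_measurable (PiM {0..<Suc n} M)"
  shows "(\<integral>x. f x \<partial>eP n e) = (\<integral>x. f (fun_upd e n x) \<partial>P n e)"
  unfolding eP_def using assms
  by (subst integral_distr) (auto intro!: measurable_fun_upd[where J="{0..<n}"] simp: space_PiM PiE_iff)

section \<open>The Feynman-Kac model and its semigroup as an operator\<close>

locale feynman_kac =
  fixes E \<eta>\<^sub>0 :: "'a measure" and M :: "nat \<Rightarrow> 'a \<Rightarrow> 'a measure" and G :: "nat \<Rightarrow> 'a \<Rightarrow> real"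
  assumes eta0: "\<eta>\<^sub>0 \<in> space (prob_algebra E)"
    and M: "\<And>n. n \<ge> 1 \<Longrightarrow> M n \<in> E \<rightarrow>\<^sub>M prob_algebra E"
    and G: "\<And>n. G n \<in> bounded_measurable E"
    and G_pos: "\<And>n x. x \<in> space E \<Longrightarrow> G n x > 0"
begin

abbreviation \<gamma> :: "nat \<Rightarrow> ('a \<Rightarrow> real) \<Rightarrow> real" where
  "\<gamma> \<equiv> gamma E \<eta>\<^sub>0 M G"

abbreviation \<eta> :: "nat \<Rightarrow> 'a measure" where
  "\<eta> \<equiv> eta E \<eta>\<^sub>0 M G"

abbreviation \<P> :: "'a measure set" where
  "\<P> \<equiv> space (prob_algebra E)"

lemma space_E_not_empty: "space E \<noteq> {}"
proof -
  from eta0 have "prob_space \<eta>\<^sub>0" "sets \<eta>\<^sub>0 = sets E" by (auto simp: space_prob_algebra)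
  then show ?thesis using prob_space.not_empty sets_eq_imp_space_eq by metis
qed

definition Mop :: "nat \<Rightarrow> ('a \<Rightarrow> real) \<Rightarrow> 'a \<Rightarrow> real" where
  "Mop n f x = (\<integral>y. f y \<partial>M n x)"

lemma Mop_bounded_measurable: "f \<in> bounded_measurable E \<Longrightarrow> Mop (Suc n) f \<in> bounded_measurable E"
  unfolding Mop_def[abs_def] by (intro kernel_bounded_measurable M) auto

lemma M_space: "x \<in> space E \<Longrightarrow> M (Suc n) x \<in> \<P>"
  using measurable_space[OF M] by simp

text \<open>The last coordinate is integrated out: given the path up to coordinate \<open>k\<close>,
  it has the law \<open>M (p + Suc k) (e k)\<close>.\<close>

lemma chain_law_Suc:
  assumes \<nu>: "\<nu> \<in> \<P>" and f: "f \<in> bounded_measurable E"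
    and g: "\<And>q. g q \<in> bounded_measurable E"
  shows "(\<integral>e. f (e (Suc k)) * (\<Prod>q<Suc k. g q (e q)) \<partial>chain_law E M p \<nu>) =
    (\<integral>e. g k (e k) * Mop (p + Suc k) f (e k) * (\<Prod>q<k. g q (e q)) \<partial>chain_law E M p \<nu>)"
proof -
  define P where "P = (\<lambda>k (e :: nat \<Rightarrow> 'a). case k of 0 \<Rightarrow> \<nu> | Suc j \<Rightarrow> M (p + Suc j) (e j))"
  interpret IT: Ionescu_Tulcea P "\<lambda>_. E"
    unfolding P_def using \<nu> M by (rule Ionescu_Tulcea_chain)
  have eq: "chain_law E M p \<nu> = IT.PF.lim"
    by (simp add: chain_law_def P_def)
  \<comment> \<open>A function of the first \<open>n\<close> coordinates may be integrated against
    the finite-dimensional law \<open>IT.C\<close>, which is an iterated bind and can be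
    peeled.\<close>
  have marginal: "(\<integral>e. F e \<partial>chain_law E M p \<nu>) = (\<integral>e. F e \<partial>IT.C 0 n (\<lambda>_. undefined))"
    if F: "F \<in> borel_measurable (PiM {0..<n} (\<lambda>_. E))" "\<And>e. F (restrict e {0..<n}) = F e"
    for F :: "(nat \<Rightarrow> 'a) \<Rightarrow> real" and n
  proof -
    have "(\<integral>e. F e \<partial>IT.C 0 n (\<lambda>_. undefined)) =
        (\<integral>e. F e \<partial>distr IT.PF.lim (PiM {0..<n} (\<lambda>_. E)) (\<lambda>e. restrict e {0..<n}))"
      by (simp add: IT.distr_lim IT.CI_atLeastLessThan)
    also have "\<dots> = (\<integral>e. F (restrict e {0..<n}) \<partial>IT.PF.lim)"
      using F by (intro integral_distr)
        (auto simp: measurable_cong_sets[OF IT.PF.sets_lim refl] intro!: measurable_restrict_subset)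
    finally show ?thesis using F(2) by (simp add: eq)
  qed
  have comp: "(\<lambda>e. u (e i)) \<in> borel_measurable (PiM {0..<n} (\<lambda>_. E))"
    if "u \<in> bounded_measurable E" "i < n" for u :: "'a \<Rightarrow> real" and i n :: nat
    using that by (intro measurable_compose[OF measurable_component_singleton bounded_measurableD]) auto
  let ?F = "\<lambda>e. f (e (Suc k)) * (\<Prod>q<Suc k. g q (e q))"
  have Fm: "?F \<in> borel_measurable (PiM {0..<Suc (Suc k)} (\<lambda>_. E))"
    using f g by (intro borel_measurable_times borel_measurable_prod comp) auto
  obtain B where B: "B \<ge> 0" "\<And>x. x \<in> space E \<Longrightarrow> \<bar>f x\<bar> \<le> B" using bounded_measurable_bound[OF f] by blast
  have "\<forall>q. \<exists>b\<ge>0. \<forall>x\<in>space E. \<bar>g q x\<bar> \<le> b" using bounded_measurable_bound[OF g] by blast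
  then obtain b where b: "\<And>q. b q \<ge> 0" "\<And>q x. x \<in> space E \<Longrightarrow> \<bar>g q x\<bar> \<le> b q" by metis
  have FB: "\<bar>?F e\<bar> \<le> B * (\<Prod>q<Suc k. b q)" if "e \<in> space (PiM {0..<Suc (Suc k)} (\<lambda>_. E))" for e
    unfolding abs_mult abs_prod using that B b
    by (intro mult_mono prod_mono prod_nonneg) (auto simp: space_PiM PiE_iff)
  have u: "(\<lambda>_. undefined) \<in> space (PiM {0..<0::nat} (\<lambda>_. E))"
    by (simp add: space_PiM)
  have "(\<integral>e. ?F e \<partial>chain_law E M p \<nu>) = (\<integral>e. ?F e \<partial>IT.C 0 (Suc (Suc k)) (\<lambda>_. undefined))"
    using Fm by (rule marginal) simp
  also have "\<dots> = (\<integral>e. ?F e \<partial>(bind (IT.C 0 (Suc k) (\<lambda>_. undefined)) (IT.eP (Suc k))))"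
    by simp
  also have "\<dots> = (\<integral>e. \<integral>e'. ?F e' \<partial>IT.eP (Suc k) e \<partial>IT.C 0 (Suc k) (\<lambda>_. undefined))"
  proof (rule integral_bind[OF Fm FB])
    show "IT.eP (Suc k) \<in> IT.C 0 (Suc k) (\<lambda>_. undefined) \<rightarrow>\<^sub>M
        subprob_algebra (PiM {0..<Suc (Suc k)} (\<lambda>_. E))"
      using IT.measurable_eP[of "Suc k"] IT.sets_C[OF u, of "Suc k"]
      by (simp cong: measurable_cong_sets)
    show "finite_measure (IT.C 0 (Suc k) (\<lambda>_. undefined))"
      using IT.prob_space_C[OF u] by (rule prob_space.finite_measure)
    show "AE e in IT.C 0 (Suc k) (\<lambda>_. undefined).
        emeasure (IT.eP (Suc k) e) (space (IT.eP (Suc k) e)) \<le> ennreal 1"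
      using IT.space_C[OF u, of "Suc k"] IT.prob_space_eP[THEN prob_space.emeasure_space_1]
      by (intro AE_I2) simp
  qed
  also have "\<dots> = (\<integral>e. g k (e k) * Mop (p + Suc k) f (e k) * (\<Prod>q<k. g q (e q))
      \<partial>IT.C 0 (Suc k) (\<lambda>_. undefined))"
  proof (rule Bochner_Integration.integral_cong[OF refl])
    fix e assume "e \<in> space (IT.C 0 (Suc k) (\<lambda>_. undefined))"
    then have e: "e \<in> space (PiM {0..<Suc k} (\<lambda>_. E))" using IT.space_C[OF u, of "Suc k"] by simp
    have "(\<integral>e'. ?F e' \<partial>IT.eP (Suc k) e) = (\<integral>x. f x * (\<Prod>q<Suc k. g q (e q)) \<partial>P (Suc k) e)"
      unfolding IT.integral_eP[OF e Fm] by (intro Bochner_Integration.integral_cong refl) simp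
    also have "\<dots> = Mop (p + Suc k) f (e k) * (\<Prod>q<Suc k. g q (e q))"
      by (simp add: Mop_def P_def)
    finally show "(\<integral>e'. ?F e' \<partial>IT.eP (Suc k) e) =
        g k (e k) * Mop (p + Suc k) f (e k) * (\<Prod>q<k. g q (e q))"
      by simp
  qed
  also have "\<dots> = (\<integral>e. g k (e k) * Mop (p + Suc k) f (e k) * (\<Prod>q<k. g q (e q)) \<partial>chain_law E M p \<nu>)"
  proof (rule marginal[symmetric])
    show "(\<lambda>e. g k (e k) * Mop (p + Suc k) f (e k) * (\<Prod>q<k. g q (e q)))
        \<in> borel_measurable (PiM {0..<Suc k} (\<lambda>_. E))"
      using f g Mop_bounded_measurable[OF f, of "p + k"]
      by (intro borel_measurable_times borel_measurable_prod comp) auto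
  qed simp
  finally show ?thesis .
qed

text \<open>
  \<open>semigroup p k\<close> is \<open>Q p (p + k)\<close> as an operator, without reference to the chain; unlike
  \<^const>\<open>Q\<close> it is unconstrained outside \<open>space E\<close>.
\<close>

primrec semigroup :: "nat \<Rightarrow> nat \<Rightarrow> ('a \<Rightarrow> real) \<Rightarrow> 'a \<Rightarrow> real" where
  "semigroup p 0 f = f"
| "semigroup p (Suc k) f = semigroup p k (\<lambda>x. G (p + k) x * Mop (p + Suc k) f x)"

lemma step_bounded_measurable:
  "f \<in> bounded_measurable E \<Longrightarrow> (\<lambda>x. G n x * Mop (Suc m) f x) \<in> bounded_measurable E"
  by (intro bounded_measurable_mult G Mop_bounded_measurable)

lemma semigroup_bounded_measurable:
  "f \<in> bounded_measurable E \<Longrightarrow> semigroup p k f \<in> bounded_measurable E"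
  by (induction k arbitrary: f) (auto intro!: step_bounded_measurable)

lemma chain_law_semigroup:
  assumes \<nu>: "\<nu> \<in> \<P>" and f: "f \<in> bounded_measurable E"
  shows "(\<integral>e. f (e k) * (\<Prod>q<k. G (p + q) (e q)) \<partial>chain_law E M p \<nu>) = (\<integral>x. semigroup p k f x \<partial>\<nu>)"
  using f
proof (induction k arbitrary: f)
  case 0
  have "sets (chain_law E M p \<nu>) = sets (\<Pi>\<^sub>M i\<in>UNIV. E)" using \<nu> M by (rule sets_chain_law)
  then have "(\<lambda>e. e 0) \<in> chain_law E M p \<nu> \<rightarrow>\<^sub>M E" by (simp cong: measurable_cong_sets)
  from integral_distr[OF this bounded_measurableD[OF 0]] show ?case
    using distr_chain_law_0[where p=p, OF \<nu> M] by simp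
next
  case (Suc k)
  show ?case
    using chain_law_Suc[OF \<nu> Suc.prems, where g="\<lambda>q. G (p + q)" and k=k and p=p, OF G]
      Suc.IH[of "\<lambda>x. G (p + k) x * Mop (p + Suc k) f x"] step_bounded_measurable[OF Suc.prems]
    by (simp del: prod.lessThan_Suc)
qed

lemma Q_eq_semigroup:
  assumes "f \<in> bounded_measurable E" "x \<in> space E"
  shows "Q E M G p (p + k) f x = semigroup p k f x"
proof -
  have "return E x \<in> \<P>"
    using assms(2) by (simp add: space_prob_algebra prob_space_return)
  from chain_law_semigroup[OF this assms(1), where k=k and p=p]
  have "Q E M G p (p + k) f x = (\<integral>y. semigroup p k f y \<partial>return E x)"
    using prod.shift_bounds_nat_ivl[of "\<lambda>q. G q (e (q - p))" 0 p k for e]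
    by (simp add: Q_def lessThan_atLeast0 add.commute)
  also have "\<dots> = semigroup p k f x"
    using assms by (intro integral_return bounded_measurableD semigroup_bounded_measurable)
  finally show ?thesis .
qed

text \<open>The defining recursion adds a step at the terminal time. Here the initial step is split
  off instead, which is the form that meets \<open>Phi\<close>.\<close>

lemma semigroup_backward:
  "semigroup p (Suc k) f = (\<lambda>x. G p x * Mop (Suc p) (semigroup (Suc p) k f) x)"
proof (induction k arbitrary: f)
  case (Suc k)
  have "semigroup p (Suc (Suc k)) f =
      semigroup p (Suc k) (\<lambda>x. G (Suc p + k) x * Mop (Suc p + Suc k) f x)"
    by simp
  also have "\<dots> = (\<lambda>x. G p x * Mop (Suc p) (semigroup (Suc p) (Suc k) f) x)"
    by (subst Suc.IH) simp
  finally show ?case .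
qed simp

lemma gamma_semigroup:
  assumes f: "f \<in> bounded_measurable E"
  shows "\<gamma> p (semigroup p k f) = \<gamma> (p + k) f"
  using f
proof (induction k arbitrary: f)
  case (Suc k)
  let ?f = "\<lambda>x. G (p + k) x * Mop (p + Suc k) f x"
  have f': "?f \<in> bounded_measurable E" using step_bounded_measurable[OF Suc.prems, of "p + k" "p + k"] by simp
  have eq: "\<gamma> n f = (\<integral>x. semigroup 0 n f x \<partial>\<eta>\<^sub>0)"
    if "f \<in> bounded_measurable E" for n f
    using chain_law_semigroup[OF eta0 that, where p=0 and k=n] by (simp add: gamma_def)
  have "\<gamma> p (semigroup p (Suc k) f) = \<gamma> (p + k) ?f"
    using Suc.IH[OF f'] by simp
  also have "\<dots> = \<gamma> (p + Suc k) f"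
    using eq[OF f', of "p + k"] eq[OF Suc.prems, of "p + Suc k"] by simp
  finally show ?case .
qed simp

lemma gamma_one_pos: "\<gamma> n (\<lambda>_. 1) > 0"
  using eta0 M G G_pos by (rule gamma_pos)

lemma eta_space: "\<eta> n \<in> \<P>"
  using prob_space_eta[OF eta0 M G G_pos] by (simp add: space_prob_algebra eta_def)

lemma eta_semigroup:
  assumes f: "f \<in> bounded_measurable E"
  shows "(\<integral>x. semigroup p k f x \<partial>\<eta> p) =
    \<gamma> (p + k) f / \<gamma> p (\<lambda>_. 1)"
  using integral_eta[OF eta0 M G G_pos bounded_measurableD[OF semigroup_bounded_measurable[OF f]]]
  by (simp add: gamma_semigroup[OF f])

lemma integral_eta':
  assumes f: "f \<in> bounded_measurable E"
  shows "(\<integral>x. f x \<partial>\<eta> p) = \<gamma> p f / \<gamma> p (\<lambda>_. 1)"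
  using eta_semigroup[OF f, of p 0] by simp

lemma eta_Suc:
  assumes f: "f \<in> bounded_measurable E"
  shows "(\<integral>x. f x \<partial>\<eta> (Suc n)) =
    (\<integral>x. G n x * Mop (Suc n) f x \<partial>\<eta> n) / (\<integral>x. G n x \<partial>\<eta> n)"
proof -
  have "G n x * Mop (Suc n) (\<lambda>_. 1) x = G n x" if "x \<in> space E" for x
    using M_space[OF that, of n] prob_space.prob_space by (auto simp: Mop_def space_prob_algebra)
  then have "(\<integral>x. G n x \<partial>\<eta> n) = (\<integral>x. G n x * Mop (Suc n) (\<lambda>_. 1) x \<partial>\<eta> n)"
    using eta_space[of n]
    by (intro Bochner_Integration.integral_cong)
      (auto simp: space_prob_algebra dest: sets_eq_imp_space_eq)
  then show ?thesis
    using eta_semigroup[OF f, where p=n and k=1]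
      eta_semigroup[OF bounded_measurable_const[where c=1], where p=n and k=1]
      integral_eta'[OF f, where p="Suc n"] gamma_one_pos[of n]
    by simp
qed

lemma semigroup_one_pos: "x \<in> space E \<Longrightarrow> semigroup p k (\<lambda>_. 1) x > 0"
proof (induction k arbitrary: p x)
  case (Suc k)
  have "0 < Mop (Suc p) (semigroup (Suc p) k (\<lambda>_. 1)) x"
  proof -
    from M_space[OF Suc.prems, of p]
    have s: "sets (M (Suc p) x) = sets E" and pr: "prob_space (M (Suc p) x)"
      by (auto simp: space_prob_algebra)
    interpret prob_space "M (Suc p) x" by (rule pr)
    have "integrable (M (Suc p) x) (semigroup (Suc p) k (\<lambda>_. 1))"
      by (intro integrable_bounded_measurable[OF M_space[OF Suc.prems]] semigroup_bounded_measurable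
          bounded_measurable_const)
    then show ?thesis
      unfolding Mop_def using Suc.IH sets_eq_imp_space_eq[OF s] emeasure_space_1
      by (intro integral_less_AE_space[of "\<lambda>_. 0", simplified]) auto
  qed
  then show ?case
    unfolding semigroup_backward using G_pos[OF Suc.prems] by simp
qed simp

lemma semigroup_mono:
  assumes "f \<in> bounded_measurable E" "f' \<in> bounded_measurable E"
    and "\<And>x. x \<in> space E \<Longrightarrow> f x \<le> f' x" "x \<in> space E"
  shows "semigroup p k f x \<le> semigroup p k f' x"
  using assms
proof (induction k arbitrary: f f' x)
  case (Suc k)
  let ?s = "\<lambda>f x. G (p + k) x * Mop (p + Suc k) f x"
  have "?s f y \<le> ?s f' y" if y: "y \<in> space E" for y
  proof (rule mult_left_mono)
    show "Mop (p + Suc k) f y \<le> Mop (p + Suc k) f' y"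
      unfolding Mop_def using M_space[OF y, of "p + k"] Suc.prems
      by (intro integral_mono integrable_bounded_measurable[of _ E])
        (auto simp: space_prob_algebra dest: sets_eq_imp_space_eq)
  qed (use G_pos[OF y] in \<open>simp add: less_imp_le\<close>)
  then show ?case
    using Suc.IH[of "?s f" "?s f'"] Suc.prems step_bounded_measurable[of _ "p + k" "p + k"] by simp
qed simp

lemma semigroup_cmult: "semigroup p k (\<lambda>x. c * f x) = (\<lambda>x. c * semigroup p k f x)"
proof (induction k arbitrary: f)
  case (Suc k)
  have "(\<lambda>x. G (p + k) x * Mop (p + Suc k) (\<lambda>x. c * f x) x) =
      (\<lambda>x. c * (G (p + k) x * Mop (p + Suc k) f x))"
    by (simp add: Mop_def mult_ac)
  then show ?case by (simp add: Suc.IH del: add_Suc_right)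
qed simp

lemma P_kernel_eq:
  assumes "f \<in> bounded_measurable E" "x \<in> space E"
  shows "P_kernel E M G p (p + k) f x = semigroup p k f x / semigroup p k (\<lambda>_. 1) x"
  using assms by (simp add: P_kernel_def Q_eq_semigroup bounded_measurable_const)

section \<open>The maps Psi and Phi and the flow of measures\<close>

lemma Mop_one: "x \<in> space E \<Longrightarrow> Mop (Suc n) (\<lambda>_. 1) x = 1"
  using M_space[of x n] prob_space.prob_space by (auto simp: Mop_def space_prob_algebra)

lemma Psi_integral:
  assumes \<mu>: "\<mu> \<in> \<P>"
  shows "Psi (G n) \<mu> \<in> \<P>"
    and "f \<in> bounded_measurable E \<Longrightarrow> (\<integral>x. f x \<partial>Psi (G n) \<mu>) = (\<integral>x. G n x * f x \<partial>\<mu>) / (\<integral>x. G n x \<partial>\<mu>)"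
    and "0 < (\<integral>x. G n x \<partial>\<mu>)"
proof -
  from \<mu> have s: "sets \<mu> = sets E" and "prob_space \<mu>" by (auto simp: space_prob_algebra)
  then interpret prob_space \<mu> by simp
  note sp = sets_eq_imp_space_eq[OF s]
  note [measurable_cong] = s
  note [measurable] = bounded_measurableD[OF G[of n]]
  note int = integrable_bounded_measurable[OF \<mu> G[of n]]
  show pos: "0 < (\<integral>x. G n x \<partial>\<mu>)"
    using int G_pos sp emeasure_space_1
    by (intro integral_less_AE_space[of "\<lambda>_. 0", simplified]) auto
  let ?d = "\<lambda>x. G n x / (\<integral>x. G n x \<partial>\<mu>)"
  have d0: "AE x in \<mu>. 0 \<le> ?d x"
    using pos G_pos sp by (auto intro!: AE_I2 divide_nonneg_pos less_imp_le)
  show "(\<integral>x. f x \<partial>Psi (G n) \<mu>) = (\<integral>x. G n x * f x \<partial>\<mu>) / (\<integral>x. G n x \<partial>\<mu>)"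
    if f: "f \<in> bounded_measurable E"
  proof -
    note [measurable] = bounded_measurableD[OF f]
    have "(\<integral>x. f x \<partial>Psi (G n) \<mu>) = (\<integral>x. ?d x *\<^sub>R f x \<partial>\<mu>)"
      unfolding Psi_def using d0 by (intro integral_density) measurable
    then show ?thesis by simp
  qed
  have "(\<integral>\<^sup>+x. ennreal (?d x) \<partial>\<mu>) = ennreal (\<integral>x. ?d x \<partial>\<mu>)"
    using int d0 by (intro nn_integral_eq_integral) auto
  also have "(\<integral>x. ?d x \<partial>\<mu>) = 1" using pos by simp
  finally have "emeasure (Psi (G n) \<mu>) (space (Psi (G n) \<mu>)) = 1"
    by (simp add: Psi_def emeasure_density cong: nn_integral_cong)
  then show "Psi (G n) \<mu> \<in> \<P>"
    using s by (auto simp: space_prob_algebra Psi_def intro!: prob_spaceI)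
qed

lemma Phi_integral:
  assumes \<mu>: "\<mu> \<in> \<P>"
  shows "Phi M G (Suc n) \<mu> \<in> \<P>"
    and "f \<in> bounded_measurable E \<Longrightarrow>
      (\<integral>x. f x \<partial>Phi M G (Suc n) \<mu>) = (\<integral>x. G n x * Mop (Suc n) f x \<partial>\<mu>) / (\<integral>x. G n x \<partial>\<mu>)"
proof -
  have M': "M (Suc n) \<in> E \<rightarrow>\<^sub>M prob_algebra E" by (rule M) simp
  show "(\<integral>x. f x \<partial>Phi M G (Suc n) \<mu>) = (\<integral>x. G n x * Mop (Suc n) f x \<partial>\<mu>) / (\<integral>x. G n x \<partial>\<mu>)"
    if "f \<in> bounded_measurable E"
    using integral_bind_kernel[OF Psi_integral(1)[OF \<mu>, of n] M' that]
      Psi_integral(2)[OF \<mu> Mop_bounded_measurable[OF that], of n n]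
    by (simp add: Phi_def Mop_def)
  show "Phi M G (Suc n) \<mu> \<in> \<P>"
    using Psi_integral(1)[OF \<mu>, of n] prob_space_bind'[OF _ M'] sets_bind'[OF _ M']
    by (simp add: Phi_def space_prob_algebra)
qed

text \<open>For a probability measure \<mu> this is \<open>Phi\<close> iterated over the times
  \<open>p + 1\<close> to \<open>p + k\<close>, evaluated on \<open>f\<close>. The form as a
  quotient of linear functionals makes perturbations of \<mu> accessible.\<close>

definition flow :: "nat \<Rightarrow> nat \<Rightarrow> 'a measure \<Rightarrow> ('a \<Rightarrow> real) \<Rightarrow> real" where
  "flow p k \<mu> f = (\<integral>x. semigroup p k f x \<partial>\<mu>) / (\<integral>x. semigroup p k (\<lambda>_. 1) x \<partial>\<mu>)"

lemma flow_0: "\<mu> \<in> \<P> \<Longrightarrow> flow p 0 \<mu> f = (\<integral>x. f x \<partial>\<mu>)"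
  using prob_space.prob_space[of \<mu>] by (auto simp: flow_def space_prob_algebra)

lemma flow_Suc:
  assumes \<mu>: "\<mu> \<in> \<P>" and f: "f \<in> bounded_measurable E"
  shows "flow p (Suc k) \<mu> f = flow (Suc p) k (Phi M G (Suc p) \<mu>) f"
  using Phi_integral(2)[OF \<mu> semigroup_bounded_measurable[OF f]]
    Phi_integral(2)[OF \<mu> semigroup_bounded_measurable[OF bounded_measurable_const]]
    Psi_integral(3)[OF \<mu>, of p]
  by (simp add: flow_def semigroup_backward del: semigroup.simps(2))

lemma flow_eta:
  assumes f: "f \<in> bounded_measurable E"
  shows "flow p k (\<eta> p) f = (\<integral>x. f x \<partial>\<eta> (p + k))"
  using eta_semigroup[OF f, where p=p and k=k]
    eta_semigroup[OF bounded_measurable_const[where c=1], where p=p and k=k]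
    integral_eta'[OF f, where p="p + k"] gamma_one_pos[of p]
  by (simp add: flow_def)

end

section \<open>Uniform consequences of mixing\<close>

locale stable_feynman_kac = feynman_kac +
  fixes g a lam :: real
  assumes ratio: "\<And>n x y. x \<in> space E \<Longrightarrow> y \<in> space E \<Longrightarrow> G n x \<le> g * G n y"
    and a: "a > 0" and lam: "lam > 0"
    and mixing: "\<And>p k f x y. f \<in> bounded_measurable E \<Longrightarrow>
      (\<And>x y. x \<in> space E \<Longrightarrow> y \<in> space E \<Longrightarrow> \<bar>f x - f y\<bar> \<le> 1) \<Longrightarrow> x \<in> space E \<Longrightarrow> y \<in> space E \<Longrightarrow>
      \<bar>P_kernel E M G p (p + k) f x - P_kernel E M G p (p + k) f y\<bar> \<le> a * exp (- lam * k)"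
begin

lemma g_ge_1: "g \<ge> 1"
proof -
  obtain x where x: "x \<in> space E" using space_E_not_empty by blast
  from ratio[OF x x, of 0] G_pos[OF x, of 0] show ?thesis by simp
qed

abbreviation Q1 :: "nat \<Rightarrow> nat \<Rightarrow> 'a \<Rightarrow> real" where
  "Q1 p k \<equiv> semigroup p k (\<lambda>_. 1)"

lemma Q1_bounded_measurable: "Q1 p k \<in> bounded_measurable E"
  by (intro semigroup_bounded_measurable bounded_measurable_const)

lemma mixing_scaled:
  assumes f: "f \<in> bounded_measurable E" and B: "B > 0"
    and osc: "\<And>x y. x \<in> space E \<Longrightarrow> y \<in> space E \<Longrightarrow> \<bar>f x - f y\<bar> \<le> B"
    and xy: "x \<in> space E" "y \<in> space E"
  shows "\<bar>semigroup p k f x / Q1 p k x - semigroup p k f y / Q1 p k y\<bar> \<le> B * (a * exp (- lam * k))"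
proof -
  let ?f = "\<lambda>x. (1 / B) * f x"
  have f': "?f \<in> bounded_measurable E" by (rule bounded_measurable_cmult[OF f])
  have osc': "\<bar>?f x - ?f y\<bar> \<le> 1" if "x \<in> space E" "y \<in> space E" for x y
    using osc[OF that] B by (simp add: abs_divide flip: diff_divide_distrib)
  have P: "P_kernel E M G p (p + k) ?f z = (semigroup p k f z / Q1 p k z) / B" if "z \<in> space E" for z
    unfolding P_kernel_eq[OF f' that] semigroup_cmult by simp
  have "\<bar>P_kernel E M G p (p + k) ?f x - P_kernel E M G p (p + k) ?f y\<bar> \<le> a * exp (- lam * k)"
    using f' osc' xy by (rule mixing)
  then have "\<bar>semigroup p k f x / Q1 p k x - semigroup p k f y / Q1 p k y\<bar> / B \<le> a * exp (- lam * k)"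
    unfolding P[OF xy(1)] P[OF xy(2)] diff_divide_distrib[symmetric] abs_divide abs_of_pos[OF B] .
  then show ?thesis using B by (simp add: field_simps)
qed

text \<open>The product over all \<open>k\<close> of the one-step factors
  \<open>exp (g\<^sup>2 * a * exp (- lam) ^ k)\<close> that arise in
  \<open>Q1_ratio\<close>.\<close>

definition C :: real where
  "C = exp (g\<^sup>2 * a / (1 - exp (- lam)))"

lemma C_ge_1: "C \<ge> 1"
  using a lam by (simp add: C_def)

text \<open>Lengthening the horizon from \<open>k\<close> to \<open>k + 1\<close> multiplies
  \<open>Q1 p k x\<close> by a mean of \<open>G (p + k)\<close> under \<open>P_kernel\<close>. By
  mixing this mean depends on the starting point only up to a relative error of order
  \<open>exp (- lam * k)\<close>, and these errors are summable; hence a constant independent of the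
  horizon.\<close>

lemma Q1_ratio:
  assumes "x \<in> space E" "y \<in> space E"
  shows "Q1 p k x \<le> C * Q1 p k y"
proof -
  have "Q1 p k x \<le> exp (g\<^sup>2 * a * (\<Sum>j<k. exp (- lam) ^ j)) * Q1 p k y"
  proof (induction k)
    case (Suc k)
    \<comment> \<open>\<open>?f\<close> is the one-step image of 1 and equals
      \<open>G (p + k)\<close> on \<open>space E\<close>; \<open>?P\<close> is its mean under the
      kernel, the ratio of consecutive \<open>Q1\<close>.\<close>
    let ?f = "\<lambda>x. G (p + k) x * Mop (p + Suc k) (\<lambda>_. 1) x"
    let ?P = "\<lambda>x. semigroup p k ?f x / Q1 p k x" and ?c = "G (p + k) x"
    have f: "?f \<in> bounded_measurable E"
      using step_bounded_measurable[OF bounded_measurable_const, of "p + k" "p + k" 1] by simp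
    have fG: "?f z = G (p + k) z" if "z \<in> space E" for z
      using Mop_one[OF that, of "p + k"] by simp
    have c: "?c > 0" using G_pos assms by simp
    have g: "g > 0" using g_ge_1 by simp
    \<comment> \<open>Both values lie between 0 and \<open>g * ?c\<close>.\<close>
    have osc: "\<bar>?f u - ?f v\<bar> \<le> g * ?c" if "u \<in> space E" "v \<in> space E" for u v
      unfolding fG[OF that(1)] fG[OF that(2)]
      using G_pos[OF that(1), of "p + k"] G_pos[OF that(2), of "p + k"]
        ratio[OF that(1) assms(1), of "p + k"] ratio[OF that(2) assms(1), of "p + k"]
      by (simp add: abs_le_iff)
    have "?P x \<le> ?P y + g * ?c * (a * exp (- lam * k))"
      using mixing_scaled[OF f mult_pos_pos[OF g c] osc assms, of p k] by (simp add: abs_le_iff)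
    \<comment> \<open>A lower bound for the mean turns the additive mixing error into a relative
      one, at the cost of the second factor \<open>g\<close>.\<close>
    also have low: "?c / g \<le> ?P y"
    proof -
      have "(?c / g) * Q1 p k y = semigroup p k (\<lambda>_. (?c / g) * 1) y"
        unfolding semigroup_cmult by simp
      also have "\<dots> \<le> semigroup p k ?f y"
      proof (rule semigroup_mono[OF bounded_measurable_const f _ assms(2)])
        show "?c / g * 1 \<le> ?f z" if "z \<in> space E" for z
          unfolding fG[OF that] using ratio[OF assms(1) that, of "p + k"] g by (simp add: field_simps)
      qed
      finally show ?thesis
        using semigroup_one_pos[OF assms(2), of p k] by (simp add: field_simps)
    qed
    then have "g * ?c * (a * exp (- lam * k)) \<le> ?P y * (g\<^sup>2 * a * exp (- lam) ^ k)"
    proof -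
      have "?c \<le> ?P y * g" using low g by (simp add: field_simps)
      then have "?c * (g * a * exp (- lam) ^ k) \<le> (?P y * g) * (g * a * exp (- lam) ^ k)"
        using g a by (intro mult_right_mono) auto
      then show ?thesis
        by (simp add: power2_eq_square mult_ac flip: exp_of_nat_mult)
    qed
    then have "?P y + g * ?c * (a * exp (- lam * k)) \<le> ?P y * (1 + g\<^sup>2 * a * exp (- lam) ^ k)"
      by (simp add: distrib_left)
    also have "\<dots> \<le> ?P y * exp (g\<^sup>2 * a * exp (- lam) ^ k)"
    proof (rule mult_left_mono[OF exp_ge_add_one_self])
      have "0 \<le> ?c / g" using c g by simp
      with low show "0 \<le> ?P y" by (rule order_trans[rotated])
    qed
    finally have P: "?P x \<le> ?P y * exp (g\<^sup>2 * a * exp (- lam) ^ k)" .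
    have "Q1 p (Suc k) x = Q1 p k x * ?P x"
      using semigroup_one_pos[OF assms(1), of p k] by simp
    also have "\<dots> \<le> (exp (g\<^sup>2 * a * (\<Sum>j<k. exp (- lam) ^ j)) * Q1 p k y) *
        (?P y * exp (g\<^sup>2 * a * exp (- lam) ^ k))"
    proof (intro mult_mono Suc.IH P)
      have "0 \<le> semigroup p k ?f x"
        using semigroup_one_pos[OF assms(1), of p "Suc k"] by simp
      then show "0 \<le> ?P x" using semigroup_one_pos[OF assms(1), of p k] by simp
    qed (use semigroup_one_pos[OF assms(2), of p k] in simp)
    also have "\<dots> = exp (g\<^sup>2 * a * (\<Sum>j<Suc k. exp (- lam) ^ j)) * (Q1 p k y * ?P y)"
      by (simp add: exp_add distrib_left mult_ac)
    also have "Q1 p k y * ?P y = Q1 p (Suc k) y"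
      using semigroup_one_pos[OF assms(2), of p k] by simp
    finally show ?case .
  qed simp
  also have "\<dots> \<le> C * Q1 p k y"
  proof (rule mult_right_mono)
    have "(\<Sum>j<k. exp (- lam) ^ j) \<le> (\<Sum>j. exp (- lam) ^ j)"
      using lam by (intro sum_le_suminf summable_geometric) auto
    also have "\<dots> = 1 / (1 - exp (- lam))"
      using lam by (intro suminf_geometric) auto
    finally have "g\<^sup>2 * a * (\<Sum>j<k. exp (- lam) ^ j) \<le> g\<^sup>2 * a * (1 / (1 - exp (- lam)))"
      using a by (intro mult_left_mono) auto
    then show "exp (g\<^sup>2 * a * (\<Sum>j<k. exp (- lam) ^ j)) \<le> C" by (simp add: C_def)
  qed (use semigroup_one_pos[OF assms(2), of p k] in simp)
  finally show ?thesis .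
qed

definition H :: "nat \<Rightarrow> nat \<Rightarrow> 'a \<Rightarrow> real" where
  "H p k x = Q1 p k x / (\<integral>y. Q1 p k y \<partial>\<eta> p)"

lemma integral_Q1_pos: "\<mu> \<in> \<P> \<Longrightarrow> 0 < (\<integral>y. Q1 p k y \<partial>\<mu>)"
proof -
  assume \<mu>: "\<mu> \<in> \<P>"
  obtain x where x: "x \<in> space E" using space_E_not_empty by blast
  have C: "C > 0" using C_ge_1 by simp
  have "0 < Q1 p k x / C" using semigroup_one_pos[OF x] C by simp
  also have "\<dots> \<le> (\<integral>y. Q1 p k y \<partial>\<mu>)"
    using Q1_ratio[OF x, of _ p k] C
    by (intro prob_integral_ge[OF \<mu> Q1_bounded_measurable]) (simp add: field_simps)
  finally show ?thesis .
qed

lemma H_bounded_measurable: "H p k \<in> bounded_measurable E"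
  using bounded_measurable_cmult[OF Q1_bounded_measurable, of "1 / (\<integral>y. Q1 p k y \<partial>\<eta> p)"]
  by (simp add: H_def[abs_def])

lemma H_bounds:
  assumes x: "x \<in> space E"
  shows "1 / C \<le> H p k x" "H p k x \<le> C" "0 < H p k x"
proof -
  let ?I = "\<integral>y. Q1 p k y \<partial>\<eta> p"
  have C: "C > 0" using C_ge_1 by simp
  have I: "?I > 0" by (rule integral_Q1_pos[OF eta_space])
  have "?I \<le> C * Q1 p k x"
    by (rule prob_integral_le[OF eta_space Q1_bounded_measurable Q1_ratio[OF _ x]])
  then show "1 / C \<le> H p k x" using I C by (simp add: H_def field_simps)
  have "Q1 p k x / C \<le> ?I"
    using Q1_ratio[OF x, of _ p k] C
    by (intro prob_integral_ge[OF eta_space Q1_bounded_measurable]) (simp add: field_simps)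
  then show "H p k x \<le> C" using I C by (simp add: H_def field_simps)
  show "0 < H p k x" using I semigroup_one_pos[OF x] by (simp add: H_def)
qed

lemma integral_H_eta: "(\<integral>x. H p k x \<partial>\<eta> p) = 1"
  using integral_Q1_pos[OF eta_space, of p p k] by (simp add: H_def)

lemma Qbar_eq_H:
  assumes "x \<in> space E"
  shows "Qbar E \<eta>\<^sub>0 M G p (p + k) (\<lambda>_. 1) x = H p k x"
proof -
  have "(\<integral>y. Q E M G p (p + k) (\<lambda>_. 1) y \<partial>\<eta> p) = (\<integral>y. Q1 p k y \<partial>\<eta> p)"
    using eta_space[of p]
    by (intro Bochner_Integration.integral_cong Q_eq_semigroup bounded_measurable_const)
      (auto simp: space_prob_algebra dest: sets_eq_imp_space_eq)
  then show ?thesis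
    using Q_eq_semigroup[OF bounded_measurable_const assms] by (simp add: Qbar_def H_def)
qed

text \<open>The functions \<open>u\<close> and \<open>v\<close> are fixed before \<mu> and \<nu>, so
  that for random measures the bound can be averaged with deterministic test functions. Relative to
  a reference point \<open>z\<close> the flow is a constant plus a quotient whose numerator is
  already small by mixing; this is how the factor \<open>exp (- lam) ^ k\<close> survives the
  normalisation.\<close>

lemma flow_contraction:
  assumes f: "f \<in> bounded_measurable E" and f1: "\<And>x. x \<in> space E \<Longrightarrow> \<bar>f x\<bar> \<le> 1"
  obtains u v where "u \<in> bounded_measurable E" "\<And>x. x \<in> space E \<Longrightarrow> \<bar>u x\<bar> \<le> 1"
    "v \<in> bounded_measurable E" "\<And>x. x \<in> space E \<Longrightarrow> \<bar>v x\<bar> \<le> 1"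
    "\<And>\<mu> \<nu>. \<mu> \<in> \<P> \<Longrightarrow> \<nu> \<in> \<P> \<Longrightarrow>
      \<bar>flow p k \<mu> f - flow p k \<nu> f\<bar> \<le> 2 * a * C\<^sup>2 * exp (- lam) ^ k *
        (\<bar>(\<integral>x. u x \<partial>\<mu>) - (\<integral>x. u x \<partial>\<nu>)\<bar> + \<bar>(\<integral>x. v x \<partial>\<mu>) - (\<integral>x. v x \<partial>\<nu>)\<bar>)"
proof -
  obtain z where z: "z \<in> space E" using space_E_not_empty by blast
  have C: "C > 0" using C_ge_1 by simp
  \<comment> \<open>The 2 bounds the oscillation of \<open>f\<close>; the rest is the mixing
    rate.\<close>
  define b where "b = 2 * a * exp (- lam) ^ k"
  have b: "b > 0" using a by (simp add: b_def)
  define c where "c = semigroup p k f z / Q1 p k z"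
  define H' where "H' x = (1 / Q1 p k z) * Q1 p k x" for x
  \<comment> \<open>Centring at \<open>c\<close>, the kernel mean of \<open>f\<close> at
    \<open>z\<close>, makes \<open>w\<close> at most \<open>b * H'\<close> in modulus, while
    division by the value at \<open>z\<close> keeps \<open>H'\<close> between \<open>1 / C\<close>
    and \<open>C\<close>.\<close>
  define w where "w x = (1 / Q1 p k z) * (semigroup p k f x - c * Q1 p k x)" for x
  have z0: "Q1 p k z > 0" using semigroup_one_pos[OF z] .
  have H'm: "H' \<in> bounded_measurable E" and wm: "w \<in> bounded_measurable E"
    unfolding H'_def[abs_def] w_def[abs_def]
    by (intro bounded_measurable_cmult bounded_measurable_diff Q1_bounded_measurable
        semigroup_bounded_measurable f)+
  have H'1: "1 / C \<le> H' x" and H'2: "H' x \<le> C" and H'3: "0 < H' x" if x: "x \<in> space E" for x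
    using Q1_ratio[OF x z, of p k] Q1_ratio[OF z x, of p k] z0 C semigroup_one_pos[OF x, of p k]
    by (auto simp: H'_def field_simps)
  have wb: "\<bar>w x\<bar> \<le> b * H' x" if x: "x \<in> space E" for x
  proof -
    have osc: "\<bar>f x - f y\<bar> \<le> 2" if "x \<in> space E" "y \<in> space E" for x y
      using f1[OF that(1)] f1[OF that(2)] by linarith
    have "w x = H' x * (semigroup p k f x / Q1 p k x - c)"
      using semigroup_one_pos[OF x, of p k] by (simp add: w_def H'_def right_diff_distrib)
    then have "\<bar>w x\<bar> = H' x * \<bar>semigroup p k f x / Q1 p k x - c\<bar>"
      using H'3[OF x] by (simp add: abs_mult)
    also have "\<dots> \<le> H' x * b"
      using mixing_scaled[OF f _ osc x z, of p k] H'3[OF x]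
      unfolding c_def b_def by (intro mult_left_mono) (auto simp: mult_ac simp flip: exp_of_nat_mult)
    finally show ?thesis by (simp add: mult_ac)
  qed
  have flow: "flow p k \<mu> f = c + (\<integral>x. w x \<partial>\<mu>) / (\<integral>x. H' x \<partial>\<mu>)"
    if \<mu>: "\<mu> \<in> \<P>" for \<mu>
  proof -
    have "(\<integral>x. w x \<partial>\<mu>) = (1 / Q1 p k z) * ((\<integral>x. semigroup p k f x \<partial>\<mu>) - c * (\<integral>x. Q1 p k x \<partial>\<mu>))"
      unfolding w_def
      using integrable_bounded_measurable[OF \<mu> semigroup_bounded_measurable[OF f], of p k]
        integrable_bounded_measurable[OF \<mu> Q1_bounded_measurable, of p k]
      by simp
    moreover have "(\<integral>x. H' x \<partial>\<mu>) = (1 / Q1 p k z) * (\<integral>x. Q1 p k x \<partial>\<mu>)"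
      unfolding H'_def by simp
    ultimately have "(\<integral>x. w x \<partial>\<mu>) / (\<integral>x. H' x \<partial>\<mu>) =
        ((\<integral>x. semigroup p k f x \<partial>\<mu>) - c * (\<integral>x. Q1 p k x \<partial>\<mu>)) / (\<integral>x. Q1 p k x \<partial>\<mu>)"
      using z0 by simp
    then show ?thesis
      using integral_Q1_pos[OF \<mu>, of p k] by (simp add: flow_def diff_divide_distrib)
  qed
  let ?u = "\<lambda>x. (1 / (b * C)) * w x" and ?v = "\<lambda>x. (1 / C) * H' x"
  show thesis
  proof (rule that[of ?u ?v])
    show "?u \<in> bounded_measurable E" "?v \<in> bounded_measurable E"
      by (intro bounded_measurable_cmult wm H'm)+
    show "\<bar>?u x\<bar> \<le> 1" if x: "x \<in> space E" for x
    proof -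
      have "\<bar>w x\<bar> \<le> b * C"
        using wb[OF x] H'2[OF x] b by (meson less_imp_le mult_left_mono order_trans)
      then show ?thesis using b C by (simp add: abs_mult abs_divide)
    qed
    show "\<bar>?v x\<bar> \<le> 1" if x: "x \<in> space E" for x
      using H'2[OF x] H'3[OF x] C by simp
    fix \<mu> \<nu> assume \<mu>: "\<mu> \<in> \<P>" and \<nu>: "\<nu> \<in> \<P>"
    let ?hm = "\<integral>x. H' x \<partial>\<mu>" and ?hn = "\<integral>x. H' x \<partial>\<nu>" and ?wm = "\<integral>x. w x \<partial>\<mu>" and ?wn = "\<integral>x. w x \<partial>\<nu>"
    have hm: "1 / C \<le> ?hm" by (rule prob_integral_ge[OF \<mu> H'm H'1])
    have hn: "1 / C \<le> ?hn" by (rule prob_integral_ge[OF \<nu> H'm H'1])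
    have pos: "?hm > 0" "?hn > 0" using hm hn C by (auto intro: less_le_trans[of _ "1 / C"])
    have "\<bar>?wn\<bar> \<le> b * ?hn"
    proof -
      have "\<bar>?wn\<bar> \<le> (\<integral>x. b * H' x \<partial>\<nu>)"
        using wb \<nu> integrable_bounded_measurable[OF \<nu> H'm]
        by (intro norm_integral_le[where 'b=real, simplified])
          (auto simp: space_prob_algebra dest: sets_eq_imp_space_eq)
      then show ?thesis by simp
    qed
    then have r: "\<bar>?wn / ?hn\<bar> \<le> b" using pos by (simp add: abs_divide field_simps)
    have inv: "1 / ?hm \<le> C" using hm pos C by (simp add: field_simps)
    \<comment> \<open>A difference of quotients with the quotient for \<nu> factored out: it is at
      most \<open>b\<close>, so both terms carry this small factor.\<close>
    have "flow p k \<mu> f - flow p k \<nu> f = (1 / ?hm) * ((?wm - ?wn) - (?wn / ?hn) * (?hm - ?hn))"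
      using pos by (simp add: flow \<mu> \<nu> field_simps)
    also have "\<bar>\<dots>\<bar> \<le> C * (\<bar>?wm - ?wn\<bar> + b * \<bar>?hm - ?hn\<bar>)"
      unfolding abs_mult[of "1 / ?hm"]
    proof (rule mult_mono)
      show "\<bar>1 / ?hm\<bar> \<le> C" using inv pos by simp
      have "\<bar>(?wn / ?hn) * (?hm - ?hn)\<bar> \<le> b * \<bar>?hm - ?hn\<bar>"
        unfolding abs_mult by (intro mult_right_mono r) simp
      then show "\<bar>(?wm - ?wn) - (?wn / ?hn) * (?hm - ?hn)\<bar> \<le> \<bar>?wm - ?wn\<bar> + b * \<bar>?hm - ?hn\<bar>"
        by linarith
    qed (use C in auto)
    also have "\<dots> = 2 * a * C\<^sup>2 * exp (- lam) ^ k *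
        (\<bar>(\<integral>x. ?u x \<partial>\<mu>) - (\<integral>x. ?u x \<partial>\<nu>)\<bar> + \<bar>(\<integral>x. ?v x \<partial>\<mu>) - (\<integral>x. ?v x \<partial>\<nu>)\<bar>)"
    proof -
      have eq1: "\<bar>(\<integral>x. ?u x \<partial>\<mu>) - (\<integral>x. ?u x \<partial>\<nu>)\<bar> = \<bar>?wm - ?wn\<bar> / (b * C)"
        using b C by (simp add: abs_divide flip: diff_divide_distrib)
      have eq2: "\<bar>(\<integral>x. ?v x \<partial>\<mu>) - (\<integral>x. ?v x \<partial>\<nu>)\<bar> = \<bar>?hm - ?hn\<bar> / C"
        using C by (simp add: abs_divide flip: diff_divide_distrib)
      have eq3: "2 * a * C\<^sup>2 * exp (- lam) ^ k = b * C\<^sup>2" by (simp add: b_def)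
      show ?thesis
        unfolding eq1 eq2 eq3 using b C by (simp add: field_simps power2_eq_square)
    qed
    finally show "\<bar>flow p k \<mu> f - flow p k \<nu> f\<bar> \<le> 2 * a * C\<^sup>2 * exp (- lam) ^ k *
        (\<bar>(\<integral>x. ?u x \<partial>\<mu>) - (\<integral>x. ?u x \<partial>\<nu>)\<bar> + \<bar>(\<integral>x. ?v x \<partial>\<mu>) - (\<integral>x. ?v x \<partial>\<nu>)\<bar>)" .
  qed
qed

end

section \<open>Fluctuations of the particle system\<close>

text \<open>The Lipschitz condition is stated with a test function bounded by 1 rather than of
  oscillation at most 1; the two differ by a constant, which cancels between probability measures.
  The function may depend on \<open>\<mu>2\<close> but serves every \<open>\<mu>1\<close>, as random
  empirical measures require.\<close>

locale particle_model = stable_feynman_kac +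
  fixes K :: "nat \<Rightarrow> 'a measure \<Rightarrow> 'a \<Rightarrow> 'a measure" and \<kappa> :: real
    and W :: "'w measure" and N :: nat and \<xi> :: "nat \<Rightarrow> nat \<Rightarrow> 'w \<Rightarrow> 'a"
  assumes K: "\<And>n \<mu>. n \<ge> 1 \<Longrightarrow> \<mu> \<in> \<P> \<Longrightarrow> K n \<mu> \<in> E \<rightarrow>\<^sub>M prob_algebra E"
    and K_Phi: "\<And>n \<mu>. n \<ge> 1 \<Longrightarrow> \<mu> \<in> \<P> \<Longrightarrow> Phi M G n \<mu> = bind \<mu> (K n \<mu>)"
    and K_0: "\<And>\<mu> x. \<mu> \<in> \<P> \<Longrightarrow> x \<in> space E \<Longrightarrow> K 0 \<mu> x = \<eta>\<^sub>0"
    and \<kappa>: "\<kappa> \<ge> 0"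
    and K_Lipschitz: "\<And>n f \<mu>2. f \<in> bounded_measurable E \<Longrightarrow>
      (\<And>x y. x \<in> space E \<Longrightarrow> y \<in> space E \<Longrightarrow> \<bar>f x - f y\<bar> \<le> 1) \<Longrightarrow> \<mu>2 \<in> \<P> \<Longrightarrow>
      \<exists>v\<in>bounded_measurable E. (\<forall>x\<in>space E. \<bar>v x\<bar> \<le> 1) \<and>
        (\<forall>\<mu>1\<in>\<P>. \<forall>x\<in>space E.
          \<bar>(\<integral>y. f y \<partial>K n \<mu>1 x) - (\<integral>y. f y \<partial>K n \<mu>2 x)\<bar> \<le> \<kappa> * \<bar>(\<integral>x. v x \<partial>\<mu>1) - (\<integral>x. v x \<partial>\<mu>2)\<bar>)"
    and particles: "particle_system E \<eta>\<^sub>0 K W N \<xi>"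
    and N: "N \<ge> 1"
begin

sublocale prob_space W
  using particles by (simp add: particle_system_def)

lemma \<xi> [measurable]: "i \<in> {1..N} \<Longrightarrow> \<xi> n i \<in> W \<rightarrow>\<^sub>M E"
  using particles by (auto simp: particle_system_def)

lemma \<xi>_space: "i \<in> {1..N} \<Longrightarrow> e \<in> space W \<Longrightarrow> \<xi> n i e \<in> space E"
  using measurable_space[OF \<xi>] by blast

abbreviation emp :: "nat \<Rightarrow> 'w \<Rightarrow> 'a measure" where
  "emp n e \<equiv> empirical E N (\<lambda>j. \<xi> n j e)"

lemma emp_space:
  assumes e: "e \<in> space W"
  shows "emp n e \<in> \<P>"
proof -
  have "prob_space (uniform_count_measure {1..N})"
    using N by (intro prob_space_uniform_count_measure) auto
  moreover have "(\<lambda>j. \<xi> n j e) \<in> uniform_count_measure {1..N} \<rightarrow>\<^sub>M E"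
    using \<xi>_space[OF _ e] by (auto simp: measurable_def space_uniform_count_measure sets_uniform_count_measure)
  ultimately show ?thesis
    by (auto simp: space_prob_algebra empirical_def prob_space.prob_space_distr)
qed

lemma integral_emp:
  assumes e: "e \<in> space W" and f: "f \<in> bounded_measurable E"
  shows "(\<integral>x. f x \<partial>emp n e) = (\<Sum>i=1..N. f (\<xi> n i e)) / N"
proof -
  have m: "(\<lambda>j. \<xi> n j e) \<in> uniform_count_measure {1..N} \<rightarrow>\<^sub>M E"
    using \<xi>_space[OF _ e] by (auto simp: measurable_def space_uniform_count_measure sets_uniform_count_measure)
  have "(\<integral>x. f x \<partial>emp n e) = (\<integral>j. f (\<xi> n j e) \<partial>uniform_count_measure {1..N})"
    unfolding empirical_def by (rule integral_distr[OF m bounded_measurableD[OF f]])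
  also have "\<dots> = (\<Sum>i=1..N. f (\<xi> n i e)) / N"
    by (simp add: integral_uniform_count_measure)
  finally show ?thesis .
qed

text \<open>The conditional mean of the empirical measure at time \<open>n\<close> given the past.\<close>

definition pred :: "nat \<Rightarrow> 'w \<Rightarrow> 'a measure" where
  "pred n e = (case n of 0 \<Rightarrow> \<eta>\<^sub>0 | Suc r \<Rightarrow> Phi M G (Suc r) (emp r e))"

lemma pred_space: "e \<in> space W \<Longrightarrow> pred n e \<in> \<P>"
  by (auto simp: pred_def eta0 emp_space intro!: Phi_integral(1) split: nat.split)

abbreviation past' :: "nat \<Rightarrow> 'w measure" where
  "past' \<equiv> past E W N \<xi>"

lemma past_subset:
  "{\<xi> p i -` A \<inter> space W | p i A. p < n \<and> i \<in> {1..N} \<and> A \<in> sets E} \<subseteq> sets W"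
  using measurable_sets[OF \<xi>] by auto

lemma
  shows space_past: "space (past' n) = space W"
    and sets_past: "sets (past' n) =
      sigma_sets (space W) {\<xi> p i -` A \<inter> space W | p i A. p < n \<and> i \<in> {1..N} \<and> A \<in> sets E}"
proof -
  have "{\<xi> p i -` A \<inter> space W | p i A. p < n \<and> i \<in> {1..N} \<and> A \<in> sets E} \<subseteq> Pow (space W)" by auto
  then show "space (past' n) = space W" "sets (past' n) =
      sigma_sets (space W) {\<xi> p i -` A \<inter> space W | p i A. p < n \<and> i \<in> {1..N} \<and> A \<in> sets E}"
    unfolding past_def by (simp_all add: space_measure_of sets_measure_of)
qed

lemma subalgebra_past: "subalgebra W (past' n)"
  unfolding subalgebra_def space_past sets_past
  using sets.sigma_sets_subset[OF past_subset] by simp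

lemma \<xi>_past: "p < n \<Longrightarrow> i \<in> {1..N} \<Longrightarrow> \<xi> p i \<in> past' n \<rightarrow>\<^sub>M E"
  by (rule measurableI) (auto simp: space_past sets_past \<xi>_space intro!: sigma_sets.Basic)

lemma measurable_integral_emp:
  assumes f: "f \<in> bounded_measurable E" and pn: "p < n"
  shows "(\<lambda>e. \<integral>x. f x \<partial>emp p e) \<in> borel_measurable (past' n)"
proof -
  have "(\<lambda>e. (\<Sum>i=1..N. f (\<xi> p i e)) / N) \<in> borel_measurable (past' n)"
    using pn by (intro borel_measurable_divide borel_measurable_sum borel_measurable_const
        measurable_compose[OF \<xi>_past bounded_measurableD[OF f]])
  then show ?thesis
    by (rule measurable_cong[THEN iffD1, rotated]) (simp add: integral_emp f space_past)
qed

lemma integral_pred_Suc: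
  assumes e: "e \<in> space W" and f: "f \<in> bounded_measurable E"
  shows "(\<integral>x. f x \<partial>pred (Suc r) e) = (\<integral>x. G r x * Mop (Suc r) f x \<partial>emp r e) / (\<integral>x. G r x \<partial>emp r e)"
  unfolding pred_def using Phi_integral(2)[OF emp_space[OF e] f] by simp

lemma measurable_integral_pred:
  assumes f: "f \<in> bounded_measurable E"
  shows "(\<lambda>e. \<integral>x. f x \<partial>pred n e) \<in> borel_measurable (past' n)"
proof (cases n)
  case (Suc r)
  have "(\<lambda>e. (\<integral>x. G r x * Mop (Suc r) f x \<partial>emp r e) / (\<integral>x. G r x \<partial>emp r e)) \<in> borel_measurable (past' n)"
    using Suc by (intro borel_measurable_divide measurable_integral_emp step_bounded_measurable f G) auto
  then show ?thesis
    by (rule measurable_cong[THEN iffD1, rotated]) (simp add: integral_pred_Suc f space_past Suc)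
qed (simp add: pred_def)

text \<open>At \<open>n = 0\<close> truncated subtraction refers to the particles of time 0
  themselves; by \<open>K_0\<close> the value is \<open>\<eta>\<^sub>0\<close> all the same.\<close>

abbreviation kern :: "nat \<Rightarrow> nat \<Rightarrow> 'w \<Rightarrow> 'a measure" where
  "kern n i e \<equiv> K n (emp (n - 1) e) (\<xi> (n - 1) i e)"

lemma kern_space:
  assumes "i \<in> {1..N}" "e \<in> space W"
  shows "kern n i e \<in> \<P>"
proof (cases n)
  case 0
  then show ?thesis using K_0[OF emp_space \<xi>_space] assms eta0 by simp
next
  case (Suc r)
  then show ?thesis
    using measurable_space[OF K[OF _ emp_space[OF assms(2)]] \<xi>_space[OF assms]] by simp
qed

lemma initial_distribution:
  assumes A: "A \<in> {1..N} \<rightarrow> sets E"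
  shows "prob {e \<in> space W. \<forall>i\<in>{1..N}. \<xi> 0 i e \<in> A i} = (\<Prod>i=1..N. measure \<eta>\<^sub>0 (A i))"
proof -
  from eta0 have s: "sets \<eta>\<^sub>0 = sets E" and "prob_space \<eta>\<^sub>0" by (auto simp: space_prob_algebra)
  then interpret \<eta>: prob_space \<eta>\<^sub>0 by simp
  interpret prod: finite_product_prob_space "\<lambda>_. \<eta>\<^sub>0" "{1..N}" by unfold_locales auto
  let ?X = "\<lambda>e. \<lambda>i\<in>{1..N}. \<xi> 0 i e"
  have X: "?X \<in> W \<rightarrow>\<^sub>M (\<Pi>\<^sub>M i\<in>{1..N}. E)" by (intro measurable_restrict \<xi>)
  have AP: "(\<Pi>\<^sub>E i\<in>{1..N}. A i) \<in> sets (\<Pi>\<^sub>M i\<in>{1..N}. E)" using A by (intro sets_PiM_I_finite) auto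
  have "prob {e \<in> space W. \<forall>i\<in>{1..N}. \<xi> 0 i e \<in> A i} = prob (?X -` (\<Pi>\<^sub>E i\<in>{1..N}. A i) \<inter> space W)"
    by (intro arg_cong[where f=prob]) (auto simp: PiE_iff)
  also have "\<dots> = measure (distr W (\<Pi>\<^sub>M i\<in>{1..N}. E) ?X) (\<Pi>\<^sub>E i\<in>{1..N}. A i)"
    by (rule measure_distr[OF X AP, symmetric])
  also have "distr W (\<Pi>\<^sub>M i\<in>{1..N}. E) ?X = (\<Pi>\<^sub>M i\<in>{1..N}. \<eta>\<^sub>0)"
    using particles by (simp add: particle_system_def)
  also have "measure \<dots> (\<Pi>\<^sub>E i\<in>{1..N}. A i) = (\<Prod>i=1..N. measure \<eta>\<^sub>0 (A i))"
    using A s by (intro prod.prob_times) auto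
  finally show ?thesis .
qed

text \<open>From time 1 on this is the transition rule of the particle system. At time 0 the past is
  the trivial sigma-algebra, so conditional expectations are plain probabilities and the initial
  product law gives the claim.\<close>

lemma conditionally_independent_step:
  "conditionally_independent W (past' n) E {1..N} (\<xi> n) (kern n)"
proof -
  have fin: "finite_measure_subalgebra W (past' n)"
    by unfold_locales (rule subalgebra_past)
  then interpret F: finite_measure_subalgebra W "past' n" .
  have "AE e in W. real_cond_exp W (past' n) (indicator {e \<in> space W. \<forall>i\<in>{1..N}. \<xi> n i e \<in> A i}) e =
      (\<Prod>i=1..N. measure (kern n i e) (A i))" if A: "A \<in> {1..N} \<rightarrow> sets E" for A
  proof (cases n)
    case 0
    let ?S = "{e \<in> space W. \<forall>i\<in>{1..N}. \<xi> 0 i e \<in> A i}"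
    have A': "A i \<in> sets E" if "i \<in> {1..N}" for i using A that by auto
    note [measurable] = A'
    have S: "?S \<in> sets W" by measurable
    have AES: "AE e in W. real_cond_exp W (past' 0) (indicator ?S) e = prob ?S"
    proof (rule F.real_cond_exp_charact[unfolded 0])
      fix B assume "B \<in> sets (past' 0)"
      then have "B = {} \<or> B = space W" by (simp add: sets_past sigma_sets_empty_eq)
      then show "(\<integral>x\<in>B. indicator ?S x \<partial>W) = (\<integral>x\<in>B. prob ?S \<partial>W)"
        using S by (auto simp: set_lebesgue_integral_def prob_space Int_absorb2 subset_eq
            simp flip: indicator_inter_arith)
    qed (use S in \<open>auto intro!: integrable_real_indicator simp: emeasure_eq_measure\<close>)
    have kern0: "prob ?S = (\<Prod>i=1..N. measure (kern 0 i e) (A i))" if "e \<in> space W" for e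
      unfolding initial_distribution[OF A] using K_0[OF emp_space[OF that] \<xi>_space[OF _ that]]
      by (intro prod.cong) auto
    from AES AE_space show ?thesis unfolding 0 by eventually_elim (simp only: kern0)
  next
    case (Suc r)
    have "n \<ge> 1" using Suc by simp
    with particles A show ?thesis unfolding particle_system_def by blast
  qed
  then show ?thesis
    unfolding conditionally_independent_def conditionally_independent_axioms_def
    using fin kern_space prob_space_axioms \<xi> by auto
qed


text \<open>The second identity is where the consistency of the kernels with \<open>Phi\<close>
  enters: averaging the kernel over the particles integrates it against the very measure that
  indexes it.\<close>

lemma step_avg:
  assumes f: "f \<in> bounded_measurable E" and e: "e \<in> space W"
  shows "conditionally_independent.avg {1..N} (\<xi> n) f e = (\<integral>x. f x \<partial>emp n e)"
    and "conditionally_independent.kavg {1..N} (kern n) f e = (\<integral>x. f x \<partial>pred n e)"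
proof -
  interpret S: conditionally_independent W "past' n" E "{1..N}" "\<xi> n" "kern n"
    by (rule conditionally_independent_step)
  show "S.avg f e = (\<integral>x. f x \<partial>emp n e)"
    unfolding S.avg_def integral_emp[OF e f] by simp
  show "S.kavg f e = (\<integral>x. f x \<partial>pred n e)"
  proof (cases n)
    case 0
    then show ?thesis
      using N K_0[OF emp_space[OF e] \<xi>_space[OF _ e]]
      unfolding S.kavg_def S.kint_def by (simp add: pred_def)
  next
    case (Suc r)
    have Km: "K n (emp r e) \<in> E \<rightarrow>\<^sub>M prob_algebra E" using Suc by (intro K emp_space[OF e]) simp
    have "(\<integral>x. f x \<partial>pred n e) = (\<integral>x. \<integral>y. f y \<partial>K n (emp r e) x \<partial>emp r e)"
      using K_Phi[OF _ emp_space[OF e], of n r] integral_bind_kernel[OF emp_space[OF e] Km f]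
      by (simp add: pred_def Suc)
    also have "\<dots> = S.kavg f e"
      unfolding integral_emp[OF e kernel_bounded_measurable[OF Km f]] S.kavg_def S.kint_def
      by (simp add: Suc)
    finally show ?thesis by simp
  qed
qed

lemma integrable_emp:
  assumes f: "f \<in> bounded_measurable E"
  shows "(\<lambda>e. \<integral>x. f x \<partial>emp n e) \<in> borel_measurable W"
    and "(\<lambda>e. \<integral>x. f x \<partial>pred n e) \<in> borel_measurable W"
    and "integrable W (\<lambda>e. \<integral>x. f x \<partial>emp n e)"
    and "integrable W (\<lambda>e. \<integral>x. f x \<partial>pred n e)"
proof -
  obtain B where B: "\<And>x. x \<in> space E \<Longrightarrow> \<bar>f x\<bar> \<le> B" using bounded_measurable_bound[OF f] by blast
  show m: "(\<lambda>e. \<integral>x. f x \<partial>emp n e) \<in> borel_measurable W" "(\<lambda>e. \<integral>x. f x \<partial>pred n e) \<in> borel_measurable W"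
    using measurable_from_subalg[OF subalgebra_past measurable_integral_emp[OF f, of n "Suc n"]]
      measurable_from_subalg[OF subalgebra_past measurable_integral_pred[OF f, of n]] by simp_all
  show "integrable W (\<lambda>e. \<integral>x. f x \<partial>emp n e)" "integrable W (\<lambda>e. \<integral>x. f x \<partial>pred n e)"
    using m prob_integral_abs_le[OF emp_space f B] prob_integral_abs_le[OF pred_space f B]
    by (auto intro!: integrable_const_bound[where B=B])
qed

section \<open>Error of the empirical measures, uniformly in time\<close>

lemma local_moments:
  assumes f: "f \<in> bounded_measurable E" and c: "\<And>x. x \<in> space E \<Longrightarrow> \<bar>f x\<bar> \<le> c"
  shows "expectation (\<lambda>e. \<bar>(\<integral>x. f x \<partial>emp n e) - (\<integral>x. f x \<partial>pred n e)\<bar>) \<le> 2 * exp (c\<^sup>2) / sqrt N"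
    and "expectation (\<lambda>e. \<bar>(\<integral>x. f x \<partial>emp n e) - (\<integral>x. f x \<partial>pred n e)\<bar> ^ 3)
      \<le> 12 * exp (c\<^sup>2) / (N * sqrt N)"
proof -
  interpret S: conditionally_independent W "past' n" E "{1..N}" "\<xi> n" "kern n"
    by (rule conditionally_independent_step)
  have I: "{1..N} \<noteq> {}" using N by simp
  note * = S.moments_avg[OF f c measurable_integral_pred[OF f, of n] step_avg(2)[OF f, symmetric] I]
  show "expectation (\<lambda>e. \<bar>(\<integral>x. f x \<partial>emp n e) - (\<integral>x. f x \<partial>pred n e)\<bar>) \<le> 2 * exp (c\<^sup>2) / sqrt N"
    using *(1) by (simp only: step_avg(1)[OF f] card_atLeastAtMost diff_Suc_1
        cong: Bochner_Integration.integral_cong)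
  show "expectation (\<lambda>e. \<bar>(\<integral>x. f x \<partial>emp n e) - (\<integral>x. f x \<partial>pred n e)\<bar> ^ 3)
      \<le> 12 * exp (c\<^sup>2) / (N * sqrt N)"
    using *(2) by (simp only: step_avg(1)[OF f] card_atLeastAtMost diff_Suc_1
        cong: Bochner_Integration.integral_cong)
qed

text \<open>Telescoping in time: as \<open>pred (Suc m)\<close> is \<open>Phi\<close> of
  \<open>emp m\<close>, both are carried to the same value at time \<open>p\<close>, and only the
  local sampling errors between \<open>pred q\<close> and \<open>emp q\<close> remain.\<close>

lemma pointwise_error_bound:
  assumes f: "f \<in> bounded_measurable E" and f1: "\<And>x. x \<in> space E \<Longrightarrow> \<bar>f x\<bar> \<le> 1"
    and e: "e \<in> space W"
  shows "\<bar>(\<integral>x. f x \<partial>emp p e) - (\<integral>x. f x \<partial>\<eta> p)\<bar> \<le>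
    (\<Sum>q\<le>p. \<bar>flow q (p - q) (emp q e) f - flow q (p - q) (pred q e) f\<bar>)"
proof -
  have "\<bar>flow m (p - m) (emp m e) f - (\<integral>x. f x \<partial>\<eta> p)\<bar> \<le>
      (\<Sum>q\<le>m. \<bar>flow q (p - q) (emp q e) f - flow q (p - q) (pred q e) f\<bar>)" if "m \<le> p" for m
    using that
  proof (induction m)
    case 0
    then show ?case
      using flow_eta[OF f, of 0 p] eta_0[OF eta0 M G G_pos] by (simp add: pred_def)
  next
    case (Suc m)
    then have "flow m (p - m) (emp m e) f = flow (Suc m) (p - Suc m) (pred (Suc m) e) f"
      using flow_Suc[OF emp_space[OF e] f, of m "p - Suc m" m] by (simp add: pred_def Suc_diff_Suc)
    with Suc show ?case by simp
  qed
  from this[of p] show ?thesis using flow_0[OF emp_space[OF e]] by simp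
qed

text \<open>The contraction factor \<open>2 * a * C\<^sup>2\<close>, times \<open>4 * exp 1\<close>
  for the local errors of two test functions bounded by 1, times the geometric sum over past
  times.\<close>

definition c1 :: real where
  "c1 = 8 * a * C\<^sup>2 * exp 1 / (1 - exp (- lam))"

lemma c1_nonneg: "c1 \<ge> 0"
  using a lam by (simp add: c1_def)

text \<open>The contraction reduces the error to two deterministic test functions, to each of which
  the local moment bound applies.\<close>

lemma local_flow_error:
  fixes q k :: nat
  assumes f: "f \<in> bounded_measurable E" and f1: "\<And>x. x \<in> space E \<Longrightarrow> \<bar>f x\<bar> \<le> 1"
  defines "D \<equiv> \<lambda>e. \<bar>flow q k (emp q e) f - flow q k (pred q e) f\<bar>"
  shows "integrable W D" "expectation D \<le> 2 * a * C\<^sup>2 * exp (- lam) ^ k * (4 * exp 1 / sqrt N)"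
proof -
  let ?D = "\<lambda>u e. \<bar>(\<integral>x. u x \<partial>emp q e) - (\<integral>x. u x \<partial>pred q e)\<bar>" and ?b = "2 * a * C\<^sup>2 * exp (- lam) ^ k"
  obtain u v where u: "u \<in> bounded_measurable E" "\<And>x. x \<in> space E \<Longrightarrow> \<bar>u x\<bar> \<le> 1"
    and v: "v \<in> bounded_measurable E" "\<And>x. x \<in> space E \<Longrightarrow> \<bar>v x\<bar> \<le> 1"
    and uv: "\<And>e. e \<in> space W \<Longrightarrow> D e \<le> ?b * (?D u e + ?D v e)"
    using flow_contraction[OF f f1, of q k] emp_space[of _ q] pred_space[of _ q] unfolding D_def by metis
  have int: "integrable W (\<lambda>e. ?b * (?D u e + ?D v e))" "integrable W (?D u)" "integrable W (?D v)"
    using integrable_emp(3,4)[OF u(1)] integrable_emp(3,4)[OF v(1)] by simp_all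
  have [measurable]: "D \<in> borel_measurable W"
    unfolding D_def flow_def using semigroup_bounded_measurable[OF f, of q k] Q1_bounded_measurable[of q k]
    by (intro borel_measurable_abs borel_measurable_diff borel_measurable_divide integrable_emp(1,2))
  show "integrable W D"
  proof (rule Bochner_Integration.integrable_bound[OF int(1)])
    show "AE e in W. norm (D e) \<le> norm (?b * (?D u e + ?D v e))"
      using uv by (intro AE_I2) (fastforce simp: D_def intro: order_trans[OF _ abs_ge_self])
  qed measurable
  then have "expectation D \<le> ?b * (expectation (?D u) + expectation (?D v))"
    using integral_mono[OF _ int(1) uv] int by simp
  also have "\<dots> \<le> ?b * (2 * exp (1\<^sup>2) / sqrt N + 2 * exp (1\<^sup>2) / sqrt N)"
    using a by (intro mult_left_mono add_mono local_moments u v) auto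
  finally show "expectation D \<le> ?b * (4 * exp 1 / sqrt N)" by simp
qed

text \<open>The sampling error of time \<open>q\<close> enters with weight
  \<open>exp (- lam) ^ (p - q)\<close>, so the sum over \<open>q\<close> stays bounded whatever
  \<open>p\<close> is.\<close>

lemma uniform_error_bound:
  assumes f: "f \<in> bounded_measurable E" and f1: "\<And>x. x \<in> space E \<Longrightarrow> \<bar>f x\<bar> \<le> 1"
  shows "expectation (\<lambda>e. \<bar>(\<integral>x. f x \<partial>emp p e) - (\<integral>x. f x \<partial>\<eta> p)\<bar>) \<le> c1 / sqrt N"
proof -
  let ?D = "\<lambda>q e. \<bar>flow q (p - q) (emp q e) f - flow q (p - q) (pred q e) f\<bar>"
  have "expectation (\<lambda>e. \<bar>(\<integral>x. f x \<partial>emp p e) - (\<integral>x. f x \<partial>\<eta> p)\<bar>) \<le>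
      expectation (\<lambda>e. \<Sum>q\<le>p. ?D q e)"
    using integrable_emp(3)[OF f] local_flow_error(1)[OF f f1]
    by (intro integral_mono pointwise_error_bound[OF f f1]) auto
  also have "\<dots> = (\<Sum>q\<le>p. expectation (?D q))"
    using local_flow_error(1)[OF f f1] by simp
  also have "\<dots> \<le> (\<Sum>q\<le>p. 2 * a * C\<^sup>2 * exp (- lam) ^ (p - q) * (4 * exp 1 / sqrt N))"
    by (intro sum_mono local_flow_error(2)[OF f f1])
  also have "\<dots> = 8 * a * C\<^sup>2 * exp 1 / sqrt N * (\<Sum>q\<le>p. exp (- lam) ^ (p - q))"
    by (simp add: sum_distrib_left sum_divide_distrib mult_ac)
  also have "(\<Sum>q\<le>p. exp (- lam) ^ (p - q)) = (\<Sum>q\<le>p. exp (- lam) ^ q)"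
    by (rule sum.reindex_bij_witness[where i="\<lambda>q. p - q" and j="\<lambda>q. p - q"]) auto
  also have "8 * a * C\<^sup>2 * exp 1 / sqrt N * \<dots> \<le> 8 * a * C\<^sup>2 * exp 1 / sqrt N * (1 / (1 - exp (- lam)))"
  proof (rule mult_left_mono)
    have "(\<Sum>q\<le>p. exp (- lam) ^ q) \<le> (\<Sum>q. exp (- lam) ^ q)"
      using lam by (intro sum_le_suminf summable_geometric) auto
    also have "\<dots> = 1 / (1 - exp (- lam))"
      using lam by (intro suminf_geometric) auto
    finally show "(\<Sum>q\<le>p. exp (- lam) ^ q) \<le> 1 / (1 - exp (- lam))" .
  qed (use a in simp)
  finally show ?thesis by (simp add: c1_def mult.commute)
qed

lemma uniform_error_bound_scaled:
  assumes f: "f \<in> bounded_measurable E" and B: "B > 0" "\<And>x. x \<in> space E \<Longrightarrow> \<bar>f x\<bar> \<le> B"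
  shows "expectation (\<lambda>e. \<bar>(\<integral>x. f x \<partial>emp p e) - (\<integral>x. f x \<partial>\<eta> p)\<bar>) \<le> B * c1 / sqrt N"
proof -
  let ?f = "\<lambda>x. (1 / B) * f x"
  have "expectation (\<lambda>e. \<bar>(\<integral>x. ?f x \<partial>emp p e) - (\<integral>x. ?f x \<partial>\<eta> p)\<bar>) \<le> c1 / sqrt N"
    using B by (intro uniform_error_bound bounded_measurable_cmult f) (simp add: abs_mult)
  moreover have "\<bar>(\<integral>x. ?f x \<partial>emp p e) - (\<integral>x. ?f x \<partial>\<eta> p)\<bar> =
      \<bar>(\<integral>x. f x \<partial>emp p e) - (\<integral>x. f x \<partial>\<eta> p)\<bar> / B" for e
    using B by (simp add: abs_divide flip: diff_divide_distrib)
  ultimately show ?thesis using B by (simp add: field_simps)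
qed

text \<open>One application of the contraction, with two test functions of error \<open>c1\<close>
  each.\<close>

definition c2 :: real where
  "c2 = 4 * a * C\<^sup>2 * c1"

lemma c2_nonneg: "c2 \<ge> 0"
  using a c1_nonneg by (simp add: c2_def)

text \<open>\<open>pred p\<close> is one step of the flow from \<open>emp (p - 1)\<close>, and
  \<open>\<eta> p\<close> is the same step from \<open>\<eta> (p - 1)\<close>; at time 0 both are
  \<open>\<eta>\<^sub>0\<close>.\<close>

lemma pred_error_bound:
  assumes f: "f \<in> bounded_measurable E" and B: "B > 0" "\<And>x. x \<in> space E \<Longrightarrow> \<bar>f x\<bar> \<le> B"
  shows "expectation (\<lambda>e. \<bar>(\<integral>x. f x \<partial>pred p e) - (\<integral>x. f x \<partial>\<eta> p)\<bar>) \<le> B * c2 / sqrt N"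
proof (cases p)
  case 0
  then show ?thesis
    using eta_0[OF eta0 M G G_pos] c2_nonneg B by (simp add: pred_def)
next
  case (Suc r)
  let ?f = "\<lambda>x. (1 / B) * f x"
  have f': "?f \<in> bounded_measurable E" by (rule bounded_measurable_cmult[OF f])
  have f1: "\<bar>?f x\<bar> \<le> 1" if "x \<in> space E" for x using B that by (simp add: abs_mult)
  obtain u v where u: "u \<in> bounded_measurable E" "\<And>x. x \<in> space E \<Longrightarrow> \<bar>u x\<bar> \<le> 1"
    and v: "v \<in> bounded_measurable E" "\<And>x. x \<in> space E \<Longrightarrow> \<bar>v x\<bar> \<le> 1"
    and uv: "\<And>\<mu> \<nu>. \<mu> \<in> \<P> \<Longrightarrow> \<nu> \<in> \<P> \<Longrightarrow>
      \<bar>flow r 1 \<mu> ?f - flow r 1 \<nu> ?f\<bar> \<le> 2 * a * C\<^sup>2 * exp (- lam) ^ 1 *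
        (\<bar>(\<integral>x. u x \<partial>\<mu>) - (\<integral>x. u x \<partial>\<nu>)\<bar> + \<bar>(\<integral>x. v x \<partial>\<mu>) - (\<integral>x. v x \<partial>\<nu>)\<bar>)"
    using flow_contraction[OF f' f1, of r 1] by blast
  let ?D = "\<lambda>u e. \<bar>(\<integral>x. u x \<partial>emp r e) - (\<integral>x. u x \<partial>\<eta> r)\<bar>"
  have int: "integrable W (?D h)" if "h \<in> bounded_measurable E" for h
    using integrable_emp(3)[OF that] by simp
  have pw: "\<bar>(\<integral>x. f x \<partial>pred p e) - (\<integral>x. f x \<partial>\<eta> p)\<bar> \<le> B * (2 * a * C\<^sup>2 * (?D u e + ?D v e))"
    if e: "e \<in> space W" for e
  proof -
    have "flow r 1 (emp r e) ?f = (\<integral>x. f x \<partial>pred p e) / B"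
      using flow_Suc[OF emp_space[OF e] f', of r 0 r] flow_0[OF pred_space[OF e], of "Suc r" "Suc r" ?f]
      by (simp add: pred_def Suc)
    moreover have "flow r 1 (\<eta> r) ?f = (\<integral>x. f x \<partial>\<eta> p) / B"
      using flow_eta[OF f', of r 1] by (simp add: Suc)
    ultimately have "\<bar>(\<integral>x. f x \<partial>pred p e) - (\<integral>x. f x \<partial>\<eta> p)\<bar> / B \<le>
        2 * a * C\<^sup>2 * exp (- lam) * (?D u e + ?D v e)"
      using uv[OF emp_space[OF e] eta_space, of r r] B by (simp add: abs_divide flip: diff_divide_distrib)
    also have "\<dots> \<le> 2 * a * C\<^sup>2 * 1 * (?D u e + ?D v e)"
      using a lam by (intro mult_right_mono mult_left_mono) auto
    finally show ?thesis using B by (simp add: field_simps)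
  qed
  have "expectation (\<lambda>e. \<bar>(\<integral>x. f x \<partial>pred p e) - (\<integral>x. f x \<partial>\<eta> p)\<bar>) \<le>
      expectation (\<lambda>e. B * (2 * a * C\<^sup>2 * (?D u e + ?D v e)))"
    using integrable_emp(4)[OF f] int u v by (intro integral_mono pw) auto
  also have "\<dots> = B * (2 * a * C\<^sup>2 * (expectation (?D u) + expectation (?D v)))"
    using int u v by simp
  also have "\<dots> \<le> B * (2 * a * C\<^sup>2 * (c1 / sqrt N + c1 / sqrt N))"
    using a B by (intro mult_left_mono add_mono uniform_error_bound u v) auto
  also have "\<dots> = B * c2 / sqrt N" by (simp add: c2_def)
  finally show ?thesis .
qed

section \<open>The conditional variance and its deterministic counterpart\<close>

lemma K_kernel:
  assumes \<mu>: "\<mu> \<in> \<P>"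
  shows "K p \<mu> \<in> E \<rightarrow>\<^sub>M prob_algebra E"
proof (cases p)
  case 0
  have "(\<lambda>_. \<eta>\<^sub>0) \<in> E \<rightarrow>\<^sub>M prob_algebra E" using eta0 by simp
  then show ?thesis
    by (rule measurable_cong[THEN iffD1, rotated]) (simp add: K_0[OF \<mu>] 0)
qed (simp add: K[OF _ \<mu>])

text \<open>Consistency of the kernels along the exact flow. At \<open>p = 0\<close> truncated
  subtraction yields \<open>\<eta> 0\<close>, in agreement with the convention for time -1.\<close>

lemma K_mean_eta:
  assumes f: "f \<in> bounded_measurable E"
  shows "(\<integral>x. \<integral>y. f y \<partial>K p (\<eta> (p - 1)) x \<partial>\<eta> (p - 1)) =
    (\<integral>x. f x \<partial>\<eta> p)"
proof (cases p)
  case 0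
  let ?\<eta> = "\<eta> 0"
  have "(\<integral>x. \<integral>y. f y \<partial>K 0 ?\<eta> x \<partial>?\<eta>) = (\<integral>x. \<integral>y. f y \<partial>\<eta>\<^sub>0 \<partial>?\<eta>)"
    using eta_space[of 0] K_0[OF eta_space]
    by (intro Bochner_Integration.integral_cong) (auto simp: space_prob_algebra dest: sets_eq_imp_space_eq)
  also have "\<dots> = (\<integral>y. f y \<partial>\<eta>\<^sub>0)"
    using eta_space[of 0] prob_space.prob_space[of ?\<eta>] by (auto simp: space_prob_algebra)
  finally show ?thesis
    using eta_0[OF eta0 M G G_pos] 0 by simp
next
  case (Suc r)
  show ?thesis
    using integral_bind_kernel[OF eta_space K_kernel[OF eta_space] f, of r p r]
      K_Phi[OF _ eta_space, of p r] Phi_integral(2)[OF eta_space f, of r r] eta_Suc[OF f, of r]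
    by (simp add: Suc)
qed

definition w :: "nat \<Rightarrow> nat \<Rightarrow> real" where
  "w p k = Cov K p (\<eta> (p - 1)) (H p k) (H p k)"

lemma C_pos: "C > 0"
  using C_ge_1 by simp

lemma abs_H_le: "x \<in> space E \<Longrightarrow> \<bar>H p k x\<bar> \<le> C"
  using H_bounds[of x p k] by simp

lemma abs_H_sq_le: "x \<in> space E \<Longrightarrow> \<bar>(H p k x)\<^sup>2\<bar> \<le> C\<^sup>2"
  using power_mono[OF abs_H_le[of x p k], of 2] by simp

lemma H_sq_bounded_measurable: "(\<lambda>x. (H p k x)\<^sup>2) \<in> bounded_measurable E"
  using bounded_measurable_mult[OF H_bounded_measurable H_bounded_measurable, of p k p k]
  by (simp add: power2_eq_square)

lemma abs_kernel_H_le: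
  assumes "\<mu> \<in> \<P>"
  shows "\<bar>\<integral>y. H p k y \<partial>\<mu>\<bar> \<le> C" and "1 / C \<le> (\<integral>y. H p k y \<partial>\<mu>)" and "(\<integral>y. H p k y \<partial>\<mu>) \<le> C"
  using prob_integral_abs_le[OF assms H_bounded_measurable abs_H_le]
    prob_integral_ge[OF assms H_bounded_measurable H_bounds(1)]
    prob_integral_le[OF assms H_bounded_measurable H_bounds(2)] by blast+

lemma kernel_sq_bounded_measurable:
  assumes "\<mu> \<in> \<P>"
  shows "(\<lambda>x. (\<integral>y. H p k y \<partial>K q \<mu> x)\<^sup>2) \<in> bounded_measurable E"
  using bounded_measurable_mult[OF kernel_bounded_measurable[OF K_kernel[OF assms] H_bounded_measurable]
    kernel_bounded_measurable[OF K_kernel[OF assms] H_bounded_measurable], of q p k q p k]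
  by (simp add: power2_eq_square)

text \<open>In this form the terms can be compared one by one with the conditional variance, in
  which \<open>pred p\<close> and an average over particles take the places of
  \<open>\<eta> p\<close> and \<open>\<eta> (p - 1)\<close>.\<close>

lemma w_eq:
  "w p k = (\<integral>x. (H p k x)\<^sup>2 \<partial>\<eta> p) -
    (\<integral>x. (\<integral>y. H p k y \<partial>K p (\<eta> (p - 1)) x)\<^sup>2 \<partial>\<eta> (p - 1))"
proof -
  let ?\<eta> = "\<eta> (p - 1)"
  have "w p k = (\<integral>x. (\<integral>y. (H p k y)\<^sup>2 \<partial>K p ?\<eta> x) - (\<integral>y. H p k y \<partial>K p ?\<eta> x)\<^sup>2 \<partial>?\<eta>)"
    by (simp add: w_def Cov_def power2_eq_square)
  also have "\<dots> = (\<integral>x. \<integral>y. (H p k y)\<^sup>2 \<partial>K p ?\<eta> x \<partial>?\<eta>) - (\<integral>x. (\<integral>y. H p k y \<partial>K p ?\<eta> x)\<^sup>2 \<partial>?\<eta>)"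
    by (intro Bochner_Integration.integral_diff integrable_bounded_measurable[OF eta_space]
        kernel_bounded_measurable[OF K_kernel[OF eta_space]] H_sq_bounded_measurable
        kernel_sq_bounded_measurable[OF eta_space])
  finally show ?thesis
    using K_mean_eta[OF H_sq_bounded_measurable] by simp
qed

lemma w_bounds: "0 \<le> w p k" "w p k \<le> C\<^sup>2"
proof -
  let ?\<eta> = "\<eta> (p - 1)"
  have s: "space ?\<eta> = space E"
    using eta_space[of "p - 1"] by (auto simp: space_prob_algebra dest: sets_eq_imp_space_eq)
  have "0 \<le> (\<integral>x. (\<integral>y. (H p k y)\<^sup>2 \<partial>K p ?\<eta> x) - (\<integral>y. H p k y \<partial>K p ?\<eta> x)\<^sup>2 \<partial>?\<eta>)"
  proof (intro integral_nonneg_AE AE_I2)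
    fix x assume "x \<in> space ?\<eta>"
    with s measurable_space[OF K_kernel[OF eta_space]]
    have k: "K p ?\<eta> x \<in> \<P>" by auto
    then have "prob_space (K p ?\<eta> x)" by (simp add: space_prob_algebra)
    then interpret k: prob_space "K p ?\<eta> x" .
    show "0 \<le> (\<integral>y. (H p k y)\<^sup>2 \<partial>K p ?\<eta> x) - (\<integral>y. H p k y \<partial>K p ?\<eta> x)\<^sup>2"
      using k.variance_positive[of "H p k"]
      unfolding k.variance_eq[OF integrable_bounded_measurable[OF k H_bounded_measurable]
          integrable_bounded_measurable[OF k H_sq_bounded_measurable]] .
  qed
  then show "0 \<le> w p k" by (simp add: w_def Cov_def power2_eq_square)
  have "w p k \<le> (\<integral>x. (H p k x)\<^sup>2 \<partial>\<eta> p)"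
    unfolding w_eq by simp
  also have "\<dots> \<le> C\<^sup>2"
    using abs_H_sq_le by (intro prob_integral_le[OF eta_space H_sq_bounded_measurable]) fastforce
  finally show "w p k \<le> C\<^sup>2" .
qed

text \<open>The summands bound, in this order, the errors \<open>?D1\<close>, \<open>?D2\<close>
  (with its prefactor) and \<open>?D3\<close> of \<open>variance_error_bound\<close>, up to
  \<open>1 / sqrt N\<close>.\<close>

definition c3 :: real where
  "c3 = C\<^sup>2 * c2 + 2 * C\<^sup>2 * \<kappa> * c1 + C\<^sup>2 * c1"

lemma variance_error_bound:
  obtains Z where "integrable W Z" "expectation Z \<le> c3 / sqrt N"
    "\<And>e. e \<in> space W \<Longrightarrow>
      \<bar>(\<integral>x. (H p k x)\<^sup>2 \<partial>pred p e) - (\<Sum>i=1..N. (\<integral>y. H p k y \<partial>kern p i e)\<^sup>2) / N - w p k\<bar> \<le> Z e"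
proof -
  let ?\<eta> = "\<eta> (p - 1)" and ?h = "H p k"
  let ?k = "\<lambda>x. \<integral>y. ?h y \<partial>K p ?\<eta> x"
  \<comment> \<open>Division by \<open>C\<close> brings the values between 0 and 1, so the
    oscillation is at most 1, as the Lipschitz condition asks.\<close>
  let ?f = "\<lambda>x. (1 / C) * ?h x"
  note h2 = H_sq_bounded_measurable[of p k]
  have k2: "(\<lambda>x. (?k x)\<^sup>2) \<in> bounded_measurable E"
    by (rule kernel_sq_bounded_measurable[OF eta_space])
  have f: "?f \<in> bounded_measurable E" by (rule bounded_measurable_cmult[OF H_bounded_measurable])
  have osc: "\<bar>?f x - ?f y\<bar> \<le> 1" if "x \<in> space E" "y \<in> space E" for x y
  proof -
    have "0 < ?f x" "?f x \<le> 1" "0 < ?f y" "?f y \<le> 1"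
      using H_bounds(2,3)[OF that(1), of p k] H_bounds(2,3)[OF that(2), of p k] C_pos by simp_all
    then show ?thesis by linarith
  qed
  from K_Lipschitz[OF f osc eta_space, of p "p - 1"] obtain v where v: "v \<in> bounded_measurable E"
    "\<And>x. x \<in> space E \<Longrightarrow> \<bar>v x\<bar> \<le> 1"
    "\<And>\<mu> x. \<mu> \<in> \<P> \<Longrightarrow> x \<in> space E \<Longrightarrow>
      \<bar>(\<integral>y. ?f y \<partial>K p \<mu> x) - (\<integral>y. ?f y \<partial>K p ?\<eta> x)\<bar> \<le> \<kappa> * \<bar>(\<integral>x. v x \<partial>\<mu>) - (\<integral>x. v x \<partial>?\<eta>)\<bar>"
    by blast
  let ?D1 = "\<lambda>e. \<bar>(\<integral>x. (?h x)\<^sup>2 \<partial>pred p e) - (\<integral>x. (?h x)\<^sup>2 \<partial>\<eta> p)\<bar>"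
  let ?D2 = "\<lambda>e. \<bar>(\<integral>x. v x \<partial>emp (p - 1) e) - (\<integral>x. v x \<partial>?\<eta>)\<bar>"
  let ?D3 = "\<lambda>e. \<bar>(\<integral>x. (?k x)\<^sup>2 \<partial>emp (p - 1) e) - (\<integral>x. (?k x)\<^sup>2 \<partial>?\<eta>)\<bar>"
  let ?Z = "\<lambda>e. ?D1 e + 2 * C\<^sup>2 * \<kappa> * ?D2 e + ?D3 e"
  have int: "integrable W ?D1" "integrable W ?D2" "integrable W ?D3"
    using integrable_emp(4)[OF h2] integrable_emp(3)[OF v(1)] integrable_emp(3)[OF k2] by simp_all
  show thesis
  proof (rule that)
    show "integrable W ?Z" using int by simp
    have k2_le: "\<bar>(?k x)\<^sup>2\<bar> \<le> C\<^sup>2" if "x \<in> space E" for x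
      using power_mono[OF abs_kernel_H_le(1)[OF measurable_space[OF K_kernel[OF eta_space] that]], where n=2]
      by simp
    have "expectation ?Z = expectation ?D1 + 2 * C\<^sup>2 * \<kappa> * expectation ?D2 + expectation ?D3"
      using int by simp
    also have "\<dots> \<le> C\<^sup>2 * c2 / sqrt N + 2 * C\<^sup>2 * \<kappa> * (c1 / sqrt N) + C\<^sup>2 * c1 / sqrt N"
      using C_pos \<kappa>
      by (intro add_mono mult_left_mono pred_error_bound uniform_error_bound
          uniform_error_bound_scaled v abs_H_sq_le h2 k2 k2_le) auto
    also have "\<dots> = c3 / sqrt N" by (simp add: c3_def add_divide_distrib)
    finally show "expectation ?Z \<le> c3 / sqrt N" .
    fix e assume e: "e \<in> space W"
    let ?ki = "\<lambda>i. \<integral>y. ?h y \<partial>kern p i e" and ?x = "\<lambda>i. \<xi> (p - 1) i e"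
    \<comment> \<open>Difference of squares: the sum of the two kernel means is at most
      \<open>2 * C\<close>, their difference at most \<open>C * (\<kappa> * ?D2 e)\<close> once the
      scaling is undone.\<close>
    have dev: "\<bar>(?ki i)\<^sup>2 - (?k (?x i))\<^sup>2\<bar> \<le> 2 * C\<^sup>2 * \<kappa> * ?D2 e" if i: "i \<in> {1..N}" for i
    proof -
      have "\<bar>?ki i - ?k (?x i)\<bar> / C = \<bar>(\<integral>y. ?f y \<partial>kern p i e) - (\<integral>y. ?f y \<partial>K p ?\<eta> (?x i))\<bar>"
        using C_pos by (simp add: abs_divide flip: diff_divide_distrib)
      also have "\<dots> \<le> \<kappa> * ?D2 e"
        by (rule v(3)[OF emp_space[OF e] \<xi>_space[OF i e]])
      finally have d: "\<bar>?ki i - ?k (?x i)\<bar> \<le> C * (\<kappa> * ?D2 e)" using C_pos by (simp add: field_simps)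
      have "\<bar>?ki i\<bar> \<le> C" by (rule abs_kernel_H_le(1)[OF kern_space[OF i e]])
      moreover have "\<bar>?k (?x i)\<bar> \<le> C"
        by (rule abs_kernel_H_le(1)[OF measurable_space[OF K_kernel[OF eta_space] \<xi>_space[OF i e]]])
      ultimately have s: "\<bar>?ki i + ?k (?x i)\<bar> \<le> 2 * C" by linarith
      have "\<bar>(?ki i)\<^sup>2 - (?k (?x i))\<^sup>2\<bar> = \<bar>?ki i + ?k (?x i)\<bar> * \<bar>?ki i - ?k (?x i)\<bar>"
        by (simp add: square_diff_square_factored abs_mult[symmetric] power2_eq_square)
      also have "\<dots> \<le> 2 * C * (C * (\<kappa> * ?D2 e))"
        using C_pos by (intro mult_mono s d) auto
      finally show ?thesis by (simp add: power2_eq_square mult_ac)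
    qed
    have "\<bar>(\<Sum>i=1..N. (?ki i)\<^sup>2) - (\<Sum>i=1..N. (?k (?x i))\<^sup>2)\<bar> \<le> N * (2 * C\<^sup>2 * \<kappa> * ?D2 e)"
      unfolding sum_subtractf[symmetric]
      using sum_norm_bound[of "{1..N}" "\<lambda>i. (?ki i)\<^sup>2 - (?k (?x i))\<^sup>2"] dev by simp
    then have "\<bar>(\<Sum>i=1..N. (?ki i)\<^sup>2) - (\<Sum>i=1..N. (?k (?x i))\<^sup>2)\<bar> / N \<le> 2 * C\<^sup>2 * \<kappa> * ?D2 e"
      using N by (simp add: field_simps)
    then have "\<bar>(\<Sum>i=1..N. (?ki i)\<^sup>2) / N - (\<integral>x. (?k x)\<^sup>2 \<partial>emp (p - 1) e)\<bar> \<le> 2 * C\<^sup>2 * \<kappa> * ?D2 e"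
      unfolding integral_emp[OF e k2] by (simp add: abs_divide flip: diff_divide_distrib)
    then show "\<bar>(\<integral>x. (?h x)\<^sup>2 \<partial>pred p e) - (\<Sum>i=1..N. (?ki i)\<^sup>2) / N - w p k\<bar> \<le> ?Z e"
      unfolding w_eq by linarith
  qed
qed

text \<open>The cost of replacing \<open>v / m\<^sup>2\<close> by \<open>w\<close>, with
  \<open>v\<close> the conditional variance and \<open>m\<close> the predicted mean of
  \<open>H\<close>: the first summand is due to \<open>v - w\<close>, the second to
  \<open>m - 1\<close>, whose mean absolute value is at most \<open>C * c2 / sqrt N\<close>.\<close>

definition c4 :: real where
  "c4 = C\<^sup>2 * c3 + C ^ 4 * (1 + C) * (C * c2)"

text \<open>The three error terms of \<open>iexp_ln_increment\<close> for
  \<open>b = 1 / C\<^sup>2\<close>, with \<open>1 / (N * sqrt N)\<close> factored out.\<close>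

definition char_const :: "real \<Rightarrow> real" where
  "char_const t = (let \<theta> = (complex_of_real (t\<^sup>2) + \<i> * t) / 2 in
    (\<bar>t\<bar> + 2) ^ 3 * (C\<^sup>2) ^ 3 * (C ^ 3 * (12 * exp (C\<^sup>2))) + cmod \<theta> * c4 +
    exp (cmod \<theta> * C\<^sup>2) * (cmod \<theta>)\<^sup>2 * (C\<^sup>2)\<^sup>2)"

section \<open>One-step estimate for the ratios\<close>

definition R :: "nat \<Rightarrow> nat \<Rightarrow> 'w \<Rightarrow> real" where
  "R p k e = (\<integral>x. H p k x \<partial>emp p e) / (\<integral>x. H p k x \<partial>pred p e)"

text \<open>This is \<open>iexp_ln_increment\<close> for \<open>Y = R p k - 1\<close> and
  \<open>u = w p k / N\<close>. The third moment is of order N^(-3/2) by the exponential bound, the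
  variance error is \<open>1 / N\<close> times the error \<open>1 / sqrt N\<close> of the empirical
  measures, and \<open>u\<^sup>2\<close> is of order N^(-2).\<close>

lemma R_increment:
  fixes A :: "'w \<Rightarrow> complex" and t :: real and \<theta> :: complex
  defines "\<theta> \<equiv> (complex_of_real (t\<^sup>2) + \<i> * t) / 2"
  assumes A: "A \<in> borel_measurable (past' p)" "\<And>e. e \<in> space W \<Longrightarrow> cmod (A e) \<le> 1"
  shows "cmod (expectation (\<lambda>e. A e * (iexp (t * ln (R p k e)) - exp (- (\<theta> * (w p k / N))))))
    \<le> char_const t / (N * sqrt N)"
proof -
  interpret S: conditionally_independent W "past' p" E "{1..N}" "\<xi> p" "kern p"
    by (rule conditionally_independent_step)
  let ?h = "H p k"
  let ?m = "\<lambda>e. \<integral>x. ?h x \<partial>pred p e" and ?X = "\<lambda>e. \<integral>x. ?h x \<partial>emp p e"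
  let ?Y = "\<lambda>e. R p k e - 1"
  note h = H_bounded_measurable[of p k]
  have I: "{1..N} \<noteq> {}" and n: "real N > 0" "sqrt N > 0" using N by auto
  note mF = measurable_integral_pred[OF h, of p]
  note [measurable] = integrable_emp(1,2)[OF h] S.measurable_F[OF mF]
  have Am [measurable]: "A \<in> borel_measurable W"
    by (rule measurable_from_subalg[OF subalgebra_past A(1)])
  have m: "1 / C \<le> ?m e" "?m e \<le> C" "?m e > 0" and X: "1 / C \<le> ?X e" "?X e \<le> C" "?X e > 0"
    if "e \<in> space W" for e
    using abs_kernel_H_le(2,3)[OF pred_space[OF that, of p], of p k]
      abs_kernel_H_le(2,3)[OF emp_space[OF that, of p], of p k] C_pos
    by (auto intro: less_le_trans[of _ "1 / C"])
  have inv: "1 / ?m e \<le> C" if "e \<in> space W" for e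
    using m[OF that] C_pos by (simp add: field_simps)
  have Y: "?Y e = (S.avg ?h e - ?m e) * (1 / ?m e)" if "e \<in> space W" for e
    using m[OF that] unfolding step_avg(1)[OF h that] by (simp add: R_def field_simps)
  \<comment> \<open>The empirical and the predicted mean of \<open>H\<close> both lie between
    \<open>1 / C\<close> and \<open>C\<close>.\<close>
  have R1: "(1 / C\<^sup>2) \<le> R p k e" and R2: "R p k e \<le> C\<^sup>2" if "e \<in> space W" for e
  proof -
    have "(1 / C) * (1 / C) \<le> ?X e * (1 / ?m e)"
      using m[OF that] X[OF that] C_pos by (intro mult_mono) (auto simp: field_simps)
    then show "(1 / C\<^sup>2) \<le> R p k e" by (simp add: R_def power2_eq_square)
    have "?X e * (1 / ?m e) \<le> C * C"
      using m[OF that] X[OF that] C_pos inv[OF that] by (intro mult_mono) auto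
    then show "R p k e \<le> C\<^sup>2" by (simp add: R_def power2_eq_square)
  qed
  have RB: "\<bar>?Y e\<bar> \<le> 1 + C\<^sup>2" if "e \<in> space W" for e
  proof -
    have "0 \<le> R p k e" using m(3)[OF that] X(3)[OF that] by (simp add: R_def)
    with R2[OF that] show ?thesis by linarith
  qed
  have Rm [measurable]: "R p k \<in> borel_measurable W" unfolding R_def[abs_def] by measurable
  obtain v where vF: "v \<in> borel_measurable (past' p)"
    and v: "AE e in W. v e = S.kavg (\<lambda>x. (?h x)\<^sup>2) e - (\<Sum>i=1..N. (S.kint ?h i e)\<^sup>2) / card {1..N}"
    and var: "\<And>(A :: 'w \<Rightarrow> real) B. A \<in> borel_measurable (past' p) \<Longrightarrow>
      (\<And>e. e \<in> space W \<Longrightarrow> \<bar>A e\<bar> \<le> B) \<Longrightarrow>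
      expectation (\<lambda>e. A e * (S.avg ?h e - ?m e)\<^sup>2) = expectation (\<lambda>e. A e * (v e / card {1..N}))"
    using S.conditional_variance_avg[OF h mF step_avg(2)[OF h, symmetric] I] by blast
  note [measurable] = S.measurable_F[OF vF]
  obtain Z where Z: "integrable W Z" "expectation Z \<le> c3 / sqrt N"
    "\<And>e. e \<in> space W \<Longrightarrow>
      \<bar>(\<integral>x. (?h x)\<^sup>2 \<partial>pred p e) - (\<Sum>i=1..N. (\<integral>y. ?h y \<partial>kern p i e)\<^sup>2) / N - w p k\<bar> \<le> Z e"
    using variance_error_bound[where p=p and k=k] by blast
  \<comment> \<open>The conditional second moment of \<open>R - 1\<close>: the predicted mean is
    determined by the past, so it comes out as a squared factor.\<close>
  let ?V = "\<lambda>e. (1 / ?m e)\<^sup>2 * (v e / N)"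
  let ?e = "\<lambda>e. C\<^sup>2 * Z e + C ^ 4 * (1 + C) * \<bar>?m e - 1\<bar>"
  have int_e: "integrable W ?e"
    using Z(1) integrable_emp(4)[OF h, of p] by simp
  \<comment> \<open>Under \<open>\<eta> p\<close> the mean of \<open>H\<close> is 1, so the
    denominator is near 1, and \<open>1 / m\<^sup>2 - 1\<close> is
    \<open>(1 + m) * (1 - m) / m\<^sup>2\<close>.\<close>
  have AEV: "AE e in W. \<bar>?V e - w p k / N\<bar> \<le> ?e e / N"
    using v AE_space
  proof eventually_elim
    case (elim e)
    note m' = m[OF elim(2)] and inv' = inv[OF elim(2)]
    have "v e = (\<integral>x. (?h x)\<^sup>2 \<partial>pred p e) - (\<Sum>i=1..N. (\<integral>y. ?h y \<partial>kern p i e)\<^sup>2) / N"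
      using elim(1) unfolding step_avg(2)[OF H_sq_bounded_measurable elim(2)] S.kint_def by simp
    with Z(3)[OF elim(2)] have vZ: "\<bar>v e - w p k\<bar> \<le> Z e" by simp
    have i2: "(1 / ?m e)\<^sup>2 \<le> C\<^sup>2" using inv' m' by (intro power_mono) auto
    have gen: "l \<le> x' + y'"
      if "l = \<bar>x + y\<bar>" "\<bar>x\<bar> \<le> x'" "\<bar>y\<bar> \<le> z" "z = y'" for l x y x' y' z :: real
      using that by linarith
    have "N * (?V e - w p k / N) = (1 / ?m e)\<^sup>2 * (v e - w p k) +
        w p k * ((1 / ?m e)\<^sup>2 * ((1 + ?m e) * (1 - ?m e)))"
      using n m' by (simp add: field_simps power2_eq_square)
    then have "N * \<bar>?V e - w p k / N\<bar> = \<bar>(1 / ?m e)\<^sup>2 * (v e - w p k) +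
        w p k * ((1 / ?m e)\<^sup>2 * ((1 + ?m e) * (1 - ?m e)))\<bar>"
      by (metis abs_mult abs_of_nat)
    moreover have "\<bar>(1 / ?m e)\<^sup>2 * (v e - w p k)\<bar> \<le> C\<^sup>2 * Z e"
      unfolding abs_mult using i2 vZ by (intro mult_mono) auto
    moreover have "\<bar>w p k * ((1 / ?m e)\<^sup>2 * ((1 + ?m e) * (1 - ?m e)))\<bar> \<le>
        C\<^sup>2 * (C\<^sup>2 * ((1 + C) * \<bar>?m e - 1\<bar>))"
      unfolding abs_mult using w_bounds[of p k] i2 m' by (intro mult_mono) (auto simp: abs_minus_commute)
    moreover have "C\<^sup>2 * (C\<^sup>2 * ((1 + C) * \<bar>?m e - 1\<bar>)) = C ^ 4 * (1 + C) * \<bar>?m e - 1\<bar>"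
      by (simp add: power2_eq_square power4_eq_xxxx)
    ultimately have "N * \<bar>?V e - w p k / N\<bar> \<le> ?e e" by (rule gen)
    then show ?case using n by (simp add: field_simps)
  qed
  have Vm: "?V \<in> borel_measurable W" by measurable
  have int_d: "integrable W (\<lambda>e. ?V e - w p k / N)"
  proof (rule Bochner_Integration.integrable_bound)
    show "integrable W (\<lambda>e. ?e e / N)" using int_e by simp
    show "AE e in W. norm (?V e - w p k / N) \<le> norm (?e e / N)"
      using AEV
    proof eventually_elim
      case (elim e)
      then show ?case unfolding real_norm_def by (rule order_trans[OF _ abs_ge_self])
    qed
  qed (use Vm in measurable)
  then have int_V: "integrable W ?V"
    using Bochner_Integration.integrable_add[OF int_d, of "\<lambda>_. w p k / N"] by simp
  have dev: "expectation (\<lambda>e. \<bar>?V e - w p k / N\<bar>) \<le> c4 / (N * sqrt N)"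
  proof -
    have "expectation (\<lambda>e. \<bar>?V e - w p k / N\<bar>) \<le> expectation (\<lambda>e. ?e e / N)"
      using int_d int_e AEV by (intro integral_mono_AE) auto
    also have "\<dots> = (C\<^sup>2 * expectation Z + C ^ 4 * (1 + C) * expectation (\<lambda>e. \<bar>?m e - 1\<bar>)) / N"
      using Z(1) integrable_emp(4)[OF h, of p] by simp
    also have "\<dots> \<le> (C\<^sup>2 * (c3 / sqrt N) + C ^ 4 * (1 + C) * (C * c2 / sqrt N)) / N"
      using pred_error_bound[OF h C_pos abs_H_le, of p] Z(2) C_pos n
      by (intro divide_right_mono add_mono mult_left_mono) (auto simp: integral_H_eta)
    also have "\<dots> = c4 / (N * sqrt N)"
      using n by (simp add: c4_def add_divide_distrib mult_ac)
    finally show ?thesis .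
  qed
  have third: "expectation (\<lambda>e. \<bar>?Y e\<bar> ^ 3) \<le> C ^ 3 * (12 * exp (C\<^sup>2) / (N * sqrt N))"
  proof -
    let ?d = "\<lambda>e. \<bar>?X e - ?m e\<bar>"
    have int: "integrable W (\<lambda>e. ?d e ^ 3)"
    proof (rule integrable_const_bound[where B="(C + C) ^ 3"])
      show "AE e in W. norm (?d e ^ 3) \<le> (C + C) ^ 3"
      proof (intro AE_I2)
        fix e assume "e \<in> space W"
        then have "?d e \<le> C + C" using m[of e] X[of e] by linarith
        from power_mono[OF this, of 3] show "norm (?d e ^ 3) \<le> (C + C) ^ 3" by simp
      qed
    qed measurable
    have "expectation (\<lambda>e. \<bar>?Y e\<bar> ^ 3) \<le> expectation (\<lambda>e. C ^ 3 * ?d e ^ 3)"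
    proof (rule integral_mono')
      show "integrable W (\<lambda>e. C ^ 3 * ?d e ^ 3)" using int by simp
      fix e assume e: "e \<in> space W"
      have "?Y e = (?X e - ?m e) * (1 / ?m e)"
        using Y[OF e] unfolding step_avg(1)[OF h e] .
      then have "\<bar>?Y e\<bar> = (1 / ?m e) * ?d e"
        using m(3)[OF e] by (simp add: abs_mult abs_divide)
      also have "\<dots> \<le> C * ?d e" using inv[OF e] by (intro mult_right_mono) auto
      finally have "\<bar>?Y e\<bar> ^ 3 \<le> (C * ?d e) ^ 3" by (intro power_mono) auto
      then show "\<bar>?Y e\<bar> ^ 3 \<le> C ^ 3 * ?d e ^ 3" by (simp add: power_mult_distrib)
    qed (use C_pos in simp)
    also have "\<dots> \<le> C ^ 3 * (12 * exp (C\<^sup>2) / (N * sqrt N))"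
      unfolding integral_mult_right_zero
      using C_pos by (intro mult_left_mono local_moments(2)[OF h abs_H_le]) auto
    finally show ?thesis .
  qed
  have mean_real: "expectation (\<lambda>e. B e * ?Y e) = 0"
    if B: "B \<in> borel_measurable (past' p)" "\<And>e. e \<in> space W \<Longrightarrow> \<bar>B e\<bar> \<le> 1" for B :: "'w \<Rightarrow> real"
  proof -
    note [measurable] = S.measurable_F[OF B(1)]
    let ?B = "\<lambda>e. B e * (1 / ?m e)"
    have BF: "?B \<in> borel_measurable (past' p)" using B(1) mF by measurable
    have BC: "\<bar>?B e\<bar> \<le> 1 * C" if "e \<in> space W" for e
      unfolding abs_mult using B(2)[OF that] inv[OF that] m(3)[OF that] by (intro mult_mono) auto
    have eq: "expectation (\<lambda>e. ?B e * S.avg ?h e) = expectation (\<lambda>e. ?B e * ?m e)"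
      by (rule S.expectation_avg[OF h BF BC mF step_avg(2)[OF h, symmetric] I])
    have int: "integrable W (\<lambda>e. ?B e * g e)"
      if "\<And>e. e \<in> space W \<Longrightarrow> \<bar>g e\<bar> \<le> C" "g \<in> borel_measurable W" for g
    proof (rule integrable_const_bound[where B="1 * C * C"])
      show "AE e in W. norm (?B e * g e) \<le> 1 * C * C"
        unfolding real_norm_def abs_mult[of "?B _"] using BC that(1) C_pos
        by (intro AE_I2 mult_mono) auto
    qed (use that(2) in measurable)
    have "integrable W (\<lambda>e. ?B e * S.avg ?h e)"
      using abs_kernel_H_le(1)[OF emp_space]
      by (intro int S.measurable_avg[OF h]) (simp only: step_avg(1)[OF h])
    moreover have "integrable W (\<lambda>e. ?B e * ?m e)"
      using abs_kernel_H_le(1)[OF pred_space] by (intro int) auto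
    ultimately have "expectation (\<lambda>e. ?B e * S.avg ?h e - ?B e * ?m e) = 0"
      using eq by simp
    also have "expectation (\<lambda>e. ?B e * S.avg ?h e - ?B e * ?m e) = expectation (\<lambda>e. B e * ?Y e)"
      by (intro Bochner_Integration.integral_cong refl) (simp add: Y algebra_simps)
    finally show ?thesis .
  qed
  have var_real: "expectation (\<lambda>e. B e * (?Y e)\<^sup>2) = expectation (\<lambda>e. B e * ?V e)"
    if B: "B \<in> borel_measurable (past' p)" "\<And>e. e \<in> space W \<Longrightarrow> \<bar>B e\<bar> \<le> 1" for B :: "'w \<Rightarrow> real"
  proof -
    let ?B = "\<lambda>e. B e * (1 / ?m e)\<^sup>2"
    have BF: "?B \<in> borel_measurable (past' p)" using B(1) mF by measurable
    have BC: "\<bar>?B e\<bar> \<le> 1 * C\<^sup>2" if "e \<in> space W" for e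
      unfolding abs_mult using B(2)[OF that] power_mono[OF inv[OF that], of 2] m(3)[OF that]
      by (intro mult_mono) auto
    have "expectation (\<lambda>e. B e * (?Y e)\<^sup>2) = expectation (\<lambda>e. ?B e * (S.avg ?h e - ?m e)\<^sup>2)"
      by (intro Bochner_Integration.integral_cong refl) (simp add: Y power_mult_distrib power_divide)
    also have "\<dots> = expectation (\<lambda>e. ?B e * (v e / card {1..N}))"
      by (rule var[OF BF BC])
    finally show ?thesis by (simp add: mult.assoc)
  qed
  \<comment> \<open>Conditional expectations are real, so the complex weight is handled through its
    real and imaginary parts.\<close>
  have ReA: "(\<lambda>e. Re (A e)) \<in> borel_measurable (past' p)" "(\<lambda>e. Im (A e)) \<in> borel_measurable (past' p)"
    using A(1) by measurable
  have ReA1: "\<bar>Re (A e)\<bar> \<le> 1" "\<bar>Im (A e)\<bar> \<le> 1" if "e \<in> space W" for e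
    using A(2)[OF that] abs_Re_le_cmod[of "A e"] abs_Im_le_cmod[of "A e"] by auto
  have intA: "integrable W (\<lambda>e. A e * complex_of_real (g e))" if "integrable W g" for g
  proof (rule Bochner_Integration.integrable_bound[OF that])
    show "AE e in W. norm (A e * complex_of_real (g e)) \<le> norm (g e)"
      using A(2) by (intro AE_I2) (simp add: norm_mult mult_left_le_one_le)
  qed (use that in measurable)
  have intY: "integrable W (\<lambda>e. ?Y e ^ j)" for j
  proof (rule integrable_const_bound[where B="(1 + C\<^sup>2) ^ j"])
    show "AE e in W. norm (?Y e ^ j) \<le> (1 + C\<^sup>2) ^ j"
      using RB by (intro AE_I2) (simp add: power_abs power_mono)
  qed measurable
  have mean: "expectation (\<lambda>e. A e * complex_of_real (?Y e)) = 0"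
  proof -
    have "expectation (\<lambda>e. A e * complex_of_real (?Y e)) = expectation (\<lambda>e. 0 :: complex)"
      using mean_real[OF ReA(1) ReA1(1)] mean_real[OF ReA(2) ReA1(2)] intY[of 1]
      by (intro integral_complex_eqI intA) simp_all
    then show ?thesis by simp
  qed
  have var_c: "expectation (\<lambda>e. A e * complex_of_real ((?Y e)\<^sup>2)) =
      expectation (\<lambda>e. A e * complex_of_real (?V e))"
    using var_real[OF ReA(1) ReA1(1)] var_real[OF ReA(2) ReA1(2)]
    by (intro integral_complex_eqI intA intY int_V) simp_all
  have uN: "w p k / N \<le> C\<^sup>2"
  proof -
    have "w p k / N \<le> w p k / 1" using w_bounds[of p k] N by (intro divide_left_mono) auto
    then show ?thesis using w_bounds[of p k] by simp
  qed
  have b: "0 < 1 / C\<^sup>2" "1 / C\<^sup>2 \<le> 1" using C_ge_1 by auto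
  have "cmod (expectation (\<lambda>e. A e * (iexp (t * ln (1 + ?Y e)) - exp (- (\<theta> * (w p k / N))))))
    \<le> (\<bar>t\<bar> + 2) ^ 3 / (1 / C\<^sup>2) ^ 3 * (C ^ 3 * (12 * exp (C\<^sup>2) / (N * sqrt N))) +
      cmod \<theta> * (c4 / (N * sqrt N)) + exp (cmod \<theta> * C\<^sup>2) * (cmod \<theta>)\<^sup>2 * (w p k / N)\<^sup>2"
    unfolding \<theta>_def
    by (rule iexp_ln_increment[OF _ _ _ A(2) b _ RB int_V mean var_c _ uN dev third])
      (use R1 w_bounds N in auto)
  also have "\<dots> \<le> (\<bar>t\<bar> + 2) ^ 3 * (C\<^sup>2) ^ 3 * (C ^ 3 * (12 * exp (C\<^sup>2))) / (N * sqrt N) +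
      cmod \<theta> * c4 / (N * sqrt N) + exp (cmod \<theta> * C\<^sup>2) * (cmod \<theta>)\<^sup>2 * (C\<^sup>2)\<^sup>2 / (N * sqrt N)"
  proof (intro add_mono)
    have "(w p k / N)\<^sup>2 = (w p k)\<^sup>2 / (real N * real N)" by (simp add: power2_eq_square)
    also have "\<dots> \<le> (C\<^sup>2)\<^sup>2 / (N * sqrt N)"
    proof (intro frac_le power_mono w_bounds mult_left_mono)
      \<comment> \<open>This weakens \<open>N * N\<close> to \<open>N * sqrt N\<close>, the order of
        the other error terms.\<close>
      show "sqrt N \<le> N"
        using N real_le_lsqrt[of "real N" "real N"] by (simp add: power2_eq_square)
    qed (use n in auto)
    finally show "exp (cmod \<theta> * C\<^sup>2) * (cmod \<theta>)\<^sup>2 * (w p k / N)\<^sup>2 \<le>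
        exp (cmod \<theta> * C\<^sup>2) * (cmod \<theta>)\<^sup>2 * (C\<^sup>2)\<^sup>2 / (N * sqrt N)"
      by (simp only: times_divide_eq_right[symmetric]) (intro mult_left_mono; simp)
  qed (simp_all add: power_divide)
  also have "\<dots> = char_const t / (N * sqrt N)"
    by (simp add: char_const_def Let_def \<theta>_def add_divide_distrib)
  finally show ?thesis by simp
qed

section \<open>The telescoping product and the characteristic function of its logarithm\<close>

lemma past_mono:
  assumes "m \<le> n"
  shows "subalgebra (past' n) (past' m)"
  unfolding subalgebra_def space_past sets_past
  using assms by (intro conjI refl sigma_sets_mono') (blast intro: less_le_trans)

lemma measurable_R:
  assumes "p < n"
  shows "R p k \<in> borel_measurable (past' n)"
proof -
  have "(\<lambda>e. \<integral>x. H p k x \<partial>emp p e) \<in> borel_measurable (past' n)"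
    using assms by (rule measurable_integral_emp[OF H_bounded_measurable])
  moreover have "(\<lambda>e. \<integral>x. H p k x \<partial>pred p e) \<in> borel_measurable (past' n)"
    using assms by (intro measurable_from_subalg[OF past_mono measurable_integral_pred]
        H_bounded_measurable) simp
  ultimately show ?thesis unfolding R_def[abs_def] by measurable
qed

lemma R_pos:
  assumes "e \<in> space W"
  shows "R p k e > 0"
proof -
  have "0 < 1 / C" using C_pos by simp
  then show ?thesis
    unfolding R_def using abs_kernel_H_le(2)[OF emp_space[OF assms]] abs_kernel_H_le(2)[OF pred_space[OF assms]]
    by (intro divide_pos_pos) (blast intro: less_le_trans)+
qed

lemma R_eq:
  "R p k e = (\<integral>x. Q1 p k x \<partial>emp p e) / (\<integral>x. Q1 p k x \<partial>pred p e)"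
  using integral_Q1_pos[OF eta_space, of p p k] by (simp add: R_def H_def)

text \<open>The predicted mean of the next \<open>Q1\<close> is the empirical mean of the current
  one divided by that of \<open>G m\<close>. Numerators and denominators of consecutive ratios
  therefore cancel, and the means of the \<open>G m\<close> accumulate into
  \<open>gammaN\<close>.\<close>

lemma prod_R_eq_gammaN_bar:
  assumes e: "e \<in> space W"
  shows "(\<Prod>p<n. R p (n - p) e) = gammaN_bar E \<eta>\<^sub>0 M G N \<xi> n e"
proof -
  \<comment> \<open>The product up to time \<open>m\<close> retains one uncancelled numerator, the
    empirical mean of \<open>Q1 m (n - m)\<close>, which is 1 for \<open>m = n\<close>.\<close>
  have tel: "(\<Prod>p<Suc m. R p (n - p) e) * \<gamma> n (\<lambda>_. 1) =
      gammaN E G N \<xi> m e * (\<integral>x. Q1 m (n - m) x \<partial>emp m e)" if "m \<le> n" for m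
    using that
  proof (induction m)
    case 0
    have "(\<integral>x. Q1 0 n x \<partial>\<eta>\<^sub>0) = \<gamma> n (\<lambda>_. 1)"
      using chain_law_semigroup[OF eta0 bounded_measurable_const[where c=1], where p=0 and k=n]
      by (simp add: gamma_def)
    then show ?case
      using gamma_one_pos[of n] by (simp add: R_eq pred_def gammaN_def)
  next
    case (Suc m)
    let ?q = "Q1 (Suc m) (n - Suc m)"
    have k: "n - m = Suc (n - Suc m)" using Suc.prems by simp
    have "(\<integral>x. ?q x \<partial>pred (Suc m) e) = (\<integral>x. Q1 m (n - m) x \<partial>emp m e) / (\<integral>x. G m x \<partial>emp m e)"
      unfolding integral_pred_Suc[OF e Q1_bounded_measurable] k semigroup_backward ..
    then have Rm: "R (Suc m) (n - Suc m) e = (\<integral>x. ?q x \<partial>emp (Suc m) e) * (\<integral>x. G m x \<partial>emp m e) /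
        (\<integral>x. Q1 m (n - m) x \<partial>emp m e)"
      by (simp add: R_eq)
    have "(\<Prod>p<Suc (Suc m). R p (n - p) e) * \<gamma> n (\<lambda>_. 1) =
        gammaN E G N \<xi> m e * (\<integral>x. Q1 m (n - m) x \<partial>emp m e) * R (Suc m) (n - Suc m) e"
      using Suc by (simp add: mult_ac)
    also have "\<dots> = gammaN E G N \<xi> m e * (\<integral>x. G m x \<partial>emp m e) * (\<integral>x. ?q x \<partial>emp (Suc m) e)"
      using integral_Q1_pos[OF emp_space[OF e], of m m "n - m"] by (simp add: Rm)
    finally show ?case by (simp add: gammaN_def)
  qed
  have one: "(\<integral>x. Q1 n 0 x \<partial>\<mu>) = 1" if "\<mu> \<in> \<P>" for \<mu>
    using that prob_space.prob_space[of \<mu>] by (simp add: space_prob_algebra)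
  \<comment> \<open>At \<open>m = n\<close> the telescoped product also contains the factor of time
    \<open>n\<close>, which is 1, whereas the claim stops before \<open>n\<close>.\<close>
  have "R n 0 e = 1"
    unfolding R_eq one[OF emp_space[OF e]] one[OF pred_space[OF e]] by simp
  with tel[of n] one[OF emp_space[OF e]] gamma_one_pos[of n] show ?thesis
    by (simp add: gammaN_bar_def field_simps)
qed

text \<open>\<open>Qbar\<close> and \<open>H\<close> agree on \<open>space E\<close>, which is all
  that the integrals in \<open>Cov\<close> see.\<close>

lemma asym_var_eq: "asym_var E \<eta>\<^sub>0 M G K n = (\<Sum>p<n. w p (n - p))"
  unfolding asym_var_def w_def
proof (rule sum.cong[OF refl])
  fix p assume "p \<in> {..<n}"
  then have Qb: "Qbar E \<eta>\<^sub>0 M G p n (\<lambda>_. 1) x = H p (n - p) x" if "x \<in> space E" for x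
    using Qbar_eq_H[OF that, of p "n - p"] by simp
  have s: "space (\<eta> (p - 1)) = space E"
    using eta_space[of "p - 1"] by (auto simp: space_prob_algebra dest: sets_eq_imp_space_eq)
  have sK: "space (K p (\<eta> (p - 1)) x) = space E" if "x \<in> space E" for x
    using measurable_space[OF K_kernel[OF eta_space] that]
    by (auto simp: space_prob_algebra dest: sets_eq_imp_space_eq)
  show "Cov K p (\<eta> (p - 1)) (Qbar E \<eta>\<^sub>0 M G p n (\<lambda>_. 1)) (Qbar E \<eta>\<^sub>0 M G p n (\<lambda>_. 1)) =
      Cov K p (\<eta> (p - 1)) (H p (n - p)) (H p (n - p))"
    unfolding Cov_def
    by (intro Bochner_Integration.integral_cong arg_cong2[where f="(-)"] arg_cong2[where f="(*)"] refl)
      (simp_all only: s sK Qb)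
qed

lemma measurable_ln_gammaN_bar:
  "(\<lambda>e. ln (gammaN_bar E \<eta>\<^sub>0 M G N \<xi> n e)) \<in> borel_measurable W"
proof -
  have "(\<lambda>e. ln (\<Prod>p<n. R p (n - p) e)) \<in> borel_measurable W"
    using measurable_from_subalg[OF subalgebra_past measurable_R]
    by (intro borel_measurable_ln borel_measurable_prod) blast
  then show ?thesis
    by (rule measurable_cong[THEN iffD1, rotated]) (simp add: prod_R_eq_gammaN_bar)
qed

text \<open>The earlier factors are functions of the past of modulus 1, hence admissible weights in
  \<open>R_increment\<close>; the constants have modulus at most 1 because \<open>w\<close> and the
  real part of \<theta> are nonnegative.\<close>

lemma char_ln_gammaN_bar:
  fixes t :: real and \<theta> :: complex
  defines "\<theta> \<equiv> (complex_of_real (t\<^sup>2) + \<i> * t) / 2"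
  shows "cmod (expectation (\<lambda>e. iexp (t * ln (gammaN_bar E \<eta>\<^sub>0 M G N \<xi> n e))) -
      exp (- (\<theta> * (asym_var E \<eta>\<^sub>0 M G K n / N)))) \<le> n * (char_const t / (N * sqrt N))"
proof -
  let ?r = "\<lambda>p e. iexp (t * ln (R p (n - p) e))" and ?d = "\<lambda>p. exp (- (\<theta> * (w p (n - p) / N)))"
  have rm: "?r p \<in> borel_measurable (past' m)" if "p < m" for p m
  proof -
    note [measurable] = measurable_R[OF that, of "n - p"]
    show ?thesis by measurable
  qed
  have "cmod (expectation (\<lambda>e. \<Prod>p<n. ?r p e) - (\<Prod>p<n. ?d p)) \<le> n * (char_const t / (N * sqrt N))"
  proof (rule expectation_prod_diff_le)
    show "?r p \<in> borel_measurable W" for p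
      using measurable_from_subalg[OF subalgebra_past rm[of p "Suc p"]] by simp
    show "cmod (?d p) \<le> 1" for p
      using w_bounds(1)[of p "n - p"] by (simp add: \<theta>_def)
    show "cmod (expectation (\<lambda>e. (\<Prod>q<p. ?r q e) * (?r p e - ?d p))) \<le> char_const t / (N * sqrt N)" for p
      unfolding \<theta>_def
    proof (rule R_increment)
      show "(\<lambda>e. \<Prod>q<p. ?r q e) \<in> borel_measurable (past' p)"
        by (intro borel_measurable_prod rm) simp
      show "cmod (\<Prod>q<p. ?r q e) \<le> 1" for e
        unfolding prod_norm[symmetric] by (intro prod_le_1) simp
    qed
  qed simp
  also have "(\<Prod>p<n. ?d p) = exp (- (\<theta> * (asym_var E \<eta>\<^sub>0 M G K n / N)))"
    by (simp add: asym_var_eq sum_divide_distrib sum_distrib_left exp_sum[symmetric] sum_negf)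
  also have "expectation (\<lambda>e. \<Prod>p<n. ?r p e) =
      expectation (\<lambda>e. iexp (t * ln (gammaN_bar E \<eta>\<^sub>0 M G N \<xi> n e)))"
  proof (rule Bochner_Integration.integral_cong[OF refl])
    fix e assume e: "e \<in> space W"
    have "(\<Prod>p<n. ?r p e) = iexp (t * (\<Sum>p<n. ln (R p (n - p) e)))"
      by (simp add: exp_sum sum_distrib_left)
    also have "(\<Sum>p<n. ln (R p (n - p) e)) = ln (gammaN_bar E \<eta>\<^sub>0 M G N \<xi> n e)"
      unfolding prod_R_eq_gammaN_bar[OF e, symmetric] using R_pos[OF e, THEN less_imp_neq]
      by (intro ln_prod[symmetric]) auto
    finally show "(\<Prod>p<n. ?r p e) = iexp (t * ln (gammaN_bar E \<eta>\<^sub>0 M G N \<xi> n e))" .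
  qed
  finally show ?thesis .
qed

end

text \<open>The law is the image of the standard normal law under the map
  \<open>m + sqrt v * x\<close>, which reduces its characteristic function to the standard
  one.\<close>

lemma
  assumes v: "v > 0"
  shows real_distribution_normal_law: "real_distribution (normal_law m v)"
    and char_normal_law: "char (normal_law m v) t = iexp (t * m) * exp (- (t\<^sup>2 * v / 2))"
proof -
  let ?\<sigma> = "sqrt v"
  interpret std: real_distribution std_normal_distribution by (rule real_dist_normal_dist)
  have "distributed std_normal_distribution lborel (\<lambda>x. x) std_normal_density"
    by (auto simp: distributed_def distr_id2 normal_density_nonneg intro!: measurable_ident_sets)
  from std.normal_density_affine[OF this, of ?\<sigma> m] v
  have d: "distributed std_normal_distribution lborel (\<lambda>x. m + ?\<sigma> * x) (normal_density m ?\<sigma>)"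
    by simp
  have "normal_law m v = distr std_normal_distribution lborel (\<lambda>x. m + ?\<sigma> * x)"
    using distributed_distr_eq_density[OF d] v by (simp add: normal_law_def)
  also have "\<dots> = distr std_normal_distribution borel (\<lambda>x. m + ?\<sigma> * x)"
    by (rule distr_cong) auto
  finally have eq: "normal_law m v = distr std_normal_distribution borel (\<lambda>x. m + ?\<sigma> * x)" .
  show "real_distribution (normal_law m v)"
    unfolding eq by (rule std.real_distribution_distr) simp
  have "char (normal_law m v) t = (\<integral>x. iexp (t * (m + ?\<sigma> * x)) \<partial>std_normal_distribution)"
    unfolding eq char_def by (subst integral_distr) auto
  also have "\<dots> = (\<integral>x. iexp (t * m) * iexp ((t * ?\<sigma>) * x) \<partial>std_normal_distribution)"
    by (simp add: exp_add[symmetric] algebra_simps)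
  also have "\<dots> = iexp (t * m) * char std_normal_distribution (t * ?\<sigma>)"
    by (simp add: char_def)
  also have "char std_normal_distribution (t * ?\<sigma>) = exp (- (t\<^sup>2 * v / 2))"
    using v by (simp add: char_std_normal_distribution power_mult_distrib exp_of_real)
  finally show "char (normal_law m v) t = iexp (t * m) * exp (- (t\<^sup>2 * v / 2))" .
qed

section \<open>From the extended-real hypotheses to the locales\<close>

lemma bounded_measurable_Osc: "f \<in> Osc E \<Longrightarrow> f \<in> bounded_measurable E"
  and Osc_le: "f \<in> Osc E \<Longrightarrow> x \<in> space E \<Longrightarrow> y \<in> space E \<Longrightarrow> \<bar>f x - f y\<bar> \<le> 1"
proof -
  show osc: "\<bar>f x - f y\<bar> \<le> 1" if "f \<in> Osc E" "x \<in> space E" "y \<in> space E" for x y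
  proof -
    have "ereal \<bar>f x - f y\<bar> \<le> osc E f"
      unfolding osc_def using that by (intro SUP_upper2[of x] SUP_upper2[of y]) auto
    also have "\<dots> \<le> 1" using that by (simp add: Osc_def)
    finally show ?thesis by simp
  qed
  show "f \<in> bounded_measurable E" if f: "f \<in> Osc E"
  proof (cases "space E = {}")
    case False
    then obtain z where z: "z \<in> space E" by blast
    have "\<bar>f x\<bar> \<le> \<bar>f z\<bar> + 1" if "x \<in> space E" for x
      using osc[OF f that z] by linarith
    then show ?thesis using f by (intro bounded_measurableI) (auto simp: Osc_def)
  qed (use f in \<open>auto simp: Osc_def bounded_measurable_def\<close>)
qed

lemma OscI:
  assumes "f \<in> borel_measurable E"
    and "\<And>x y. x \<in> space E \<Longrightarrow> y \<in> space E \<Longrightarrow> \<bar>f x - f y\<bar> \<le> 1"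
  shows "f \<in> Osc E"
  using assms by (auto simp: Osc_def osc_def intro!: SUP_least)

text \<open>The supremum is finite and positive, so an infimum equal to 0 would make the ratio
  infinite. A finite bound thus forces a positive infimum, and the quotient is one of real
  numbers.\<close>

lemma le_sup_inf_ratio:
  assumes G: "G \<in> bounded_measurable E" "\<And>x. x \<in> space E \<Longrightarrow> G x > 0"
    and le: "sup_inf_ratio E G \<le> ereal g" and xy: "x \<in> space E" "y \<in> space E"
  shows "G x \<le> g * G y"
proof -
  let ?S = "SUP x\<in>space E. ereal (G x)" and ?I = "INF x\<in>space E. ereal (G x)"
  obtain B where B: "\<And>x. x \<in> space E \<Longrightarrow> \<bar>G x\<bar> \<le> B" using bounded_measurable_bound[OF G(1)] by blast
  have "?S \<le> ereal B" using B by (intro SUP_least) (auto dest: abs_le_D1)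
  moreover have Sx: "ereal (G z) \<le> ?S" and Iz: "?I \<le> ereal (G z)" if "z \<in> space E" for z
    using that by (auto intro: SUP_upper INF_lower)
  moreover have I0: "0 \<le> ?I" using G(2) by (intro INF_greatest) (auto intro: less_imp_le)
  ultimately obtain s i where s: "?S = ereal s" and i: "?I = ereal i"
    using Sx[OF xy(1)] Iz[OF xy(1)] I0
    by (cases ?S; cases ?I) auto
  have s0: "0 < s" using Sx[OF xy(1)] G(2)[OF xy(1)] s by simp
  have "i \<noteq> 0"
  proof
    assume "i = 0"
    then have "sup_inf_ratio E G = \<infinity>"
      using s i s0 by (simp add: sup_inf_ratio_def divide_ereal_def)
    with le show False by simp
  qed
  with I0 i have i0: "i > 0" by simp
  have "s / i \<le> g" using le s i i0 by (simp add: sup_inf_ratio_def)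
  then have "s \<le> g * i" using i0 by (simp add: field_simps)
  moreover have "G x \<le> s" using Sx[OF xy(1)] s by simp
  moreover have "i \<le> G y" using Iz[OF xy(2)] i by simp
  moreover have "0 \<le> g" using \<open>s / i \<le> g\<close> s0 i0 by (meson divide_pos_pos less_imp_le less_le_trans)
  ultimately show ?thesis using mult_left_mono[of i "G y" g] by linarith
qed

text \<open>Each population size \<open>L\<close> has its own probability space
  \<open>\<Omega> L\<close>, since convergence in distribution involves the laws alone.\<close>

theorem theorem1p1:
  fixes E \<eta>\<^sub>0 :: "'a measure"
    and M :: "nat \<Rightarrow> 'a \<Rightarrow> 'a measure"
    and G :: "nat \<Rightarrow> 'a \<Rightarrow> real"
    and K :: "nat \<Rightarrow> 'a measure \<Rightarrow> 'a \<Rightarrow> 'a measure"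
    and T :: "nat \<Rightarrow> ('a \<Rightarrow> real) \<Rightarrow> 'a measure \<Rightarrow> 'a \<Rightarrow> real"
    and \<Omega> :: "nat \<Rightarrow> 'w measure"
    and \<xi> :: "nat \<Rightarrow> nat \<Rightarrow> nat \<Rightarrow> 'w \<Rightarrow> 'a"
    and N :: "nat \<Rightarrow> nat"
    and a lam \<kappa> \<alpha> \<sigma> :: real
  assumes eta0: "\<eta>\<^sub>0 \<in> space (prob_algebra E)"
    and M: "\<And>n. n \<ge> 1 \<Longrightarrow> M n \<in> E \<rightarrow>\<^sub>M prob_algebra E"
    and G: "\<And>n. G n \<in> bounded_measurable E"
    and G_pos: "\<And>n x. x \<in> space E \<Longrightarrow> G n x > 0"
    and K: "\<And>n \<mu>. n \<ge> 1 \<Longrightarrow> \<mu> \<in> space (prob_algebra E) \<Longrightarrow> K n \<mu> \<in> E \<rightarrow>\<^sub>M prob_algebra E"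
    and K_Phi: "\<And>n \<mu>. n \<ge> 1 \<Longrightarrow> \<mu> \<in> space (prob_algebra E) \<Longrightarrow> Phi M G n \<mu> = bind \<mu> (K n \<mu>)"
    and K_0: "\<And>\<mu> x. \<mu> \<in> space (prob_algebra E) \<Longrightarrow> x \<in> space E \<Longrightarrow> K 0 \<mu> x = \<eta>\<^sub>0"
    and particles: "\<And>L. L \<ge> 1 \<Longrightarrow> particle_system E \<eta>\<^sub>0 K (\<Omega> L) L (\<xi> L)"
    and g_n: "\<And>n. sup_inf_ratio E (G n) < \<infinity>"
    and g: "(SUP n. sup_inf_ratio E (G n)) < \<infinity>"
    and lam: "lam > 0"
    and mixing: "\<And>p n. p \<le> n \<Longrightarrow>
      dobrushin E (P_kernel E M G p n) \<le> ereal (a * exp (- lam * real (n - p)))"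
    and T: "\<And>n f \<mu>. f \<in> Osc E \<Longrightarrow> \<mu> \<in> space (prob_algebra E) \<Longrightarrow> T n f \<mu> \<in> Osc E"
    and K_Lipschitz: "\<And>n f \<mu>1 \<mu>2. f \<in> Osc E \<Longrightarrow>
      \<mu>1 \<in> space (prob_algebra E) \<Longrightarrow> \<mu>2 \<in> space (prob_algebra E) \<Longrightarrow>
      sup_norm E (\<lambda>x. (\<integral>y. f y \<partial>K n \<mu>1 x) - (\<integral>y. f y \<partial>K n \<mu>2 x))
        \<le> ereal (\<kappa> * \<bar>(\<integral>x. T n f \<mu>2 x \<partial>\<mu>1) - (\<integral>x. T n f \<mu>2 x \<partial>\<mu>2)\<bar>)"
    and N: "\<And>n. N n \<ge> 1"
    and N_lim: "(\<lambda>n. real n / real (N n)) \<longlonglongrightarrow> \<alpha>"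
    and \<alpha>: "\<alpha> > 0"
    and v_lim: "(\<lambda>n. asym_var E \<eta>\<^sub>0 M G K n / real n) \<longlonglongrightarrow> \<sigma>\<^sup>2"
    and \<sigma>: "\<sigma>\<^sup>2 > 0"
  shows "(\<forall>(W :: 'v measure) V.
            centered_gaussian_fields W E (\<lambda>p. Cov K p (eta E \<eta>\<^sub>0 M G (p - 1))) V \<longrightarrow>
            (\<forall>n. (\<Sum>p<n. \<integral>\<omega>. (V p (Qbar E \<eta>\<^sub>0 M G p n (\<lambda>_. 1)) \<omega>)\<^sup>2 \<partial>W) =
                   asym_var E \<eta>\<^sub>0 M G K n))
         \<and> weak_conv_m
             (\<lambda>n. distr (\<Omega> (N n)) borel (\<lambda>\<omega>. ln (gammaN_bar E \<eta>\<^sub>0 M G (N n) (\<xi> (N n)) n \<omega>)))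
             (normal_law (- (1/2) * \<alpha> * \<sigma>\<^sup>2) (\<alpha> * \<sigma>\<^sup>2))"
proof -
  obtain z where z: "z \<in> space E"
  proof -
    from eta0 have "prob_space \<eta>\<^sub>0" "sets \<eta>\<^sub>0 = sets E" by (auto simp: space_prob_algebra)
    then show ?thesis using that prob_space.not_empty sets_eq_imp_space_eq by blast
  qed
  obtain g' where g': "\<And>n. sup_inf_ratio E (G n) \<le> ereal g'"
  proof (cases "SUP n. sup_inf_ratio E (G n)")
    case (real r)
    then show ?thesis using that[of r] SUP_upper[of _ UNIV "\<lambda>n. sup_inf_ratio E (G n)"] by auto
  next
    case MInf
    then show ?thesis using that[of 0] SUP_upper[of _ UNIV "\<lambda>n. sup_inf_ratio E (G n)"] by auto
  qed (use g in simp)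
  \<comment> \<open>Enlarging the constants keeps the hypotheses valid and gives them the signs that
    the locales require.\<close>
  define a' where "a' = max a 1"
  define \<kappa>' where "\<kappa>' = max \<kappa> 0"
  interpret stable_feynman_kac E \<eta>\<^sub>0 M G g' a' lam
  proof unfold_locales
    show "G n x \<le> g' * G n y" if "x \<in> space E" "y \<in> space E" for n x y
      using G G_pos g' that by (rule le_sup_inf_ratio)
    show "a' > 0" by (simp add: a'_def)
    fix p k :: nat and f x y
    assume f: "f \<in> bounded_measurable E"
      "\<And>x y. x \<in> space E \<Longrightarrow> y \<in> space E \<Longrightarrow> \<bar>f x - f y\<bar> \<le> 1"
      and xy: "x \<in> space E" "y \<in> space E"
    let ?P = "P_kernel E M G p (p + k)"
    have "f \<in> Osc E" using f by (intro OscI bounded_measurableD)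
    then have "ereal \<bar>?P f x - ?P f y\<bar> \<le> dobrushin E ?P"
      unfolding dobrushin_def using xy
      by (intro SUP_upper2[of x] SUP_upper2[of y] SUP_upper2[of f]) auto
    also have "\<dots> \<le> ereal (a * exp (- lam * real (p + k - p)))" by (rule mixing) simp
    finally have "\<bar>?P f x - ?P f y\<bar> \<le> a * exp (- lam * k)" by simp
    also have "\<dots> \<le> a' * exp (- lam * k)" by (intro mult_right_mono) (auto simp: a'_def)
    finally show "\<bar>?P f x - ?P f y\<bar> \<le> a' * exp (- lam * k)" .
  qed (fact eta0 M G G_pos lam | assumption)+
  have Lipschitz: "\<exists>v\<in>bounded_measurable E. (\<forall>x\<in>space E. \<bar>v x\<bar> \<le> 1) \<and>
      (\<forall>\<mu>1\<in>space (prob_algebra E). \<forall>x\<in>space E.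
        \<bar>(\<integral>y. f y \<partial>K n \<mu>1 x) - (\<integral>y. f y \<partial>K n \<mu>2 x)\<bar> \<le> \<kappa>' * \<bar>(\<integral>x. v x \<partial>\<mu>1) - (\<integral>x. v x \<partial>\<mu>2)\<bar>)"
    if f: "f \<in> bounded_measurable E"
      "\<And>x y. x \<in> space E \<Longrightarrow> y \<in> space E \<Longrightarrow> \<bar>f x - f y\<bar> \<le> 1"
      and \<mu>2: "\<mu>2 \<in> space (prob_algebra E)" for n f \<mu>2
  proof -
    let ?T = "T n f \<mu>2"
    have fO: "f \<in> Osc E" using f by (intro OscI bounded_measurableD)
    have TO: "?T \<in> Osc E" by (rule T[OF fO \<mu>2])
    note Tb = bounded_measurable_Osc[OF TO]
    \<comment> \<open>Subtracting the value at \<open>z\<close> turns oscillation at most 1 into a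
      bound by 1 and changes no difference of integrals.\<close>
    let ?v = "\<lambda>x. ?T x - ?T z"
    have int_v: "(\<integral>x. ?v x \<partial>\<mu>) = (\<integral>x. ?T x \<partial>\<mu>) - ?T z" if "\<mu> \<in> space (prob_algebra E)" for \<mu>
    proof -
      have "prob_space \<mu>" using that by (simp add: space_prob_algebra)
      then interpret \<mu>: prob_space \<mu> .
      show ?thesis using integrable_bounded_measurable[OF that Tb] by (simp add: \<mu>.prob_space)
    qed
    have "\<bar>(\<integral>y. f y \<partial>K n \<mu>1 x) - (\<integral>y. f y \<partial>K n \<mu>2 x)\<bar> \<le> \<kappa>' * \<bar>(\<integral>x. ?v x \<partial>\<mu>1) - (\<integral>x. ?v x \<partial>\<mu>2)\<bar>"
      if \<mu>1: "\<mu>1 \<in> space (prob_algebra E)" and x: "x \<in> space E" for \<mu>1 x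
    proof -
      have "ereal \<bar>(\<integral>y. f y \<partial>K n \<mu>1 x) - (\<integral>y. f y \<partial>K n \<mu>2 x)\<bar> \<le>
          sup_norm E (\<lambda>x. (\<integral>y. f y \<partial>K n \<mu>1 x) - (\<integral>y. f y \<partial>K n \<mu>2 x))"
        unfolding sup_norm_def using x by (rule SUP_upper)
      also note K_Lipschitz[OF fO \<mu>1 \<mu>2, of n]
      finally have "\<bar>(\<integral>y. f y \<partial>K n \<mu>1 x) - (\<integral>y. f y \<partial>K n \<mu>2 x)\<bar> \<le>
          \<kappa> * \<bar>(\<integral>x. ?T x \<partial>\<mu>1) - (\<integral>x. ?T x \<partial>\<mu>2)\<bar>" by simp
      also have "\<dots> \<le> \<kappa>' * \<bar>(\<integral>x. ?T x \<partial>\<mu>1) - (\<integral>x. ?T x \<partial>\<mu>2)\<bar>"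
        by (intro mult_right_mono) (auto simp: \<kappa>'_def)
      finally show ?thesis by (simp add: int_v \<mu>1 \<mu>2)
    qed
    moreover have "\<forall>x\<in>space E. \<bar>?v x\<bar> \<le> 1" using Osc_le[OF TO _ z] by blast
    moreover have "?v \<in> bounded_measurable E" by (intro bounded_measurable_diff Tb bounded_measurable_const)
    ultimately show ?thesis by (intro bexI[of _ ?v] conjI) simp_all
  qed
  \<comment> \<open>A separate particle model for every \<open>n\<close>, of size
    \<open>N n\<close>, with constants common to all.\<close>
  interpret P: particle_model E \<eta>\<^sub>0 M G g' a' lam K \<kappa>' "\<Omega> (N n)" "N n" "\<xi> (N n)" for n
  proof unfold_locales
    show "particle_system E \<eta>\<^sub>0 K (\<Omega> (N n)) (N n) (\<xi> (N n))" by (rule particles[OF N])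
  qed (fact K K_Phi K_0 Lipschitz N | simp add: \<kappa>'_def)+
  \<comment> \<open>The fields are indexed by bounded measurable functions, so \<open>Qbar\<close>
    has to be recognised as one before the covariance formula applies.\<close>
  have gaussian: "(\<Sum>p<n. \<integral>\<omega>. (V p (Qbar E \<eta>\<^sub>0 M G p n (\<lambda>_. 1)) \<omega>)\<^sup>2 \<partial>W) = asym_var E \<eta>\<^sub>0 M G K n"
    if V: "centered_gaussian_fields W E (\<lambda>p. Cov K p (eta E \<eta>\<^sub>0 M G (p - 1))) V" for W :: "'v measure" and V n
    unfolding asym_var_def
  proof (rule sum.cong[OF refl])
    fix p assume "p \<in> {..<n}"
    then have eq: "Qbar E \<eta>\<^sub>0 M G p n (\<lambda>_. 1) x = H p (n - p) x" if "x \<in> space E" for x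
      using Qbar_eq_H[OF that, of p "n - p"] by simp
    have "Qbar E \<eta>\<^sub>0 M G p n (\<lambda>_. 1) \<in> borel_measurable E"
      using bounded_measurableD[OF H_bounded_measurable]
      by (rule measurable_cong[THEN iffD2, rotated]) (rule eq)
    moreover obtain B where "\<And>x. x \<in> space E \<Longrightarrow> \<bar>H p (n - p) x\<bar> \<le> B"
      using bounded_measurable_bound[OF H_bounded_measurable] by blast
    ultimately have "Qbar E \<eta>\<^sub>0 M G p n (\<lambda>_. 1) \<in> bounded_measurable E"
      by (intro bounded_measurableI) (auto simp: eq)
    with V show "(\<integral>\<omega>. (V p (Qbar E \<eta>\<^sub>0 M G p n (\<lambda>_. 1)) \<omega>)\<^sup>2 \<partial>W) =
        Cov K p (eta E \<eta>\<^sub>0 M G (p - 1)) (Qbar E \<eta>\<^sub>0 M G p n (\<lambda>_. 1)) (Qbar E \<eta>\<^sub>0 M G p n (\<lambda>_. 1))"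
      unfolding centered_gaussian_fields_def power2_eq_square by blast
  qed
  have v: "\<alpha> * \<sigma>\<^sup>2 > 0" using \<alpha> \<sigma> by simp
  let ?X = "\<lambda>n \<omega>. ln (gammaN_bar E \<eta>\<^sub>0 M G (N n) (\<xi> (N n)) n \<omega>)"
  \<comment> \<open>\<open>1 / N\<close> is \<open>n / N\<close> times \<open>1 / n\<close>, except
    at \<open>n = 0\<close>, where division by zero gives 0.\<close>
  have N_inv: "(\<lambda>n. 1 / real (N n)) \<longlonglongrightarrow> 0"
  proof -
    have "(\<lambda>n. real n / real (N n) * (1 / real n)) \<longlonglongrightarrow> \<alpha> * 0"
      by (intro tendsto_mult N_lim lim_1_over_n)
    moreover have "\<forall>\<^sub>F n in sequentially. real n / real (N n) * (1 / real n) = 1 / real (N n)"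
      using eventually_gt_at_top[of 0] by eventually_elim simp
    ultimately show ?thesis by (simp add: tendsto_cong)
  qed
  have "weak_conv_m (\<lambda>n. distr (\<Omega> (N n)) borel (?X n))
      (normal_law (- (1/2) * \<alpha> * \<sigma>\<^sup>2) (\<alpha> * \<sigma>\<^sup>2))"
  proof (rule levy_continuity)
    show "real_distribution (distr (\<Omega> (N n)) borel (?X n))" for n
      by (rule P.real_distribution_distr[OF P.measurable_ln_gammaN_bar])
    show "real_distribution (normal_law (- (1/2) * \<alpha> * \<sigma>\<^sup>2) (\<alpha> * \<sigma>\<^sup>2))"
      by (rule real_distribution_normal_law[OF v])
    fix t :: real
    define \<theta> where "\<theta> = (complex_of_real (t\<^sup>2) + \<i> * t) / 2"
    let ?u = "\<lambda>n. asym_var E \<eta>\<^sub>0 M G K n / real (N n)"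
    \<comment> \<open>The error is split into \<open>n / N\<close>, which converges, and a multiple
      of N^(-1/2), which tends to 0.\<close>
    have bound: "cmod (char (distr (\<Omega> (N n)) borel (?X n)) t - exp (- (\<theta> * ?u n)))
        \<le> real n / real (N n) * (P.char_const t * sqrt (1 / real (N n)))" for n
    proof -
      have "char (distr (\<Omega> (N n)) borel (?X n)) t = P.expectation n (\<lambda>\<omega>. iexp (t * ?X n \<omega>))"
        unfolding char_def using P.measurable_ln_gammaN_bar by (intro integral_distr) auto
      then show ?thesis
        using P.char_ln_gammaN_bar[of n t n] by (simp add: \<theta>_def real_sqrt_divide)
    qed
    have "(\<lambda>n. real n / real (N n) * (P.char_const t * sqrt (1 / real (N n)))) \<longlonglongrightarrow> \<alpha> * (P.char_const t * sqrt 0)"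
      by (intro tendsto_mult N_lim tendsto_const tendsto_real_sqrt N_inv)
    then have "(\<lambda>n. real n / real (N n) * (P.char_const t * sqrt (1 / real (N n)))) \<longlonglongrightarrow> 0"
      by simp
    then have diff: "(\<lambda>n. char (distr (\<Omega> (N n)) borel (?X n)) t - exp (- (\<theta> * ?u n))) \<longlonglongrightarrow> 0"
      by (rule Lim_null_comparison[rotated]) (intro always_eventually allI bound)
    have lim: "(\<lambda>n. exp (- (\<theta> * ?u n))) \<longlonglongrightarrow> exp (- (\<theta> * complex_of_real (\<alpha> * \<sigma>\<^sup>2)))"
    proof -
      have "(\<lambda>n. real n / real (N n) * (asym_var E \<eta>\<^sub>0 M G K n / real n)) \<longlonglongrightarrow> \<alpha> * \<sigma>\<^sup>2"
        by (intro tendsto_mult N_lim v_lim)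
      moreover have "\<forall>\<^sub>F n in sequentially.
          real n / real (N n) * (asym_var E \<eta>\<^sub>0 M G K n / real n) = ?u n"
        using eventually_gt_at_top[of 0] by eventually_elim simp
      ultimately have "?u \<longlonglongrightarrow> \<alpha> * \<sigma>\<^sup>2" by (simp add: tendsto_cong)
      then show ?thesis by (intro tendsto_intros)
    qed
    have "(\<lambda>n. char (distr (\<Omega> (N n)) borel (?X n)) t) \<longlonglongrightarrow>
        exp (- (\<theta> * complex_of_real (\<alpha> * \<sigma>\<^sup>2)))"
      using tendsto_add[OF diff lim] by simp
    \<comment> \<open>With \<open>v\<close> for \<open>\<alpha> * \<sigma>\<^sup>2\<close> the
      exponent is \<open>- t\<^sup>2 * v / 2 - \<i> * t * v / 2\<close>, that of a normal law with
      mean \<open>- v / 2\<close> and variance \<open>v\<close>.\<close>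
    also have "exp (- (\<theta> * complex_of_real (\<alpha> * \<sigma>\<^sup>2))) =
        char (normal_law (- (1/2) * \<alpha> * \<sigma>\<^sup>2) (\<alpha> * \<sigma>\<^sup>2)) t"
      unfolding char_normal_law[OF v] exp_of_real[symmetric] exp_add[symmetric]
      by (intro arg_cong[where f=exp]) (simp add: \<theta>_def field_simps)
    finally show "(\<lambda>n. char (distr (\<Omega> (N n)) borel (?X n)) t) \<longlonglongrightarrow>
        char (normal_law (- (1/2) * \<alpha> * \<sigma>\<^sup>2) (\<alpha> * \<sigma>\<^sup>2)) t" .
  qed
  with gaussian show ?thesis by blast
qed

end
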